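(* Let $V\in C_b(\mathbb X\times\mathcal P(\mathbb X))$. Assume: (1) $\mathbb A$ is compact; (2) $\mathring{\overline G}$ and all $\overline G^\lambda_{t,\xi}$ are nondecreasing; (3) there are $c_0,c_1>0$ with $\|\overline G^\lambda_{t,\xi}v\|_\infty\le c_0+c_1\|v\|_\infty$ for all $t,\lambda,\xi$ and $v\in B_b(\mathbb X)$; (4) there is $\bar c>0$ with $|\mathring{\overline G}v-\mathring{\overline G}v'|\le\bar c\int|v-v'|\,d\mathring\xi$ and $|\overline G^\lambda_{t,\xi}v(x)-\overline G^\lambda_{t,\xi}v'(x)|\le\bar c\int|v-v'|\,dQ^\lambda_{t,x,\xi}$ for all $t,\lambda,\xi,x$ and $v,v'\in B_b(\mathbb X)$; (5) $\overline G^{\gamma\lambda+(1-\gamma)\lambda'}_{t,\xi}v\le\gamma\overline G^\lambda_{t,\xi}v+(1-\gamma)\overline G^{\lambda'}_{t,\xi}v$ for all $t,\xi,\lambda,\lambda'$, $v\in B_b(\mathbb X)$, $\gamma\in(0,1)$; (6) there are an increasing sequence of compact sets $\check K_i\subseteq\mathbb X$, $i\in\mathbb N$, a constant $\check c\ge1$ and a continuous $\sigma:\mathbb X\to\mathbb R$ with $\inf_{x\in\check K_i^c}\sigma(x)\ge i$ for all $i\in\mathbb N$ (with $\inf\emptyset=\infty$), $\int\sigma\,d\mathring\xi\le\check c$, and $\int_{\mathbb X}\sigma(y)P_{t,x,\xi,a}(dy)\le\check c\,\sigma(x)$ for all $(t,x,\xi,a)\in\{1,\dots,T-1\}\times\mathbb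 X\times\mathcal P(\mathbb X)\times\mathbb A$; (7) for each $t$, $(x,\xi,a)\mapsto P_{t,x,\xi,a}$ is weakly continuous on $\mathbb X\times\mathcal P(\mathbb X)\times\mathbb A$; (8) for each $t=1,\dots,T-1$ and $v\in C_b(\mathbb X)$, $(x,\xi,\lambda)\mapsto\overline G^\lambda_{t,\xi}v(x)$ is continuous on $\mathbb X\times\mathcal P(\mathbb X)\times\mathcal P(\mathbb A)$. Then there is a mean field flow $\Psi^*$ such that $\overline{\mathfrak R}(\Psi^*;V)=0$.
   Context: $\mathbb X$ and $\mathbb A$ are complete separable metric spaces. For a Polish space $\mathbb Y$, $\mathcal P(\mathbb Y)$ is the set of Borel probability measures with the weak topology; $B_b(\mathbb Y)$, $C_b(\mathbb Y)$ are the bounded Borel, resp. bounded continuous, real functions. All maps are Borel measurable. $T\ge2$; $P_t:\mathbb X\times\mathcal P(\mathbb X)\times\mathbb A\to\mathcal P(\mathbb X)$, written $P_{t,x,\xi,a}$, $t=1,\dots,T-1$, are transition kernels; $\mathring\xi\in\mathcal P(\mathbb X)$ is the initial law; $Q^\lambda_{t,x,\xi}(B)=\int_{\mathbb A}P_{t,x,\xi,a}(B)\lambda(da)$. Score operators. $\overline G^\lambda_{t,\xi}:B_b(\mathbb X)\to B_b(\mathbb X)$ ($t=1,\dots,T-1$, $\lambda\in\mathcal P(\mathbb A)$, $\xi\in\mathcal P(\mathbb X)$) and $\mathring{\overline G}:B_b(\mathbb X)\to\mathbb R$ are given, with $(x,\xi,\lambda)\mapsto\overline G^\lambda_{t,\xi}v(x)$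 Borel for each $v\in B_b(\mathbb X)$. For a kernel $\overline\pi:\mathbb X\to\mathcal P(\mathbb A)$, $\overline S^{\overline\pi}_{t,\xi}v(x)=\overline G^{\overline\pi_x}_{t,\xi}v(x)$; $\overline S^*_{t,\xi}v(x)=\inf_{\lambda\in\mathcal P(\mathbb A)}\overline G^\lambda_{t,\xi}v(x)$; for $\Xi=(\xi_1,\dots,\xi_{T-1})$, $\overline{\mathcal S}^*_{s,t,\Xi}=\overline S^*_{s,\xi_s}\circ\cdots\circ\overline S^*_{t-1,\xi_{t-1}}$ (identity if $s=t$). Mean field flow. For $\psi\in\mathcal P(\mathbb X\times\mathbb A)$, $\xi^\psi$ is its $\mathbb X$-marginal and $\overline\pi^\psi:\mathbb X\to\mathcal P(\mathbb A)$ is a kernel with $\psi(B\times A)=\int_B\overline\pi^\psi_x(A)\xi^\psi(dx)$. $\Psi=(\psi_1,\dots,\psi_{T-1})\in\mathcal P(\mathbb X\times\mathbb A)^{T-1}$ is a mean field flow if $\xi^{\psi_1}=\mathring\xi$ and $\xi^{\psi_{t+1}}(B)=\int P_{t,y,\xi^{\psi_t},a}(B)\psi_t(dy\,da)$ for Borel $B$, $t=1,\dots,T-2$. $\Xi^\Psi=(\xi^{\psi_1},\dots,\xi^{\psi_{T-1}})$ and $V_\Psi(x)=V\big(x,\int P_{T-1,y,\xi^{\psi_{T-1}},a}(\cdot)\psi_{T-1}(dy\,da)\big)$. Mean field total exploitability: $\overline{\mathfrak R}(\Psi;V)=\sum_{t=1}^{T-1}\bar c^{\,t}\int_{\mathbb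 X}\big(\overline S^{\overline\pi^{\psi_t}}_{t,\xi^{\psi_t}}\circ\overline{\mathcal S}^*_{t+1,T,\Xi^\Psi}V_\Psi-\overline{\mathcal S}^*_{t,T,\Xi^\Psi}V_\Psi\big)d\xi^{\psi_t}$, with $\bar c$ the constant in (4). *)

theory Defs
  imports "HOL-Probability.Probability"
begin

definition Bb :: "('a::topological_space \<Rightarrow> real) set" where
  "Bb = {v \<in> borel_measurable borel. bounded (range v)}"

definition Cb :: "'a topology \<Rightarrow> ('a \<Rightarrow> real) set" where
  "Cb T = {f. continuous_map T euclideanreal f \<and> bounded (f ` topspace T)}"

definition sup_norm :: "('a \<Rightarrow> real) \<Rightarrow> real" where
  "sup_norm v = (SUP x. \<bar>v x\<bar>)"

definition borel_probs :: "'a::topological_space measure set" where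
  "borel_probs = {M. sets M = sets borel \<and> prob_space M}"

text \<open>The coarsest topology on \<open>borel_probs\<close> that makes \<open>M \<mapsto> \<integral> f dM\<close> continuous for every bounded
  continuous \<open>f\<close>. Its underlying set is all of \<open>borel_probs\<close> (take \<open>U = UNIV\<close>).\<close>

definition weak_topology :: "'a::topological_space measure topology" where
  "weak_topology = topology_generated_by
     {{M \<in> borel_probs. (\<integral>x. f x \<partial>M) \<in> U} | f U. f \<in> Cb euclidean \<and> open U}"

definition borel_of :: "'a topology \<Rightarrow> 'a measure" where
  "borel_of T = sigma (topspace T) {U. openin T U}"

definition kernel :: "('x::topological_space \<Rightarrow> 'a::topological_space measure) \<Rightarrow> bool" where
  "kernel p \<longleftrightarrow> p \<in> measurable borel (borel_of weak_topology)"

text \<open>The convex combination \<open>\<gamma> M + (1 - \<gamma>) N\<close> of two measures on the same \<open>\<sigma>\<close>-algebra.\<close>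

definition mixture :: "real \<Rightarrow> 'a measure \<Rightarrow> 'a measure \<Rightarrow> 'a measure" where
  "mixture \<gamma> M N = measure_of (space M) (sets M)
     (\<lambda>B. ennreal \<gamma> * emeasure M B + ennreal (1 - \<gamma>) * emeasure N B)"

text \<open>In the following, \<open>P t x \<xi> a\<close> is the transition kernel and \<open>G t \<xi> \<mu> v x\<close> the score operator with
  parameters \<open>t, \<xi>, \<mu>\<close>, applied to \<open>v\<close> and evaluated at \<open>x\<close>. Their values matter only for
  \<open>\<xi>\<close> and \<open>\<mu>\<close> in \<open>borel_probs\<close>. \<open>Q P t x \<xi> \<mu>\<close> is the mixture \<open>B \<mapsto> \<integral> P t x \<xi> a B \<mu>(da)\<close>,
  written as the bind of the Giry monad.\<close>

definition Q ::
  "(nat \<Rightarrow> 'x::topological_space \<Rightarrow> 'x measure \<Rightarrow> 'a::topological_space \<Rightarrow> 'x measure) \<Rightarrow>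
   nat \<Rightarrow> 'x \<Rightarrow> 'x measure \<Rightarrow> 'a measure \<Rightarrow> 'x measure" where
  "Q P t x \<xi> \<mu> = \<mu> \<bind> P t x \<xi>"

definition S_pol ::
  "(nat \<Rightarrow> 'x measure \<Rightarrow> 'a measure \<Rightarrow> ('x \<Rightarrow> real) \<Rightarrow> 'x \<Rightarrow> real) \<Rightarrow>
   nat \<Rightarrow> 'x measure \<Rightarrow> ('x \<Rightarrow> 'a measure) \<Rightarrow> ('x \<Rightarrow> real) \<Rightarrow> 'x \<Rightarrow> real" where
  "S_pol G t \<xi> p v x = G t \<xi> (p x) v x"

definition S_opt ::
  "(nat \<Rightarrow> 'x measure \<Rightarrow> 'a::topological_space measure \<Rightarrow> ('x \<Rightarrow> real) \<Rightarrow> 'x \<Rightarrow> real) \<Rightarrow>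
   nat \<Rightarrow> 'x measure \<Rightarrow> ('x \<Rightarrow> real) \<Rightarrow> 'x \<Rightarrow> real" where
  "S_opt G t \<xi> v x = (INF \<mu>\<in>borel_probs. G t \<xi> \<mu> v x)"

text \<open>\<open>S_opt G s (\<Xi> s) \<circ> \<dots> \<circ> S_opt G (t - 1) (\<Xi> (t - 1))\<close>, the identity if \<open>s = t\<close>.\<close>

definition S_comp ::
  "(nat \<Rightarrow> 'x measure \<Rightarrow> 'a::topological_space measure \<Rightarrow> ('x \<Rightarrow> real) \<Rightarrow> 'x \<Rightarrow> real) \<Rightarrow>
   nat \<Rightarrow> nat \<Rightarrow> (nat \<Rightarrow> 'x measure) \<Rightarrow> ('x \<Rightarrow> real) \<Rightarrow> ('x \<Rightarrow> real)" where
  "S_comp G s t \<Xi> = foldr (\<circ>) (map (\<lambda>r. S_opt G r (\<Xi> r)) [s..<t]) id"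

definition marg ::
  "('x::topological_space \<times> 'a::topological_space) measure \<Rightarrow> 'x measure" where
  "marg \<psi> = distr \<psi> borel fst"

definition disintegrates ::
  "('x::topological_space \<times> 'a::topological_space) measure \<Rightarrow> ('x \<Rightarrow> 'a measure) \<Rightarrow> bool" where
  "disintegrates \<psi> p \<longleftrightarrow> kernel p \<and>
     (\<forall>B\<in>sets borel. \<forall>C\<in>sets borel.
        emeasure \<psi> (B \<times> C) = (\<integral>\<^sup>+x\<in>B. emeasure (p x) C \<partial>marg \<psi>))"

text \<open>Such a kernel exists on Polish spaces. It is determined by \<open>\<psi>\<close> only up to a \<open>marg \<psi>\<close>-null set of \<open>x\<close>; one version is
  selected by choice. The exploitability below does not depend on the version, because
  \<open>S_pol G t \<xi> p v x\<close> depends on \<open>p\<close> only through \<open>p x\<close>.\<close>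

definition pol ::
  "('x::topological_space \<times> 'a::topological_space) measure \<Rightarrow> 'x \<Rightarrow> 'a measure" where
  "pol \<psi> = (SOME p. disintegrates \<psi> p)"

text \<open>The law \<open>B \<mapsto> \<integral> P t y (marg \<psi>) a B \<psi>(dy da)\<close>, as a bind of the Giry monad.\<close>

definition next_law ::
  "(nat \<Rightarrow> 'x::topological_space \<Rightarrow> 'x measure \<Rightarrow> 'a::topological_space \<Rightarrow> 'x measure) \<Rightarrow>
   nat \<Rightarrow> ('x \<times> 'a) measure \<Rightarrow> 'x measure" where
  "next_law P t \<psi> = \<psi> \<bind> (\<lambda>(y, a). P t y (marg \<psi>) a)"

text \<open>Flows are functions on \<open>nat\<close>, of which only the values at \<open>1, \<dots>, T - 1\<close> are used.\<close>

definition mean_field_flow ::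
  "nat \<Rightarrow> (nat \<Rightarrow> 'x::topological_space \<Rightarrow> 'x measure \<Rightarrow> 'a::topological_space \<Rightarrow> 'x measure) \<Rightarrow>
   'x measure \<Rightarrow> (nat \<Rightarrow> ('x \<times> 'a) measure) \<Rightarrow> bool" where
  "mean_field_flow T P \<xi>0 \<Psi> \<longleftrightarrow>
     (\<forall>t\<in>{1..T-1}. \<Psi> t \<in> borel_probs) \<and>
     marg (\<Psi> 1) = \<xi>0 \<and>
     (\<forall>t\<in>{1..T-2}. marg (\<Psi> (t + 1)) = next_law P t (\<Psi> t))"

definition V_flow ::
  "nat \<Rightarrow> (nat \<Rightarrow> 'x::topological_space \<Rightarrow> 'x measure \<Rightarrow> 'a::topological_space \<Rightarrow> 'x measure) \<Rightarrow>
   ('x \<times> 'x measure \<Rightarrow> real) \<Rightarrow> (nat \<Rightarrow> ('x \<times> 'a) measure) \<Rightarrow> 'x \<Rightarrow> real" where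
  "V_flow T P V \<Psi> x = V (x, next_law P (T - 1) (\<Psi> (T - 1)))"

definition mf_exploitability ::
  "nat \<Rightarrow> (nat \<Rightarrow> 'x::topological_space \<Rightarrow> 'x measure \<Rightarrow> 'a::topological_space \<Rightarrow> 'x measure) \<Rightarrow>
   (nat \<Rightarrow> 'x measure \<Rightarrow> 'a measure \<Rightarrow> ('x \<Rightarrow> real) \<Rightarrow> 'x \<Rightarrow> real) \<Rightarrow> real \<Rightarrow>
   (nat \<Rightarrow> ('x \<times> 'a) measure) \<Rightarrow> ('x \<times> 'x measure \<Rightarrow> real) \<Rightarrow> real" where
  "mf_exploitability T P G cbar \<Psi> V =
     (let \<Xi> = (\<lambda>t. marg (\<Psi> t)); W = V_flow T P V \<Psi> in
      \<Sum>t=1..T-1. cbar ^ t *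
        (\<integral>x. (S_pol G t (\<Xi> t) (pol (\<Psi> t)) (S_comp G (t + 1) T \<Xi> W) x
              - S_comp G t T \<Xi> W x) \<partial>(\<Xi> t)))"

end

theory Submission
  imports Defs
begin

text \<open>The equilibrium is the limit, as \<open>\<epsilon> \<longlonglongrightarrow> 0\<close>, of equilibria of games in which a strictly convex penalty of
  weight \<open>\<epsilon>\<close> is added to the cost of a randomised action.

  Given the laws \<open>\<Xi> 1, \<dots>, \<Xi> T\<close> of the population, the value functions are defined backwards from the terminal cost. They
  are jointly continuous in the state and in the laws (lemma \<open>regular\<close>): the Lipschitz condition on the score operators reduces
  their continuity at a varying value function to that at a fixed one, and minima over the compact space of randomised actions
  depend continuously on the parameters. Since the operators are convex in the randomised action, the penalised cost has exactly
  one minimiser, which is continuous in the state and in the laws (\<open>best_tendsto\<close>). Moving the population by these best responses is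
  a continuous map of sequences of laws. The condition on \<open>\<sigma>\<close> bounds a moment of the law at every time, so the map acts on a
  convex set that is compact by Prokhorov's theorem (\<open>prokhorov\<close>, \<open>wcompact_moment\<close>), and it has a fixed point
  (\<open>penalised_equilibrium\<close>).

  As \<open>\<epsilon>\<close> tends to \<open>0\<close>, the joint laws of state and action converge along a subsequence, and their limit \<open>\<Psi>\<close> is a
  mean field flow. It remains to show that the disintegration of \<open>\<Psi> t\<close> takes optimal values almost surely. Weak convergence
  of joint laws does not imply convergence of their disintegrations. However, the optimal randomised actions at a state form a
  closed convex set, and every limit of penalised minimisers at nearby states belongs to it; a separation argument shows that
  this suffices (\<open>limit_kernel_in_convex\<close>).

  The convex analysis of probability measures is done in the Hilbert cube: the integrals of countably many test functions embed
  the measures (\<open>crd\<close>), and the cube carries the inner product of a weighted \<open>\<ell>\<^sup>2\<close> space. The nearest-point map onto a convex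
  compact set (\<open>prj\<close>) serves several purposes. It extends maps to the whole cube, where a fixed point is found with Kuhn's
  combinatorial lemma (\<open>cube_fixpoint\<close>); it separates points from convex sets; and it
  constructs the disintegration itself, by projecting the conditional expectations of the test functions to the set of
  coordinates of probability measures (\<open>disintegration_exists\<close>).\<close>

section \<open>Weak convergence of sequences of probability measures\<close>

lemma borel_probs_eq: "borel_probs = space (prob_algebra borel)"
  by (auto simp: borel_probs_def space_prob_algebra)

lemma borel_probsD:
  assumes "M \<in> borel_probs"
  shows "prob_space M" "sets M = sets borel" "space M = UNIV"
  using assms sets_eq_imp_space_eq[of M borel] by (auto simp: borel_probs_def)

lemma borel_probsI: "prob_space M \<Longrightarrow> sets M = sets borel \<Longrightarrow> M \<in> borel_probs"
  by (simp add: borel_probs_def)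

lemma Cb_euclidean_iff:
  "f \<in> Cb euclidean \<longleftrightarrow> continuous_on UNIV f \<and> (\<exists>B. \<forall>x. \<bar>f x\<bar> \<le> B)"
  unfolding Cb_def by (auto simp: bounded_iff)

lemma Cb_borel: "f \<in> Cb euclidean \<Longrightarrow> f \<in> borel_measurable borel"
  by (auto simp: Cb_euclidean_iff intro: borel_measurable_continuous_onI)

lemma Cb_subset_Bb: "Cb euclidean \<subseteq> Bb"
  by (auto simp: Bb_def Cb_borel) (auto simp: Cb_def)

lemma integrable_borel_probs:
  fixes f :: "'b::topological_space \<Rightarrow> real"
  assumes "M \<in> borel_probs" "f \<in> borel_measurable borel" "\<And>x. \<bar>f x\<bar> \<le> B"
  shows "integrable M f"
proof -
  interpret prob_space M using borel_probsD(1)[OF assms(1)] .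
  show ?thesis
    by (rule integrable_const_bound[of _ B])
      (use assms borel_probsD(2)[OF assms(1)] in \<open>auto cong: measurable_cong_sets\<close>)
qed

lemma integral_bounded_borel_probs:
  fixes f :: "'b::topological_space \<Rightarrow> real"
  assumes "M \<in> borel_probs" "f \<in> borel_measurable borel" "\<And>x. \<bar>f x\<bar> \<le> B"
  shows "\<bar>\<integral>x. f x \<partial>M\<bar> \<le> B"
proof -
  interpret prob_space M using borel_probsD(1)[OF assms(1)] .
  have i: "integrable M f" by (rule integrable_borel_probs[OF assms])
  have "\<bar>\<integral>x. f x \<partial>M\<bar> \<le> (\<integral>x. \<bar>f x\<bar> \<partial>M)" by (rule integral_abs_bound)
  also have "\<dots> \<le> (\<integral>x. B \<partial>M)" using i assms(3) by (intro integral_mono) auto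
  finally show ?thesis by (simp add: prob_space)
qed

text \<open>Limits of measures are taken along sequences, and compactness of sets of measures is sequential compactness. The topology
  \<open>weak_topology\<close> itself matters only for the hypotheses of continuity and for the notion of a kernel.\<close>

definition wconv :: "(nat \<Rightarrow> 'b::topological_space measure) \<Rightarrow> 'b measure \<Rightarrow> bool" where
  "wconv M N \<longleftrightarrow> (\<forall>n. M n \<in> borel_probs) \<and> N \<in> borel_probs \<and>
     (\<forall>f\<in>Cb euclidean. (\<lambda>n. \<integral>x. f x \<partial>M n) \<longlonglongrightarrow> (\<integral>x. f x \<partial>N))"

lemma wconv_compose:
  assumes "wconv M N" "filterlim r at_top sequentially"
  shows "wconv (\<lambda>k. M (r k)) N"
proof -
  have "(\<lambda>k. \<integral>x. f x \<partial>M (r k)) \<longlonglongrightarrow> (\<integral>x. f x \<partial>N)" if "f \<in> Cb euclidean" for f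
    by (rule filterlim_compose[OF _ assms(2)]) (use assms(1) that in \<open>simp add: wconv_def\<close>)
  then show ?thesis using assms(1) by (simp add: wconv_def)
qed

lemma wconv_const: "M \<in> borel_probs \<Longrightarrow> wconv (\<lambda>n. M) M"
  by (simp add: wconv_def)

lemma topspace_weak: "topspace (weak_topology :: 'b::topological_space measure topology) = borel_probs"
proof -
  have "(\<lambda>x. 0) \<in> Cb (euclidean :: 'b topology)" by (auto simp: Cb_euclidean_iff)
  then have "borel_probs \<in> {{M \<in> borel_probs. (\<integral>x. f x \<partial>M) \<in> U} | f U. f \<in> Cb (euclidean :: 'b topology) \<and> open U}"
    by (auto intro!: exI[of _ "\<lambda>x. 0"] exI[of _ UNIV])
  then show ?thesis unfolding weak_topology_def topology_generated_by_topspace by auto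
qed

text \<open>Whether a sequence is eventually in a generated open set can be tested on the generators, by induction
  over the generation of the set.\<close>

lemma wconv_imp_limitin:
  assumes "wconv M N"
  shows "limitin weak_topology M N sequentially"
proof -
  have "\<forall>\<^sub>F n in sequentially. M n \<in> U"
    if "generate_topology_on {{M \<in> borel_probs. (\<integral>x. f x \<partial>M) \<in> U} | f U. f \<in> Cb euclidean \<and> open U} U" "N \<in> U" for U
    using that
  proof induction
    case Empty then show ?case by simp
  next
    case (Int a b) then show ?case by (auto intro: eventually_conj)
  next
    case (UN K)
    then obtain k where k: "k \<in> K" "N \<in> k" by blast
    then have "\<forall>\<^sub>F n in sequentially. M n \<in> k" using UN by blast
    then show ?case by (rule eventually_mono) (use k in blast)
  next
    case (Basis s)
    then obtain f U where s: "s = {M \<in> borel_probs. (\<integral>x. f x \<partial>M) \<in> U}" "f \<in> Cb euclidean" "open U" by blast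
    then have "(\<lambda>n. \<integral>x. f x \<partial>M n) \<longlonglongrightarrow> (\<integral>x. f x \<partial>N)" using assms by (simp add: wconv_def)
    then have "\<forall>\<^sub>F n in sequentially. (\<integral>x. f x \<partial>M n) \<in> U"
      by (rule topological_tendstoD) (use s Basis in auto)
    then show ?case using assms by (simp add: s wconv_def)
  qed
  moreover have "N \<in> topspace weak_topology" using assms by (simp add: topspace_weak wconv_def)
  ultimately show ?thesis
    unfolding limitin_def by (auto simp: weak_topology_def openin_topology_generated_by_iff)
qed

lemma openin_weak_subbasis:
  "f \<in> Cb euclidean \<Longrightarrow> open U \<Longrightarrow> openin weak_topology {M \<in> borel_probs. (\<integral>x. f x \<partial>M) \<in> U}"
  unfolding weak_topology_def openin_topology_generated_by_iff
  by (rule generate_topology_on.Basis, rule CollectI, rule exI[of _ f], rule exI[of _ U]) simp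

lemma limitin_imp_wconv:
  assumes "limitin weak_topology M N sequentially" "\<And>n. M n \<in> borel_probs"
  shows "wconv M N"
proof -
  have N: "N \<in> borel_probs" using limitin_topspace[OF assms(1)] by (simp add: topspace_weak)
  have "(\<lambda>n. \<integral>x. f x \<partial>M n) \<longlonglongrightarrow> (\<integral>x. f x \<partial>N)" if f: "f \<in> Cb euclidean" for f
  proof (rule topological_tendstoI)
    fix S :: "real set" assume S: "open S" "(\<integral>x. f x \<partial>N) \<in> S"
    then have "\<forall>\<^sub>F n in sequentially. M n \<in> {M \<in> borel_probs. (\<integral>x. f x \<partial>M) \<in> S}"
      using openin_weak_subbasis[OF f S(1)] assms(1) N unfolding limitin_def by blast
    then show "\<forall>\<^sub>F n in sequentially. (\<integral>x. f x \<partial>M n) \<in> S" by (rule eventually_mono) simp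
  qed
  with N assms show ?thesis by (simp add: wconv_def)
qed

text \<open>Continuous functions that decrease to the indicator of a closed set. The empty set is treated separately
  because \<open>infdist x {} = 0\<close>.\<close>

definition bump :: "'b::metric_space set \<Rightarrow> nat \<Rightarrow> 'b \<Rightarrow> real" where
  "bump F m x = (if F = {} then 0 else max 0 (1 - real m * infdist x F))"

lemma bump_bounds: "0 \<le> bump F m x" "bump F m x \<le> 1" "\<bar>bump F m x\<bar> \<le> 1"
  by (simp_all add: bump_def infdist_nonneg)

lemma continuous_bump: "continuous_on UNIV (bump F m)"
proof -
  have "bump F m = (if F = {} then (\<lambda>x. 0) else (\<lambda>x. max 0 (1 - real m * infdist x F)))"
    by (auto simp: bump_def)
  then show ?thesis by (auto intro!: continuous_intros)
qed

lemma bump_Cb: "bump F m \<in> Cb euclidean"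
  unfolding Cb_euclidean_iff using continuous_bump bump_bounds(3) by (intro conjI exI[of _ 1] allI)

lemma bump_borel [measurable]: "bump F m \<in> borel_measurable borel"
  by (rule Cb_borel[OF bump_Cb])

lemma bump_eq_1: "x \<in> F \<Longrightarrow> bump F m x = 1"
  by (auto simp: bump_def)

lemma bump_tendsto: assumes "closed F" shows "(\<lambda>m. bump F m x) \<longlonglongrightarrow> indicator F x"
proof (cases "x \<in> F")
  case True then show ?thesis by (simp add: bump_eq_1)
next
  case False
  show ?thesis
  proof (cases "F = {}")
    case True then show ?thesis by (simp add: bump_def)
  next
    case ne: False
    have pos: "infdist x F > 0"
      using False assms ne infdist_nonneg[of x F] in_closed_iff_infdist_zero[of F x] by (simp add: less_le)
    have "\<forall>\<^sub>F m in sequentially. bump F m x = 0"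
    proof -
      obtain n where "real n > 1 / infdist x F" using reals_Archimedean2 by blast
      then have "bump F m x = 0" if "m \<ge> n" for m
      proof -
        have "real m > 1 / infdist x F" using that \<open>real n > _\<close> by linarith
        then have "real m * infdist x F > 1" using pos by (simp add: field_simps)
        then show ?thesis using ne by (simp add: bump_def)
      qed
      then show ?thesis by (auto simp: eventually_sequentially)
    qed
    then have "(\<lambda>m. bump F m x) \<longlonglongrightarrow> 0" by (rule tendsto_eventually)
    then show ?thesis using False by simp
  qed
qed

lemma integral_bump_tendsto:
  assumes "finite_measure M" "sets M = sets borel" "closed F"
  shows "(\<lambda>m. \<integral>x. bump F m x \<partial>M) \<longlonglongrightarrow> measure M F"
proof -
  interpret finite_measure M by fact
  note [measurable_cong] = assms(2)
  have F: "F \<in> sets M" using assms(2,3) by simp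
  have "(\<lambda>m. \<integral>x. bump F m x \<partial>M) \<longlonglongrightarrow> (\<integral>x. indicator F x \<partial>M)"
  proof (rule integral_dominated_convergence[where w="\<lambda>x. 1"])
    show "indicat_real F \<in> borel_measurable M" using F by (rule borel_measurable_indicator)
    show "AE x in M. (\<lambda>m. bump F m x) \<longlonglongrightarrow> indicator F x"
      by (intro AE_I2 bump_tendsto assms(3))
    show "AE x in M. norm (bump F m x) \<le> 1" for m
      by (intro AE_I2) (simp add: bump_bounds)
  qed simp_all
  then show ?thesis using F by simp
qed

text \<open>The half of the portmanteau theorem about closed sets: the indicator of \<open>F\<close> lies below the bounded
  continuous function \<open>bump F m\<close>, whose integral under \<open>N\<close> is below \<open>e\<close> once \<open>m\<close> is large.\<close>

lemma wconv_closed: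
  fixes F :: "'b::metric_space set"
  assumes "wconv M N" "closed F" "measure N F < e"
  shows "\<forall>\<^sub>F n in sequentially. measure (M n) F < e"
proof -
  have N: "N \<in> borel_probs" and M: "\<And>n. M n \<in> borel_probs" using assms by (auto simp: wconv_def)
  interpret N: prob_space N using borel_probsD(1)[OF N] .
  have "(\<lambda>m. \<integral>x. bump F m x \<partial>N) \<longlonglongrightarrow> measure N F"
    by (rule integral_bump_tendsto) (use borel_probsD[OF N] assms in \<open>auto intro: N.finite_measure_axioms\<close>)
  from order_tendstoD(2)[OF this assms(3)] obtain m where m: "(\<integral>x. bump F m x \<partial>N) < e"
    by (auto simp: eventually_sequentially)
  have "(\<lambda>n. \<integral>x. bump F m x \<partial>M n) \<longlonglongrightarrow> (\<integral>x. bump F m x \<partial>N)"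
    using assms bump_Cb by (auto simp: wconv_def)
  then have "\<forall>\<^sub>F n in sequentially. (\<integral>x. bump F m x \<partial>M n) < e" using m by (rule order_tendstoD)
  then show ?thesis
  proof (rule eventually_mono)
    fix n assume l: "(\<integral>x. bump F m x \<partial>M n) < e"
    interpret n: prob_space "M n" using borel_probsD(1)[OF M] .
    have s: "sets (M n) = sets borel" using borel_probsD(2)[OF M] .
    have Fm: "F \<in> sets (M n)" using assms(2) s by simp
    then have "measure (M n) F = (\<integral>x. indicator F x \<partial>M n)" by simp
    also have "\<dots> \<le> (\<integral>x. bump F m x \<partial>M n)"
    proof (rule integral_mono)
      show "integrable (M n) (indicat_real F)"
        by (rule n.integrable_const_bound[of _ 1]) (simp_all add: Fm borel_measurable_indicator)
      show "integrable (M n) (bump F m)"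
        by (rule integrable_borel_probs[OF M bump_borel bump_bounds(3)])
    qed (auto simp: indicator_def bump_eq_1 bump_bounds)
    finally show "measure (M n) F < e" using l by simp
  qed
qed

text \<open>Integrals converge if the measures converge weakly and the integrands converge continuously. A point that
  belongs for every \<open>k\<close> to the closure of the set where some \<open>h n\<close> with \<open>n \<ge> k\<close> differs from \<open>g\<close> by at
  least \<open>e\<close> is the limit of points that violate continuous convergence. So these closures decrease to the empty
  set, one of them has small mass under \<open>N\<close>, and by \<open>wconv_closed\<close> also under \<open>M n\<close> for all late \<open>n\<close>.\<close>

lemma wconv_integral:
  fixes h :: "nat \<Rightarrow> 'b::metric_space \<Rightarrow> real"
  assumes w: "wconv M N" and g: "continuous_on UNIV g"
    and h: "\<And>n. h n \<in> borel_measurable borel"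
    and B: "\<And>n x. \<bar>h n x\<bar> \<le> B"
    and conv: "\<And>r ys y. filterlim r at_top sequentially \<Longrightarrow> ys \<longlonglongrightarrow> y \<Longrightarrow> (\<lambda>k. h (r k) (ys k)) \<longlonglongrightarrow> g y"
  shows "(\<lambda>n. \<integral>x. h n x \<partial>M n) \<longlonglongrightarrow> (\<integral>x. g x \<partial>N)"
proof -
  have N: "N \<in> borel_probs" and M: "\<And>n. M n \<in> borel_probs" using w by (auto simp: wconv_def)
  interpret N: prob_space N using borel_probsD(1)[OF N] .
  have gB: "\<bar>g x\<bar> \<le> B" for x
  proof -
    have "(\<lambda>k. \<bar>h k x\<bar>) \<longlonglongrightarrow> \<bar>g x\<bar>" using conv[of "\<lambda>k. k" "\<lambda>k. x" x] by (intro tendsto_rabs) (auto simp: filterlim_ident)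
    then show ?thesis by (rule LIMSEQ_le_const2) (use B in auto)
  qed
  have gm: "g \<in> borel_measurable borel" using g by (rule borel_measurable_continuous_onI)
  have B0: "B \<ge> 0" using B[of 0 undefined] by linarith
  have small: "(\<lambda>n. \<integral>x. h n x - g x \<partial>M n) \<longlonglongrightarrow> 0"
  proof (rule LIMSEQ_I)
    fix e0 :: real assume e0: "e0 > 0"
    \<comment> \<open>the error is at most \<open>e\<close> off the exceptional set and \<open>2 * B\<close> on it, and the set has mass below \<open>e\<close>\<close>
    define e where "e = e0 / (2 + 2 * B)"
    have e: "e > 0" using e0 B0 by (simp add: e_def)
    define F where "F k = closure {y. \<exists>n\<ge>k. \<bar>h n y - g y\<bar> \<ge> e}" for k :: nat
    have "decseq F" unfolding F_def decseq_def by (intro allI impI closure_mono) (use order_trans in blast)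
    have "\<Inter>(range F) = {}"
    proof (rule ccontr)
      assume "\<Inter>(range F) \<noteq> {}"
      then obtain y where y: "\<And>k. y \<in> F k" by blast
      have "\<exists>z n. n \<ge> k \<and> \<bar>h n z - g z\<bar> \<ge> e \<and> dist z y < inverse (real (Suc k))" for k
        using y[of k, unfolded F_def closure_approachable, rule_format, of "inverse (real (Suc k))"] by auto
      then obtain z n where zn: "\<And>k. n k \<ge> k" "\<And>k. \<bar>h (n k) (z k) - g (z k)\<bar> \<ge> e"
        "\<And>k. dist (z k) y < inverse (real (Suc k))" by metis
      have "z \<longlonglongrightarrow> y"
        by (rule tendsto_dist_iff[THEN iffD2], rule tendsto_sandwich[OF _ _ tendsto_const LIMSEQ_inverse_real_of_nat])
          (use zn(3) in \<open>auto intro!: always_eventually less_imp_le\<close>)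
      moreover have "filterlim n at_top sequentially"
        by (rule filterlim_at_top_mono[OF filterlim_ident]) (use zn(1) in auto)
      ultimately have "(\<lambda>k. h (n k) (z k)) \<longlonglongrightarrow> g y" by (intro conv)
      moreover have "(\<lambda>k. g (z k)) \<longlonglongrightarrow> g y"
        using g \<open>z \<longlonglongrightarrow> y\<close> by (auto simp: continuous_on_eq_continuous_at intro: isCont_tendsto_compose)
      ultimately have "(\<lambda>k. \<bar>h (n k) (z k) - g (z k)\<bar>) \<longlonglongrightarrow> \<bar>g y - g y\<bar>" by (intro tendsto_intros)
      from LIMSEQ_le_const[OF this, of e] show False using zn(2) e by auto
    qed
    moreover have "(\<lambda>k. measure N (F k)) \<longlonglongrightarrow> measure N (\<Inter>(range F))"
      by (rule N.finite_Lim_measure_decseq) (use \<open>decseq F\<close> borel_probsD(2)[OF N] in \<open>simp_all add: image_subset_iff\<close>, simp add: F_def)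
    ultimately have "(\<lambda>k. measure N (F k)) \<longlonglongrightarrow> 0" by simp
    from order_tendstoD(2)[OF this e] obtain k where k: "measure N (F k) < e"
      by (auto simp: eventually_sequentially)
    have "\<forall>\<^sub>F n in sequentially. measure (M n) (F k) < e"
      by (rule wconv_closed[OF w _ k]) (simp add: F_def)
    then obtain n0 where n0: "\<And>n. n \<ge> n0 \<Longrightarrow> measure (M n) (F k) < e" by (auto simp: eventually_sequentially)
    show "\<exists>no. \<forall>n\<ge>no. norm ((\<integral>x. h n x - g x \<partial>M n) - 0) < e0"
    proof (intro exI allI impI)
      fix n assume n: "n \<ge> max k n0"
      interpret n: prob_space "M n" using borel_probsD(1)[OF M] .
      have s: "sets (M n) = sets borel" using borel_probsD(2)[OF M] .
      note [measurable_cong] = s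
      have Fm: "F k \<in> sets (M n)" using s by (simp add: F_def)
      have i1: "integrable (M n) (\<lambda>x. h n x - g x)"
        using integrable_borel_probs[OF M h B] integrable_borel_probs[OF M gm gB] by auto
      have i2: "integrable (M n) (\<lambda>x. e + 2 * B * indicator (F k) x)"
        using Fm by (intro n.integrable_const_bound[of _ "e + 2 * B"]) (use e B0 in \<open>auto simp: indicator_def\<close>)
      have "norm (\<integral>x. h n x - g x \<partial>M n) \<le> (\<integral>x. \<bar>h n x - g x\<bar> \<partial>M n)" by simp
      also have "\<dots> \<le> (\<integral>x. e + 2 * B * indicator (F k) x \<partial>M n)"
      proof (rule integral_mono)
        show "\<bar>h n x - g x\<bar> \<le> e + 2 * B * indicator (F k) x" for x
        proof (cases "x \<in> F k")
          case True then show ?thesis using B[of n x] gB[of x] e by auto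
        next
          case False
          then have "x \<notin> {y. \<exists>n\<ge>k. \<bar>h n y - g y\<bar> \<ge> e}"
            unfolding F_def by (rule contra_subsetD[OF closure_subset])
          then have "\<forall>n. n < k \<or> \<bar>h n x - g x\<bar> < e" by (auto simp: not_le)
          from this[rule_format, of n] have "\<bar>h n x - g x\<bar> < e" using n by simp
          then show ?thesis using False by simp
        qed
      qed (use i1 i2 in auto)
      also have "\<dots> = e + 2 * B * measure (M n) (F k)"
        using Fm by (subst Bochner_Integration.integral_add) (auto simp: n.prob_space n.emeasure_eq_measure)
      also have "\<dots> \<le> e + 2 * B * e" using n0[of n] n B0 by (intro add_left_mono mult_left_mono) auto
      also have "\<dots> = e * (1 + 2 * B)" by (simp add: algebra_simps)
      also have "\<dots> < e0"
      proof -
        have "e * (1 + 2 * B) < e * (2 + 2 * B)" using e by (intro mult_strict_left_mono) auto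
        also have "\<dots> = e0" using B0 by (simp add: e_def)
        finally show ?thesis .
      qed
      finally show "norm ((\<integral>x. h n x - g x \<partial>M n) - 0) < e0" by simp
    qed
  qed
  have "(\<lambda>n. \<integral>x. g x \<partial>M n) \<longlonglongrightarrow> (\<integral>x. g x \<partial>N)"
  proof -
    have "g \<in> Cb euclidean" unfolding Cb_euclidean_iff using g gB by (intro conjI exI[of _ B] allI)
    then show ?thesis using w by (simp add: wconv_def)
  qed
  from tendsto_add[OF small this] have "(\<lambda>n. (\<integral>x. h n x - g x \<partial>M n) + (\<integral>x. g x \<partial>M n)) \<longlonglongrightarrow> (\<integral>x. g x \<partial>N)" by simp
  moreover have "(\<integral>x. h n x - g x \<partial>M n) + (\<integral>x. g x \<partial>M n) = (\<integral>x. h n x \<partial>M n)" for n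
    using integrable_borel_probs[OF M h B] integrable_borel_probs[OF M gm gB] by simp
  ultimately show ?thesis by simp
qed

text \<open>Closed sets form an intersection-stable generator of the Borel sets, and their measures are limits of the
  integrals of \<open>bump\<close>.\<close>

lemma measurable_prob_algebra_Cb:
  fixes k :: "'c \<Rightarrow> 'b::metric_space measure"
  assumes p: "\<And>x. x \<in> space M \<Longrightarrow> k x \<in> borel_probs"
    and f: "\<And>f. f \<in> Cb euclidean \<Longrightarrow> (\<lambda>x. \<integral>y. f y \<partial>k x) \<in> borel_measurable M"
  shows "k \<in> M \<rightarrow>\<^sub>M prob_algebra borel"
proof (rule measurable_prob_algebra_generated[where \<Omega>=UNIV and G="{F. closed F}"])
  show "sets borel = sigma_sets UNIV (Collect closed :: 'b set set)"
    by (simp add: borel_eq_closed)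
  show "Int_stable (Collect closed :: 'b set set)" by (auto simp: Int_stable_def)
  fix F :: "'b set" assume "F \<in> {F. closed F}"
  then have F: "closed F" by simp
  have "(\<lambda>a. measure (k a) F) \<in> borel_measurable M"
  proof (rule borel_measurable_LIMSEQ_real)
    fix a assume "a \<in> space M"
    then have a: "k a \<in> borel_probs" by (rule p)
    interpret prob_space "k a" using borel_probsD[OF a] by simp
    show "(\<lambda>m. \<integral>x. bump F m x \<partial>k a) \<longlonglongrightarrow> measure (k a) F"
      by (rule integral_bump_tendsto) (use borel_probsD[OF a] F finite_measure_axioms in auto)
  qed (use f bump_Cb in auto)
  then show "(\<lambda>a. emeasure (k a) F) \<in> borel_measurable M"
  proof (subst measurable_cong)
    fix a assume "a \<in> space M"
    then have a: "k a \<in> borel_probs" by (rule p)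
    interpret prob_space "k a" using borel_probsD[OF a] by simp
    show "emeasure (k a) F = ennreal (measure (k a) F)" by (rule emeasure_eq_measure)
  qed auto
next
  fix a assume "a \<in> space M"
  then have a: "k a \<in> borel_probs" by (rule p)
  show "prob_space (k a)" "sets (k a) = sets borel" by (rule borel_probsD[OF a])+
qed simp_all

lemma borel_probs_measurable_prob_algebra:
  "k \<in> borel \<rightarrow>\<^sub>M prob_algebra borel \<Longrightarrow> k x \<in> borel_probs"
  using measurable_space[of k borel "prob_algebra borel" x] by (simp add: borel_probs_eq)

text \<open>A kernel is a map that is measurable for the weak topology; for the integration theory of the Giry monad it
  has to be measurable for the evaluations at Borel sets.\<close>

lemma kernel_imp_measurable:
  fixes p :: "'c::topological_space \<Rightarrow> 'b::metric_space measure"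
  assumes "kernel p"
  shows "p \<in> borel \<rightarrow>\<^sub>M prob_algebra borel"
proof (rule measurable_prob_algebra_Cb)
  have k: "p \<in> borel \<rightarrow>\<^sub>M borel_of weak_topology" using assms by (simp add: kernel_def)
  have sp: "space (borel_of weak_topology) = (borel_probs :: 'b measure set)"
    by (auto simp: borel_of_def topspace_weak space_measure_of_conv)
  show p: "p x \<in> borel_probs" for x using measurable_space[OF k, of x] sp by simp
  fix f :: "'b \<Rightarrow> real" assume f: "f \<in> Cb euclidean"
  show "(\<lambda>x. \<integral>y. f y \<partial>p x) \<in> borel_measurable borel"
  proof (rule borel_measurableI)
    fix S :: "real set" assume "open S"
    then have "{M \<in> borel_probs. (\<integral>x. f x \<partial>M) \<in> S} \<in> sets (borel_of weak_topology)"
      unfolding borel_of_def using openin_weak_subbasis[OF f]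
      by (subst sets_measure_of) (auto intro!: sigma_sets.Basic dest: openin_subset)
    from measurable_sets[OF k this] have "p -` {M \<in> borel_probs. (\<integral>x. f x \<partial>M) \<in> S} \<in> sets borel" by simp
    moreover have "p -` {M \<in> borel_probs. (\<integral>x. f x \<partial>M) \<in> S} = (\<lambda>x. \<integral>y. f y \<partial>p x) -` S" using p by auto
    ultimately show "(\<lambda>x. \<integral>y. f y \<partial>p x) -` S \<inter> space borel \<in> sets borel" by simp
  qed
qed

section \<open>Nearest points in convex compact subsets of the Hilbert cube\<close>

lemma tendsto_fun_iff:
  fixes f :: "'c \<Rightarrow> 'i \<Rightarrow> 'b::topological_space"
  shows "(f \<longlongrightarrow> l) F \<longleftrightarrow> (\<forall>i. ((\<lambda>c. f c i) \<longlongrightarrow> l i) F)"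
proof -
  have "(f \<longlongrightarrow> l) F \<longleftrightarrow> limitin (product_topology (\<lambda>i. euclidean) UNIV) f l F"
    by (simp add: euclidean_product_topology)
  also have "\<dots> \<longleftrightarrow> (\<forall>i. ((\<lambda>c. f c i) \<longlongrightarrow> l i) F)"
    by (subst limitin_componentwise) simp
  finally show ?thesis .
qed

definition cube :: "(nat \<Rightarrow> real) set" where
  "cube = {z. \<forall>j. 0 \<le> z j \<and> z j \<le> 1}"

lemma compact_cube: "compact cube"
proof -
  have "compactin (product_topology (\<lambda>i::nat. euclideanreal) UNIV) (PiE UNIV (\<lambda>_. {0..1}))"
    by (subst compactin_PiE) simp
  moreover have "PiE UNIV (\<lambda>_::nat. {0..1::real}) = cube" by (auto simp: cube_def PiE_def Pi_def)
  ultimately show ?thesis by (simp add: euclidean_product_topology)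
qed

lemma cubeD: "z \<in> cube \<Longrightarrow> 0 \<le> z j" "z \<in> cube \<Longrightarrow> z j \<le> 1" "z \<in> cube \<Longrightarrow> \<bar>z j\<bar> \<le> 1"
  by (auto simp: cube_def)

lemma compact_cube_subseq:
  assumes "compact C" "\<And>n. y n \<in> C"
  obtains z s where "z \<in> C" "strict_mono (s :: nat \<Rightarrow> nat)" "(y \<circ> s) \<longlonglongrightarrow> (z :: nat \<Rightarrow> real)"
  using compact_imp_seq_compact[OF assms(1)] assms(2) unfolding seq_compact_def by metis

text \<open>Sequences of reals carry the inner product of a weighted \<open>\<ell>\<^sup>2\<close> space. The weights are the probabilities of the
  geometric distribution, so that the inner product is an expectation, to which dominated convergence and Fubini's
  theorem apply. On the Hilbert cube, its norm induces the product topology.\<close>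

definition geo :: "nat measure" where "geo = measure_pmf (geometric_pmf (1/2))"

definition ip :: "(nat \<Rightarrow> real) \<Rightarrow> (nat \<Rightarrow> real) \<Rightarrow> real" where
  "ip u v = (\<integral>j. u j * v j \<partial>geo)"

lemma prob_space_geo: "prob_space geo"
  unfolding geo_def by (rule prob_space_measure_pmf)

lemma sets_geo [simp]: "sets geo = UNIV" by (simp add: geo_def)
lemma space_geo [simp]: "space geo = UNIV" by (simp add: geo_def)
lemma measurable_geo [simp]: "u \<in> borel_measurable geo"
  by (simp add: geo_def)

lemma integrable_geo:
  fixes u :: "nat \<Rightarrow> real"
  assumes "\<And>j. \<bar>u j\<bar> \<le> B"
  shows "integrable geo u"
proof -
  interpret prob_space geo by (rule prob_space_geo)
  show ?thesis by (rule integrable_const_bound[of _ B]) (simp_all add: assms)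
qed

lemma integrable_ip:
  fixes u v :: "nat \<Rightarrow> real"
  assumes "\<And>j. \<bar>u j\<bar> \<le> A" "\<And>j. \<bar>v j\<bar> \<le> B"
  shows "integrable geo (\<lambda>j. u j * v j)"
proof (rule integrable_geo)
  fix j show "\<bar>u j * v j\<bar> \<le> A * B"
    unfolding abs_mult using assms(1)[of j] assms(2)[of j] by (intro mult_mono) linarith+
qed

lemma ip_coord_bound:
  assumes B: "\<And>j. \<bar>u j\<bar> \<le> B"
  shows "(u j)\<^sup>2 * (1/2)^(Suc j) \<le> ip u u"
proof -
  interpret prob_space geo by (rule prob_space_geo)
  have "measure geo {j} = (1/2)^(Suc j)" by (simp add: geo_def measure_pmf_single)
  then have "(u j)\<^sup>2 * (1/2)^(Suc j) = (\<integral>i. (u j)\<^sup>2 * indicator {j} i \<partial>geo)" by simp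
  also have "\<dots> \<le> ip u u" unfolding ip_def
  proof (rule integral_mono)
    show "integrable geo (\<lambda>i. (u j)\<^sup>2 * indicator {j} i)"
      by (rule integrable_geo[of _ "(u j)\<^sup>2"]) (simp add: indicator_def)
    show "integrable geo (\<lambda>j. u j * u j)" by (rule integrable_ip[OF B B])
    show "(u j)\<^sup>2 * indicator {j} i \<le> u i * u i" for i
      by (auto simp: indicator_def power2_eq_square)
  qed
  finally show ?thesis .
qed

lemma ip_self_le_0:
  assumes "\<And>j. \<bar>u j\<bar> \<le> B" "ip u u \<le> 0"
  shows "u j = 0"
proof -
  have "(u j)\<^sup>2 * (1/2)^(Suc j) \<le> 0" by (rule order_trans[OF ip_coord_bound assms(2)]) (rule assms(1))
  moreover have "(1/2::real)^(Suc j) > 0" by simp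
  ultimately have "(u j)\<^sup>2 \<le> 0" by (metis mult_le_0_iff not_le)
  then show ?thesis by simp
qed

lemma ip_tendsto:
  assumes "\<And>n j. \<bar>U n j\<bar> \<le> A" "\<And>n j. \<bar>W n j\<bar> \<le> B"
    and "\<And>j. (\<lambda>n. U n j) \<longlonglongrightarrow> u j" "\<And>j. (\<lambda>n. W n j) \<longlonglongrightarrow> w j"
  shows "(\<lambda>n. ip (U n) (W n)) \<longlonglongrightarrow> ip u w"
proof -
  interpret prob_space geo by (rule prob_space_geo)
  show ?thesis unfolding ip_def
  proof (rule integral_dominated_convergence[where w="\<lambda>j. A * B"])
    show "AE j in geo. (\<lambda>n. U n j * W n j) \<longlonglongrightarrow> u j * w j"
      by (intro AE_I2 tendsto_mult assms)
    show "AE j in geo. norm (U n j * W n j) \<le> A * B" for n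
    proof (intro AE_I2)
      fix j show "norm (U n j * W n j) \<le> A * B"
        unfolding real_norm_def abs_mult using assms(1)[of n j] assms(2)[of n j] by (intro mult_mono) linarith+
    qed
  qed simp_all
qed

definition cvx :: "(nat \<Rightarrow> real) set \<Rightarrow> bool" where
  "cvx C \<longleftrightarrow> (\<forall>a\<in>C. \<forall>b\<in>C. \<forall>\<gamma>. 0 < \<gamma> \<longrightarrow> \<gamma> < 1 \<longrightarrow> (\<lambda>j. \<gamma> * a j + (1 - \<gamma>) * b j) \<in> C)"

text \<open>The variational characterisation of the nearest point of a convex set. Working with it instead of
  with the minimal distance gives uniqueness, continuity and separation at once.\<close>

definition is_proj :: "(nat \<Rightarrow> real) set \<Rightarrow> (nat \<Rightarrow> real) \<Rightarrow> (nat \<Rightarrow> real) \<Rightarrow> bool" where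
  "is_proj C z c \<longleftrightarrow> c \<in> C \<and> (\<forall>c'\<in>C. ip (\<lambda>j. z j - c j) (\<lambda>j. c' j - c j) \<le> 0)"

definition prj :: "(nat \<Rightarrow> real) set \<Rightarrow> (nat \<Rightarrow> real) \<Rightarrow> nat \<Rightarrow> real" where
  "prj C z = (SOME c. is_proj C z c)"

lemma cube_diff_bound: "z \<in> cube \<Longrightarrow> w \<in> cube \<Longrightarrow> \<bar>z j - w j\<bar> \<le> 1"
  using cubeD(1,2)[of z j] cubeD(1,2)[of w j] by linarith

text \<open>A minimiser of the distance exists by compactness; along the segment from it to any other point of the
  convex set the distance has a nonnegative derivative, which is the variational inequality.\<close>

lemma is_proj_exists:
  assumes C: "compact C" "C \<subseteq> cube" "cvx C" "C \<noteq> {}" and z: "z \<in> cube"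
  shows "\<exists>c. is_proj C z c"
proof -
  define f where "f c = ip (\<lambda>j. z j - c j) (\<lambda>j. z j - c j)" for c
  have "continuous_on C f"
    unfolding continuous_on_sequentially
  proof (intro allI ballI impI)
    fix x c assume c: "c \<in> C" and x: "(\<forall>n. x n \<in> C) \<and> x \<longlonglongrightarrow> c"
    have b: "\<bar>z j - x n j\<bar> \<le> 1" for n j using x C z by (intro cube_diff_bound) auto
    have l: "(\<lambda>n. z j - x n j) \<longlonglongrightarrow> z j - c j" for j
      using x by (intro tendsto_diff tendsto_const) (simp add: tendsto_fun_iff)
    show "(f \<circ> x) \<longlonglongrightarrow> f c" unfolding f_def comp_def by (rule ip_tendsto[OF b b l l])
  qed
  from continuous_attains_inf[OF C(1,4) this] obtain c where c: "c \<in> C" "\<And>y. y \<in> C \<Longrightarrow> f c \<le> f y" by blast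
  have "ip (\<lambda>j. z j - c j) (\<lambda>j. c' j - c j) \<le> 0" if c': "c' \<in> C" for c'
  proof -
    define d where "d = (\<lambda>j. c' j - c j)"
    define e where "e = (\<lambda>j. z j - c j)"
    have bd: "\<bar>d j\<bar> \<le> 1" "\<bar>e j\<bar> \<le> 1" for j
      unfolding d_def e_def using c c' C z by (auto intro!: cube_diff_bound)
    \<comment> \<open>expand the square of the distance to the point at parameter \<open>\<gamma>\<close> on the segment\<close>
    have "2 * ip e d \<le> \<gamma> * ip d d" if g: "0 < \<gamma>" "\<gamma> < 1" for \<gamma>
    proof -
      have m: "(\<lambda>j. \<gamma> * c' j + (1 - \<gamma>) * c j) \<in> C" using C(3) c c' g by (auto simp: cvx_def)
      have "f (\<lambda>j. \<gamma> * c' j + (1 - \<gamma>) * c j) = ip (\<lambda>j. e j - \<gamma> * d j) (\<lambda>j. e j - \<gamma> * d j)"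
        unfolding f_def by (intro arg_cong2[where f=ip] ext) (auto simp: e_def d_def algebra_simps)
      also have "\<dots> = (\<integral>j. e j * e j - (2 * \<gamma>) * (e j * d j) + \<gamma>\<^sup>2 * (d j * d j) \<partial>geo)"
        unfolding ip_def by (intro Bochner_Integration.integral_cong refl) (simp add: algebra_simps power2_eq_square)
      also have "\<dots> = ip e e - 2 * \<gamma> * ip e d + \<gamma>\<^sup>2 * ip d d"
        unfolding ip_def using integrable_ip[OF bd(2) bd(2)] integrable_ip[OF bd(2) bd(1)] integrable_ip[OF bd(1) bd(1)]
        by (simp add: mult.assoc)
      finally have "f (\<lambda>j. \<gamma> * c' j + (1 - \<gamma>) * c j) = f c - 2 * \<gamma> * ip e d + \<gamma>\<^sup>2 * ip d d"
        by (simp add: f_def e_def)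
      with c(2)[OF m] have "\<gamma> * (2 * ip e d) \<le> \<gamma> * (\<gamma> * ip d d)" by (simp add: power2_eq_square algebra_simps)
      then show ?thesis using g by simp
    qed
    then have ev: "\<forall>\<^sub>F \<gamma> in at_right 0. 2 * ip e d \<le> \<gamma> * ip d d"
      unfolding eventually_at_right_field by (intro exI[of _ 1]) auto
    have "((\<lambda>\<gamma>. \<gamma> * ip d d) \<longlongrightarrow> 0 * ip d d) (at_right 0)" by (intro tendsto_intros)
    from tendsto_lowerbound[OF this ev] have "2 * ip e d \<le> 0" by simp
    then show ?thesis by (simp add: e_def d_def)
  qed
  with c show ?thesis by (auto simp: is_proj_def)
qed

text \<open>Adding the variational inequalities of both points at each other and completing the square.\<close>

lemma is_proj_nonexpansive:
  assumes C: "C \<subseteq> cube" and z: "z1 \<in> cube" "z2 \<in> cube" and p: "is_proj C z1 c1" "is_proj C z2 c2"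
  shows "ip (\<lambda>j. c2 j - c1 j) (\<lambda>j. c2 j - c1 j) \<le> ip (\<lambda>j. z2 j - z1 j) (\<lambda>j. z2 j - z1 j)"
proof -
  have c: "c1 \<in> cube" "c2 \<in> cube" using p C by (auto simp: is_proj_def)
  have 1: "ip (\<lambda>j. z1 j - c1 j) (\<lambda>j. c2 j - c1 j) \<le> 0" "ip (\<lambda>j. z2 j - c2 j) (\<lambda>j. c1 j - c2 j) \<le> 0"
    using p by (auto simp: is_proj_def)
  have i: "integrable geo (\<lambda>j. (z1 j - c1 j) * (c2 j - c1 j))" "integrable geo (\<lambda>j. (z2 j - c2 j) * (c1 j - c2 j))"
    "integrable geo (\<lambda>j. (z2 j - z1 j) * (z2 j - z1 j))" "integrable geo (\<lambda>j. (c2 j - c1 j) * (c2 j - c1 j))"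
    by (rule integrable_ip[of _ 1 _ 1]; intro cube_diff_bound c z)+
  have "ip (\<lambda>j. c2 j - c1 j) (\<lambda>j. c2 j - c1 j) \<le>
    (\<integral>j. (z2 j - z1 j) * (z2 j - z1 j) + 2 * ((z1 j - c1 j) * (c2 j - c1 j)) + 2 * ((z2 j - c2 j) * (c1 j - c2 j)) \<partial>geo)"
    unfolding ip_def
  proof (rule integral_mono[OF i(4)])
    fix j
    have "0 \<le> ((z2 j - z1 j) - (c2 j - c1 j))\<^sup>2" by simp
    then show "(c2 j - c1 j) * (c2 j - c1 j) \<le> (z2 j - z1 j) * (z2 j - z1 j) + 2 * ((z1 j - c1 j) * (c2 j - c1 j)) + 2 * ((z2 j - c2 j) * (c1 j - c2 j))"
      by (simp add: power2_eq_square algebra_simps)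
  qed (use i in simp)
  also have "\<dots> = ip (\<lambda>j. z2 j - z1 j) (\<lambda>j. z2 j - z1 j) + 2 * ip (\<lambda>j. z1 j - c1 j) (\<lambda>j. c2 j - c1 j)
      + 2 * ip (\<lambda>j. z2 j - c2 j) (\<lambda>j. c1 j - c2 j)"
    unfolding ip_def using i by simp
  finally show ?thesis using 1 by linarith
qed

lemma prj_self:
  assumes "C \<subseteq> cube" "z \<in> C" "is_proj C z c"
  shows "c = z"
proof
  fix j
  have "ip (\<lambda>j. z j - c j) (\<lambda>j. z j - c j) \<le> 0" using assms by (auto simp: is_proj_def)
  then have "z j - c j = 0"
    using ip_self_le_0[of "\<lambda>j. z j - c j" 1 j] cube_diff_bound[of z c] assms by (auto simp: is_proj_def)
  then show "c j = z j" by simp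
qed

text \<open>Nonempty convex compact subsets of the Hilbert cube, the setting in which measures appear through their
  coordinates.\<close>

locale cube_body =
  fixes C :: "(nat \<Rightarrow> real) set"
  assumes C: "compact C" "C \<subseteq> cube" "cvx C" "C \<noteq> {}"
begin

lemma is_proj_prj: "z \<in> cube \<Longrightarrow> is_proj C z (prj C z)"
  unfolding prj_def using is_proj_exists[OF C] by (rule someI_ex)

lemma prj_in: "z \<in> cube \<Longrightarrow> prj C z \<in> C"
  using is_proj_prj by (auto simp: is_proj_def)

lemma prj_char: "z \<in> cube \<Longrightarrow> c \<in> C \<Longrightarrow> ip (\<lambda>j. z j - prj C z j) (\<lambda>j. c j - prj C z j) \<le> 0"
  using is_proj_prj by (auto simp: is_proj_def)

lemma prj_id: "z \<in> C \<Longrightarrow> prj C z = z"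
  using prj_self[OF C(2) _ is_proj_prj] C(2) by auto

lemma continuous_on_prj: "continuous_on cube (prj C)"
  unfolding continuous_on_sequentially
proof (intro allI ballI impI)
  fix x z assume z: "z \<in> cube" and "(\<forall>n. x n \<in> cube) \<and> x \<longlonglongrightarrow> z"
  then have x: "\<And>n. x n \<in> cube" "x \<longlonglongrightarrow> z" by auto
  have b: "\<bar>x n j - z j\<bar> \<le> 1" for n j by (rule cube_diff_bound) (use x z in auto)
  have l: "(\<lambda>n. x n j - z j) \<longlonglongrightarrow> 0" for j
    using x(2) by (intro LIM_zero) (simp add: tendsto_fun_iff)
  have "(\<lambda>n. ip (\<lambda>j. x n j - z j) (\<lambda>j. x n j - z j)) \<longlonglongrightarrow> ip (\<lambda>j. 0) (\<lambda>j. 0)"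
    by (rule ip_tendsto[OF b b l l])
  then have lim: "(\<lambda>n. ip (\<lambda>j. x n j - z j) (\<lambda>j. x n j - z j)) \<longlonglongrightarrow> 0" by (simp add: ip_def)
  have "(\<lambda>n. prj C (x n) j) \<longlonglongrightarrow> prj C z j" for j
  proof -
    have bnd: "(prj C (x n) j - prj C z j)\<^sup>2 \<le> ip (\<lambda>j. x n j - z j) (\<lambda>j. x n j - z j) * 2 ^ Suc j" for n
    proof -
      have "(prj C (x n) j - prj C z j)\<^sup>2 * (1/2)^(Suc j) \<le> ip (\<lambda>j. prj C (x n) j - prj C z j) (\<lambda>j. prj C (x n) j - prj C z j)"
        using C(2) prj_in[OF x(1)] prj_in[OF z] by (intro ip_coord_bound[of _ 1] cube_diff_bound) auto
      also have "\<dots> \<le> ip (\<lambda>j. x n j - z j) (\<lambda>j. x n j - z j)"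
        by (rule is_proj_nonexpansive[OF C(2) z x(1) is_proj_prj[OF z] is_proj_prj[OF x(1)]])
      finally show ?thesis by (simp add: field_simps)
    qed
    have "(\<lambda>n. (prj C (x n) j - prj C z j)\<^sup>2) \<longlonglongrightarrow> 0"
    proof (rule tendsto_sandwich[OF _ _ tendsto_const])
      show "(\<lambda>n. ip (\<lambda>j. x n j - z j) (\<lambda>j. x n j - z j) * 2 ^ Suc j) \<longlonglongrightarrow> 0"
        using tendsto_mult_right[OF lim, of "2 ^ Suc j"] by simp
    qed (use bnd in \<open>auto intro!: always_eventually\<close>)
    then have "(\<lambda>n. sqrt ((prj C (x n) j - prj C z j)\<^sup>2)) \<longlonglongrightarrow> sqrt 0" by (rule tendsto_real_sqrt)
    then have "(\<lambda>n. prj C (x n) j - prj C z j) \<longlonglongrightarrow> 0" by (simp add: tendsto_rabs_zero_iff)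
    then show ?thesis by (rule LIM_zero_cancel)
  qed
  then show "(prj C \<circ> x) \<longlonglongrightarrow> prj C z" by (simp add: tendsto_fun_iff comp_def)
qed

end

section \<open>Fixed points in the Hilbert cube\<close>

text \<open>Kuhn's combinatorial lemma is applied to the grid of mesh \<open>1/n\<close> in the first \<open>n\<close> coordinates, the
  others being \<open>0\<close>. A grid point gets label \<open>0\<close> in direction \<open>i\<close> if \<open>H\<close> does not decrease its
  coordinate \<open>i\<close>, and label \<open>1\<close> if \<open>H\<close> does not increase it; on the faces of the grid the labels that
  the lemma prescribes satisfy this because \<open>H\<close> maps into the cube.\<close>

lemma cube_almost_fixpoint:
  assumes H: "\<And>z. z \<in> cube \<Longrightarrow> H z \<in> cube" and n: "n > (0::nat)"
  shows "\<exists>y\<in>cube. \<forall>i<n. \<exists>r\<in>cube. \<exists>s\<in>cube. (\<forall>j. \<bar>r j - y j\<bar> \<le> 1 / real n) \<and>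
    (\<forall>j. \<bar>s j - y j\<bar> \<le> 1 / real n) \<and> r i \<le> H r i \<and> H s i \<le> s i"
proof -
  define pt where "pt x = (\<lambda>j. if j < n then real (x j) / real n else 0)" for x :: "nat \<Rightarrow> nat"
  define label where "label x i = (if x i = 0 then 0 else if x i = n then 1 else
      if pt x i \<le> H (pt x) i then 0 else (1::nat))" for x i
  have pt: "pt x \<in> cube" if "\<forall>j<n. x j \<le> n" for x
    using that n by (auto simp: pt_def cube_def)
  have l0: "pt x i \<le> H (pt x) i" if "\<forall>j<n. x j \<le> n" "i < n" "label x i = 0" for x i
    using that n cubeD(1)[OF H[OF pt[OF that(1)]], of i] by (auto simp: label_def pt_def split: if_splits)
  have l1: "H (pt x) i \<le> pt x i" if "\<forall>j<n. x j \<le> n" "i < n" "label x i = 1" for x i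
    using that n cubeD(2)[OF H[OF pt[OF that(1)]], of i] by (auto simp: label_def pt_def split: if_splits)
  obtain q where q: "\<forall>i<n. q i < n"
    "\<forall>i<n. \<exists>r s. (\<forall>j<n. q j \<le> r j \<and> r j \<le> q j + 1) \<and> (\<forall>j<n. q j \<le> s j \<and> s j \<le> q j + 1) \<and> label r i \<noteq> label s i"
    by (rule kuhn_lemma[of n n label]) (use n in \<open>auto simp: label_def\<close>)
  have near: "\<bar>pt r j - pt q j\<bar> \<le> 1 / real n" if "\<forall>j<n. q j \<le> r j \<and> r j \<le> q j + 1" for r j
  proof (cases "j < n")
    case True
    with that have "\<bar>real (r j) - real (q j)\<bar> \<le> 1" by fastforce
    then have "\<bar>real (r j) - real (q j)\<bar> / real n \<le> 1 / real n" using n by (intro divide_right_mono) auto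
    then show ?thesis using True n by (simp add: pt_def flip: diff_divide_distrib)
  qed (simp add: pt_def)
  show ?thesis
  proof (rule bexI[of _ "pt q"], intro allI impI)
    show "pt q \<in> cube" using q by (intro pt) (auto intro: less_imp_le)
  next
    fix i assume i: "i < n"
    then obtain r s where rs: "\<forall>j<n. q j \<le> r j \<and> r j \<le> q j + 1" "\<forall>j<n. q j \<le> s j \<and> s j \<le> q j + 1" "label r i \<noteq> label s i"
      using q(2) by blast
    have le: "\<forall>j<n. r j \<le> n" "\<forall>j<n. s j \<le> n" using rs q(1) by fastforce+
    have "(label r i = 0 \<and> label s i = 1) \<or> (label r i = 1 \<and> label s i = 0)"
      using rs(3) by (auto simp: label_def split: if_splits)
    then show "\<exists>r\<in>cube. \<exists>s\<in>cube. (\<forall>j. \<bar>r j - pt q j\<bar> \<le> 1 / real n) \<and>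
       (\<forall>j. \<bar>s j - pt q j\<bar> \<le> 1 / real n) \<and> r i \<le> H r i \<and> H s i \<le> s i"
    proof
      assume l: "label r i = 0 \<and> label s i = 1"
      show ?thesis
        by (rule bexI[OF _ pt[OF le(1)]], rule bexI[OF _ pt[OF le(2)]])
          (use l l0[OF le(1) i] l1[OF le(2) i] near[OF rs(1)] near[OF rs(2)] in simp)
    next
      assume l: "label r i = 1 \<and> label s i = 0"
      show ?thesis
        by (rule bexI[OF _ pt[OF le(2)]], rule bexI[OF _ pt[OF le(1)]])
          (use l l1[OF le(1) i] l0[OF le(2) i] near[OF rs(1)] near[OF rs(2)] in simp)
    qed
  qed
qed

text \<open>In a limit of the cells found by \<open>cube_almost_fixpoint\<close>, both corners that carry the labels of
  direction \<open>i\<close> converge to the same point \<open>z\<close>, whence \<open>z i \<le> H z i \<le> z i\<close>. The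
  dimension of the grid grows with its fineness, so that a single limit treats all coordinates.\<close>

theorem cube_fixpoint:
  assumes H: "\<And>z. z \<in> cube \<Longrightarrow> H z \<in> cube" and c: "continuous_on cube H"
  obtains z where "z \<in> cube" "H z = z"
proof -
  have "\<exists>y\<in>cube. \<forall>i<Suc n. \<exists>r\<in>cube. \<exists>s\<in>cube. (\<forall>j. \<bar>r j - y j\<bar> \<le> 1 / real (Suc n)) \<and>
    (\<forall>j. \<bar>s j - y j\<bar> \<le> 1 / real (Suc n)) \<and> r i \<le> H r i \<and> H s i \<le> s i" for n
    by (rule cube_almost_fixpoint[OF H]) auto
  then obtain y where y: "\<And>n. y n \<in> cube"
    "\<And>n i. i < Suc n \<Longrightarrow> \<exists>r\<in>cube. \<exists>s\<in>cube. (\<forall>j. \<bar>r j - y n j\<bar> \<le> 1 / real (Suc n)) \<and>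
    (\<forall>j. \<bar>s j - y n j\<bar> \<le> 1 / real (Suc n)) \<and> r i \<le> H r i \<and> H s i \<le> s i" by metis
  from compact_cube_subseq[where y=y, OF compact_cube y(1)]
  obtain z f where z: "z \<in> cube" "strict_mono f" "(y \<circ> f) \<longlonglongrightarrow> z" by metis
  have near: "R \<longlonglongrightarrow> z" if "\<And>n j. \<bar>R n j - y (f (n + i)) j\<bar> \<le> 1 / real (Suc (f (n + i)))" for R i
    unfolding tendsto_fun_iff
  proof
    fix j
    have yz: "(\<lambda>n. y (f n) j) \<longlonglongrightarrow> z j" using z(3) by (simp add: tendsto_fun_iff comp_def)
    have "(\<lambda>n. R n j - y (f (n + i)) j) \<longlonglongrightarrow> 0"
    proof (rule Lim_null_comparison)
      have "filterlim (\<lambda>n. f (n + i)) at_top sequentially"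
        by (rule filterlim_compose[OF filterlim_subseq[OF z(2)] filterlim_add_const_nat_at_top])
      from filterlim_compose[OF LIMSEQ_inverse_real_of_nat this]
      show "(\<lambda>n. 1 / real (Suc (f (n + i)))) \<longlonglongrightarrow> 0" by (simp add: inverse_eq_divide)
    qed (use that in \<open>auto intro!: always_eventually\<close>)
    from tendsto_add[OF this LIMSEQ_ignore_initial_segment[OF yz, of i]] show "(\<lambda>n. R n j) \<longlonglongrightarrow> z j" by simp
  qed
  have Hlim: "(\<lambda>n. H (R n) j) \<longlonglongrightarrow> H z j" if "R \<longlonglongrightarrow> z" "\<And>n. R n \<in> cube" for R j
    using c z(1) that unfolding continuous_on_sequentially by (simp add: tendsto_fun_iff comp_def)
  have "H z i = z i" for i
  proof (rule antisym)
    \<comment> \<open>shifting the subsequence by \<open>i\<close> ensures that direction \<open>i\<close> occurs in every grid\<close>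
    have lt: "i < Suc (f (n + i))" for n using seq_suble[OF z(2), of "n + i"] by linarith
    obtain R where R: "\<And>n. R n \<in> cube" "\<And>n j. \<bar>R n j - y (f (n + i)) j\<bar> \<le> 1 / real (Suc (f (n + i)))" "\<And>n. R n i \<le> H (R n) i"
      using y(2)[OF lt] by metis
    obtain S where S: "\<And>n. S n \<in> cube" "\<And>n j. \<bar>S n j - y (f (n + i)) j\<bar> \<le> 1 / real (Suc (f (n + i)))" "\<And>n. H (S n) i \<le> S n i"
      using y(2)[OF lt] by metis
    have Rz: "R \<longlonglongrightarrow> z" and Sz: "S \<longlonglongrightarrow> z" using near R(2) S(2) by blast+
    have "(\<lambda>n. R n i) \<longlonglongrightarrow> z i" "(\<lambda>n. S n i) \<longlonglongrightarrow> z i" using Rz Sz by (simp_all add: tendsto_fun_iff)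
    then show "z i \<le> H z i" "H z i \<le> z i"
      using LIMSEQ_le[OF _ Hlim[OF Rz R(1)]] LIMSEQ_le[OF Hlim[OF Sz S(1)]] R(3) S(3) by blast+
  qed
  then show ?thesis using z(1) that by blast
qed

text \<open>Composition with the nearest-point map extends \<open>F\<close> to the cube; a fixed point of the extension lies in
  \<open>C\<close>, where the nearest-point map is the identity.\<close>

theorem (in cube_body) fixpoint:
  assumes F: "\<And>z. z \<in> C \<Longrightarrow> F z \<in> C" and c: "continuous_on C F"
  obtains z where "z \<in> C" "F z = z"
proof -
  have "continuous_on cube (F \<circ> prj C)"
    by (rule continuous_on_compose[OF continuous_on_prj continuous_on_subset[OF c]]) (use prj_in in auto)
  moreover have "(F \<circ> prj C) z \<in> cube" if "z \<in> cube" for z using F[OF prj_in[OF that]] C(2) by auto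
  ultimately obtain z where z: "z \<in> cube" "(F \<circ> prj C) z = z" using cube_fixpoint[of "F \<circ> prj C"] by metis
  then have "z \<in> C" using F[OF prj_in[OF z(1)]] by simp
  with z show ?thesis using that[of z] prj_id[of z] by simp
qed

section \<open>Coordinates of measures\<close>

text \<open>A countable intersection-stable basis of the topology. Such a basis generates the Borel sets, so finite measures that
  agree on it are equal.\<close>

definition tbase :: "nat \<Rightarrow> 'b::{metric_space, second_countable_topology} set" where
  "tbase = (SOME U. (\<forall>n. open (U n)) \<and> Int_stable (range U) \<and> sets borel = sigma_sets UNIV (range U) \<and> \<Union>(range U) = UNIV)"

lemma tbase:
  shows "open (tbase n :: 'b::{metric_space, second_countable_topology} set)"
    and "Int_stable (range tbase :: 'b set set)"
    and "sets (borel :: 'b measure) = sigma_sets UNIV (range tbase)"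
    and "\<Union>(range tbase) = (UNIV :: 'b set)"
proof -
  obtain B :: "'b set set" where B: "countable B" "topological_basis B" using ex_countable_basis by blast
  define G where "G = Inter ` {F. finite F \<and> F \<subseteq> B}"
  have cG: "countable G" unfolding G_def using B(1) by (intro countable_image countable_Collect_finite_subset)
  have oG: "open g" if "g \<in> G" for g
    using that topological_basis_open[OF B(2)] by (auto simp: G_def intro!: open_Inter)
  have BG: "B \<subseteq> G"
  proof
    fix b assume "b \<in> B"
    then have "b = \<Inter>{b}" "{b} \<in> {F. finite F \<and> F \<subseteq> B}" by auto
    then show "b \<in> G" unfolding G_def by blast
  qed
  have bG: "topological_basis G"
    by (rule topological_basisI[OF oG]) (use B(2) BG in \<open>meson subsetD topological_basisE\<close>)+
  have IG: "Int_stable G"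
    unfolding Int_stable_def
  proof (intro ballI)
    fix a b assume "a \<in> G" "b \<in> G"
    then obtain E F where "finite E" "E \<subseteq> B" "a = \<Inter>E" "finite F" "F \<subseteq> B" "b = \<Inter>F" by (auto simp: G_def)
    then have "a \<inter> b = \<Inter>(E \<union> F)" "E \<union> F \<in> {F. finite F \<and> F \<subseteq> B}" by auto
    then show "a \<inter> b \<in> G" unfolding G_def by blast
  qed
  have ne: "G \<noteq> {}" by (auto simp: G_def)
  obtain U :: "nat \<Rightarrow> 'b set" where U: "range U = G" using range_from_nat_into[OF ne cG] by blast
  have "UNIV \<in> G" unfolding G_def by (rule image_eqI[of _ _ "{}"]) simp_all
  then have cov: "\<Union>G = UNIV" by blast
  have sb: "sets (borel :: 'b measure) = sigma_sets UNIV G"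
    unfolding borel_eq_countable_basis[OF cG bG] by (rule sets_measure_of) simp
  have "(\<forall>n. open (U n)) \<and> Int_stable (range U) \<and> sets borel = sigma_sets UNIV (range U) \<and> \<Union>(range U) = UNIV"
    unfolding U using U oG IG sb cov by (intro conjI allI) blast+
  then have "\<exists>U :: nat \<Rightarrow> 'b set. (\<forall>n. open (U n)) \<and> Int_stable (range U) \<and> sets borel = sigma_sets UNIV (range U) \<and> \<Union>(range U) = UNIV"
    by (intro exI[of _ U])
  from someI_ex[OF this] have "(\<forall>n. open (tbase n :: 'b set)) \<and> Int_stable (range tbase :: 'b set set) \<and>
     sets (borel :: 'b measure) = sigma_sets UNIV (range tbase) \<and> \<Union>(range tbase) = (UNIV :: 'b set)"
    unfolding tbase_def[symmetric] .
  then show "open (tbase n :: 'b set)" "Int_stable (range tbase :: 'b set set)"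
    "sets (borel :: 'b measure) = sigma_sets UNIV (range tbase)" "\<Union>(range tbase) = (UNIV :: 'b set)" by auto
qed

text \<open>Countably many continuous functions with values in the unit interval: for each basic open set, a sequence that
  increases to its indicator.\<close>

definition tf :: "nat \<Rightarrow> 'b::{metric_space, second_countable_topology} \<Rightarrow> real" where
  "tf j x = 1 - bump (- tbase (fst (prod_decode j))) (snd (prod_decode j)) x"

lemma tf_bounds: "0 \<le> tf j x" "tf j x \<le> 1" "\<bar>tf j x\<bar> \<le> 1"
  using bump_bounds[of "- tbase (fst (prod_decode j))" "snd (prod_decode j)" x] by (simp_all add: tf_def)

lemma continuous_tf: "continuous_on UNIV (tf j)"
  unfolding tf_def by (intro continuous_on_diff continuous_on_const continuous_bump)

lemma tf_Cb: "tf j \<in> Cb euclidean"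
  unfolding Cb_euclidean_iff by (intro conjI continuous_tf exI[of _ 1] allI tf_bounds(3))

lemma tf_borel [measurable]: "tf j \<in> borel_measurable borel"
  by (rule Cb_borel[OF tf_Cb])

text \<open>The integrals of the test functions embed the probability measures into the Hilbert cube. Mixtures become convex
  combinations there, and on weakly compact sets the embedding is a homeomorphism onto its image.\<close>

definition crd :: "'b::{metric_space, second_countable_topology} measure \<Rightarrow> nat \<Rightarrow> real" where
  "crd M j = (\<integral>x. tf j x \<partial>M)"

lemma crd_inj_finite:
  fixes M N :: "'b::{metric_space, second_countable_topology} measure"
  assumes M: "finite_measure M" "sets M = sets borel" and N: "finite_measure N" "sets N = sets borel"
    and eq: "\<And>j. crd M j = crd N j"
  shows "M = N"
proof (rule measure_eqI_generator_eq[where E="range tbase" and \<Omega>=UNIV and A=tbase])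
  have lim: "(\<lambda>m. crd L (prod_encode (k, m))) \<longlonglongrightarrow> measure L (tbase k)"
    if "finite_measure L" "sets L = sets borel" for L :: "'b measure" and k
  proof -
    interpret L: finite_measure L by fact
    have "open (tbase k :: 'b set)" by (rule tbase(1))
    then have U: "tbase k \<in> sets L" using that(2) by simp
    note [measurable_cong] = that(2)
    have "(\<lambda>m. \<integral>x. tf (prod_encode (k, m)) x \<partial>L) \<longlonglongrightarrow> (\<integral>x. indicator (tbase k) x \<partial>L)"
    proof (rule integral_dominated_convergence[where w="\<lambda>x. 1"])
      show "indicat_real (tbase k) \<in> borel_measurable L" using U by (rule borel_measurable_indicator)
      show "AE x in L. (\<lambda>m. tf (prod_encode (k, m)) x) \<longlonglongrightarrow> indicator (tbase k) x"
      proof (intro AE_I2)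
        fix x
        have "(\<lambda>m. 1 - bump (- tbase k) m x) \<longlonglongrightarrow> 1 - indicator (- tbase k) x"
          by (intro tendsto_diff tendsto_const bump_tendsto) (simp add: closed_Compl tbase(1))
        then show "(\<lambda>m. tf (prod_encode (k, m)) x) \<longlonglongrightarrow> indicator (tbase k) x"
          by (simp add: tf_def indicator_compl)
      qed
      show "AE x in L. norm (tf (prod_encode (k, m)) x) \<le> 1" for m
        by (intro AE_I2) (simp add: tf_bounds)
    qed simp_all
    then show ?thesis using U by (simp add: crd_def)
  qed
  interpret M: finite_measure M by fact
  interpret N: finite_measure N by fact
  fix X :: "'b set" assume "X \<in> range tbase"
  then obtain k where k: "X = tbase k" by blast
  have "measure M X = measure N X"
    using LIMSEQ_unique[OF lim[OF M, of k]] lim[OF N, of k] eq unfolding k by simp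
  then show "emeasure M X = emeasure N X" by (simp add: M.emeasure_eq_measure N.emeasure_eq_measure)
next
  interpret M: finite_measure M by fact
  show "emeasure M (tbase i) \<noteq> \<infinity>" for i by simp
next
  show "Int_stable (range tbase :: 'b set set)" by (rule tbase(2))
  show "sets M = sigma_sets UNIV (range tbase)" "sets N = sigma_sets UNIV (range tbase)"
    by (simp_all only: M(2) N(2) tbase(3))
  show "(\<Union>i. tbase i) = (UNIV :: 'b set)" by (rule tbase(4))
qed simp_all

lemma crd_inj:
  assumes "M \<in> borel_probs" "N \<in> borel_probs" "crd M = crd N"
  shows "M = N"
  by (rule crd_inj_finite[OF prob_space.axioms(1)[OF borel_probsD(1)[OF assms(1)]] borel_probsD(2)[OF assms(1)]
      prob_space.axioms(1)[OF borel_probsD(1)[OF assms(2)]] borel_probsD(2)[OF assms(2)]]) (simp add: assms(3))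

lemma crd_cube: "M \<in> borel_probs \<Longrightarrow> crd M \<in> cube"
proof -
  assume M: "M \<in> borel_probs"
  have "0 \<le> crd M j" for j unfolding crd_def by (rule Bochner_Integration.integral_nonneg) (simp add: tf_bounds)
  moreover have "crd M j \<le> 1" for j
    using integral_bounded_borel_probs[OF M tf_borel tf_bounds(3), of j] unfolding crd_def by linarith
  ultimately show ?thesis by (simp add: cube_def)
qed

lemma wconv_crd: "wconv M N \<Longrightarrow> (\<lambda>n. crd (M n)) \<longlonglongrightarrow> crd N"
  unfolding tendsto_fun_iff crd_def wconv_def by (intro allI) (elim conjE, erule bspec, rule tf_Cb)

definition wcompact :: "'b::{metric_space, second_countable_topology} measure set \<Rightarrow> bool" where
  "wcompact C \<longleftrightarrow> C \<subseteq> borel_probs \<and>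
    (\<forall>M. (\<forall>n. M n \<in> C) \<longrightarrow> (\<exists>r N. strict_mono (r :: nat \<Rightarrow> nat) \<and> N \<in> C \<and> wconv (\<lambda>k. M (r k)) N))"

lemma tendsto_by_subseq:
  fixes X :: "nat \<Rightarrow> 'b::topological_space"
  assumes "\<And>r. strict_mono (r :: nat \<Rightarrow> nat) \<Longrightarrow> \<exists>s. strict_mono (s :: nat \<Rightarrow> nat) \<and> (\<lambda>k. X (r (s k))) \<longlonglongrightarrow> L"
  shows "X \<longlonglongrightarrow> L"
proof (rule ccontr)
  assume "\<not> X \<longlonglongrightarrow> L"
  then obtain S where S: "open S" "L \<in> S" "\<not> (\<forall>\<^sub>F n in sequentially. X n \<in> S)" by (auto simp: tendsto_def)
  then have "\<exists>\<^sub>\<infinity>n. X n \<notin> S" by (simp add: frequently_def cofinite_eq_sequentially)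
  then have inf: "infinite {n. X n \<notin> S}" by (simp add: INFM_iff_infinite)
  define r where "r = enumerate {n. X n \<notin> S}"
  have r: "strict_mono r" "\<And>k. X (r k) \<notin> S"
    using strict_mono_enumerate[OF inf] enumerate_in_set[OF inf] by (auto simp: r_def)
  from assms[OF r(1)] obtain s where s: "(\<lambda>k. X (r (s k))) \<longlonglongrightarrow> L" by blast
  from topological_tendstoD[OF s S(1,2)] r(2) show False by simp
qed

lemma wconv_by_subseq:
  assumes "\<And>n. M n \<in> borel_probs" "N \<in> borel_probs"
    and "\<And>r. strict_mono (r :: nat \<Rightarrow> nat) \<Longrightarrow> \<exists>s. strict_mono (s :: nat \<Rightarrow> nat) \<and> wconv (\<lambda>k. M (r (s k))) N"
  shows "wconv M N"
  unfolding wconv_def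
proof (intro conjI allI ballI assms(1,2))
  fix f :: "'a \<Rightarrow> real" assume f: "f \<in> Cb euclidean"
  show "(\<lambda>n. \<integral>x. f x \<partial>M n) \<longlonglongrightarrow> (\<integral>x. f x \<partial>N)"
    by (rule tendsto_by_subseq) (use assms(3) f in \<open>unfold wconv_def, blast\<close>)
qed

lemma wconv_unique:
  fixes N :: "'b::{metric_space, second_countable_topology} measure"
  assumes "wconv M N" "wconv M N'"
  shows "N = N'"
proof (rule crd_inj)
  show "N \<in> borel_probs" "N' \<in> borel_probs" using assms by (auto simp: wconv_def)
  show "crd N = crd N'" by (rule LIMSEQ_unique[OF wconv_crd[OF assms(1)] wconv_crd[OF assms(2)]])
qed

lemma wcompact_wconvI:
  assumes C: "wcompact C" "\<And>n. M n \<in> C" and N: "N \<in> borel_probs"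
    and lim: "\<And>r L. strict_mono (r :: nat \<Rightarrow> nat) \<Longrightarrow> wconv (\<lambda>k. M (r k)) L \<Longrightarrow> L = N"
  shows "wconv M N"
proof (rule wconv_by_subseq[OF _ N])
  show "M n \<in> borel_probs" for n using C by (auto simp: wcompact_def)
  fix r :: "nat \<Rightarrow> nat" assume r: "strict_mono r"
  obtain s L where s: "strict_mono (s :: nat \<Rightarrow> nat)" "wconv (\<lambda>k. M (r (s k))) L"
  proof -
    have "\<forall>n. M (r n) \<in> C" using C(2) by blast
    with C(1) have "\<exists>s L. strict_mono (s :: nat \<Rightarrow> nat) \<and> L \<in> C \<and> wconv (\<lambda>k. M (r (s k))) L"
      unfolding wcompact_def by (elim conjE allE[of _ "\<lambda>n. M (r n)"] impE) auto
    then show ?thesis using that by blast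
  qed
  have "L = N" by (rule lim[of "\<lambda>k. r (s k)"]) (use r s in \<open>auto simp: strict_mono_def\<close>)
  with s show "\<exists>s. strict_mono s \<and> wconv (\<lambda>k. M (r (s k))) N" by blast
qed

text \<open>Every subsequential weak limit has the coordinates of \<open>N\<close> and hence is \<open>N\<close>; compactness provides such
  limits.\<close>

lemma wcompact_crd_conv:
  assumes C: "wcompact C" "\<And>n. M n \<in> C" and N: "N \<in> borel_probs"
    and lim: "(\<lambda>n. crd (M n)) \<longlonglongrightarrow> crd N"
  shows "wconv M N"
proof (rule wcompact_wconvI[OF C N])
  fix r :: "nat \<Rightarrow> nat" and L assume r: "strict_mono r" "wconv (\<lambda>k. M (r k)) L"
  have "(\<lambda>k. crd (M (r k))) \<longlonglongrightarrow> crd N"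
    using LIMSEQ_subseq_LIMSEQ[OF lim r(1)] by (simp add: comp_def)
  then have "crd L = crd N" by (rule LIMSEQ_unique[OF wconv_crd[OF r(2)]])
  then show "L = N" using r(2) N by (intro crd_inj) (auto simp: wconv_def)
qed

lemma compact_crd_image:
  assumes C: "wcompact C"
  shows "compact (crd ` C)"
proof -
  have "seq_compact (crd ` C)"
    unfolding seq_compact_def
  proof (intro allI impI)
    fix f :: "nat \<Rightarrow> nat \<Rightarrow> real" assume "\<forall>n. f n \<in> crd ` C"
    then have "\<forall>n. \<exists>m. m \<in> C \<and> f n = crd m" by blast
    then obtain M where M: "\<And>n. M n \<in> C" "\<And>n. f n = crd (M n)" by metis
    then obtain r N where "strict_mono (r :: nat \<Rightarrow> nat)" "N \<in> C" "wconv (\<lambda>k. M (r k)) N"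
      using C unfolding wcompact_def by (elim conjE allE[of _ M] impE) auto
    then show "\<exists>l\<in>crd ` C. \<exists>r. strict_mono r \<and> (f \<circ> r) \<longlonglongrightarrow> l"
      using wconv_crd[of "\<lambda>k. M (r k)" N] M(2) by (auto simp: comp_def)
  qed
  then show ?thesis by (simp add: seq_compact_eq_compact)
qed

section \<open>Compactness of tight families\<close>

text \<open>The point of Cantor's middle-thirds set with digits \<open>b\<close>.\<close>

definition cantor :: "(nat \<Rightarrow> bool) \<Rightarrow> real" where
  "cantor b = (\<Sum>m. (if b m then 2 else 0) * (1/3) ^ Suc m)"

lemma summable_cantor:
  assumes "\<And>m. \<bar>x m\<bar> \<le> 2"
  shows "summable (\<lambda>m. x m * (1/3::real) ^ Suc m)"
proof (rule summable_comparison_test')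
  show "summable (\<lambda>m. 2 * (1/3::real) ^ Suc m)"
    by (intro summable_mult) (simp add: summable_Suc_iff summable_geometric)
  show "norm (x m * (1/3) ^ Suc m) \<le> 2 * (1/3) ^ Suc m" if "0 \<le> m" for m
    unfolding real_norm_def abs_mult power_abs using assms[of m] by (intro mult_mono) auto
qed

lemma suminf_cantor_tail: "(\<Sum>m. 2 * (1/3::real) ^ Suc (m + k)) = (1/3) ^ k"
proof -
  have "(\<lambda>m. (1/3::real) ^ m) sums (1 / (1 - 1/3))" by (rule geometric_sums) simp
  then have "(\<lambda>m. (2 * (1/3) ^ Suc k) * (1/3::real) ^ m) sums ((2 * (1/3) ^ Suc k) * (1 / (1 - 1/3)))"
    by (rule sums_mult)
  moreover have "(\<lambda>m. (2 * (1/3) ^ Suc k) * (1/3::real) ^ m) = (\<lambda>m. 2 * (1/3::real) ^ Suc (m + k))"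
    by (rule ext) (simp add: power_add)
  moreover have "(2 * (1/3) ^ Suc k) * (1 / (1 - 1/3)) = (1/3::real) ^ k" by simp
  ultimately have "(\<lambda>m. 2 * (1/3::real) ^ Suc (m + k)) sums ((1/3) ^ k)" by (simp only:)
  then show ?thesis by (rule sums_unique[symmetric])
qed

lemma cantor_bounds: "0 \<le> cantor b" "cantor b \<le> 1"
proof -
  have s: "summable (\<lambda>m. (if b m then 2 else 0) * (1/3::real) ^ Suc m)" by (rule summable_cantor) auto
  show "0 \<le> cantor b" unfolding cantor_def by (rule suminf_nonneg[OF s]) auto
  have "cantor b \<le> (\<Sum>m. 2 * (1/3::real) ^ Suc m)"
    unfolding cantor_def by (rule suminf_le[OF _ s summable_cantor]) auto
  then show "cantor b \<le> 1" using suminf_cantor_tail[of 0] by simp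
qed

text \<open>At the first digit that differs, the sums differ by \<open>2 / 3\<^sup>k\<close>, and the remaining digits
  can compensate at most half of this.\<close>

lemma cantor_digits:
  assumes "\<bar>cantor b - cantor b'\<bar> < (1/3) ^ Suc M"
  shows "\<forall>m\<le>M. b m = b' m"
proof (rule ccontr)
  assume "\<not> (\<forall>m\<le>M. b m = b' m)"
  then obtain m where "b m \<noteq> b' m" "m \<le> M" by blast
  \<comment> \<open>the first position where the digits differ\<close>
  define m0 where "m0 = (LEAST m. b m \<noteq> b' m)"
  have m0: "b m0 \<noteq> b' m0" "m0 \<le> M"
    using LeastI[of "\<lambda>m. b m \<noteq> b' m"] Least_le[of "\<lambda>m. b m \<noteq> b' m"] \<open>b m \<noteq> b' m\<close> \<open>m \<le> M\<close> le_trans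
    unfolding m0_def by blast+
  have below: "b i = b' i" if "i < m0" for i using not_less_Least that unfolding m0_def by blast
  define x where "x m = (if b m then 2 else 0) - (if b' m then 2 else (0::real))" for m
  have x2: "\<bar>x m\<bar> \<le> 2" for m by (auto simp: x_def)
  have sx: "summable (\<lambda>m. x m * (1/3::real) ^ Suc m)" by (rule summable_cantor[OF x2])
  have "cantor b - cantor b' = (\<Sum>m. x m * (1/3) ^ Suc m)"
    unfolding cantor_def x_def left_diff_distrib by (rule suminf_diff; rule summable_cantor) auto
  also have "\<dots> = (\<Sum>m. x (m + Suc m0) * (1/3) ^ Suc (m + Suc m0)) + (\<Sum>m<Suc m0. x m * (1/3) ^ Suc m)"
    by (rule suminf_split_initial_segment[OF sx])
  also have "(\<Sum>m<Suc m0. x m * (1/3) ^ Suc m) = x m0 * (1/3) ^ Suc m0"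
    using below by (simp add: x_def)
  finally have e: "cantor b - cantor b' = (\<Sum>m. x (m + Suc m0) * (1/3) ^ Suc (m + Suc m0)) + x m0 * (1/3) ^ Suc m0" .
  have "\<bar>\<Sum>m. x (m + Suc m0) * (1/3) ^ Suc (m + Suc m0)\<bar> \<le> (\<Sum>m. 2 * (1/3::real) ^ Suc (m + Suc m0))"
  proof -
    have s1: "summable (\<lambda>m. 2 * (1/3::real) ^ Suc (m + Suc m0))"
      using summable_ignore_initial_segment[OF summable_cantor[of "\<lambda>_. 2"], of "Suc m0"] by simp
    show ?thesis unfolding real_norm_def[symmetric]
    proof (rule norm_suminf_le[OF _ s1])
      fix m show "norm (x (m + Suc m0) * (1/3) ^ Suc (m + Suc m0)) \<le> 2 * (1/3) ^ Suc (m + Suc m0)"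
        unfolding real_norm_def abs_mult power_abs using x2[of "m + Suc m0"] by (intro mult_mono) auto
    qed
  qed
  then have t: "\<bar>\<Sum>m. x (m + Suc m0) * (1/3) ^ Suc (m + Suc m0)\<bar> \<le> (1/3) ^ Suc m0"
    unfolding suminf_cantor_tail .
  have "\<bar>x m0 * (1/3) ^ Suc m0\<bar> = 2 * (1/3) ^ Suc m0" using m0(1) by (auto simp: x_def)
  then have "\<bar>cantor b - cantor b'\<bar> \<ge> (1/3) ^ Suc m0" using t e by linarith
  moreover have "(1/3::real) ^ Suc M \<le> (1/3) ^ Suc m0" using m0(2) by (intro power_decreasing) auto
  ultimately show False using assms by linarith
qed

text \<open>A point of a separable space is determined by the indices \<open>ix k\<close> of the first points of a dense sequence that are
  closer to it than \<open>2\<^sup>-\<^sup>k\<close>. The real number \<open>code\<close> has as its digits the truth values of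
  \<open>ix k y = j\<close> for all pairs \<open>(k, j)\<close>.\<close>

locale dense_seq =
  fixes d :: "nat \<Rightarrow> 'b::polish_space"
  assumes dense: "\<And>x e. e > 0 \<Longrightarrow> \<exists>j. dist x (d j) < e"
begin

definition ix :: "nat \<Rightarrow> 'b \<Rightarrow> nat" where
  "ix k y = (LEAST j. dist y (d j) < (1/2) ^ k)"

definition code :: "'b \<Rightarrow> real" where
  "code y = cantor (\<lambda>m. ix (fst (prod_decode m)) y = snd (prod_decode m))"

lemma ix: "dist y (d (ix k y)) < (1/2) ^ k"
  unfolding ix_def by (rule LeastI_ex, rule dense) simp

lemma measurable_code [measurable]: "code \<in> borel_measurable borel"
proof -
  have [measurable]: "ix k \<in> borel \<rightarrow>\<^sub>M count_space UNIV" for k unfolding ix_def by measurable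
  show ?thesis unfolding code_def cantor_def by measurable
qed

lemma code_close:
  assumes "\<bar>code y - code y'\<bar> < (1/3) ^ Suc M" "prod_encode (k, ix k y) \<le> M"
  shows "dist y y' < 2 * (1/2) ^ k"
proof -
  have "ix k y' = ix k y"
    using cantor_digits[OF assms(1)[unfolded code_def], rule_format, OF assms(2)] by simp
  then show ?thesis
    using dist_triangle2[of y y' "d (ix k y)"] ix[of y k] ix[of y' k] by simp
qed

lemma inj_code: "inj code"
proof (rule injI, rule ccontr)
  fix x y assume e: "code x = code y" and "x \<noteq> y"
  then have "dist x y > 0" by simp
  then obtain k where k: "(1/2) ^ k < dist x y / 2" using real_arch_pow_inv[of "dist x y / 2" "1/2"] by auto
  have "dist x y < 2 * (1/2) ^ k" by (rule code_close[of _ _ "prod_encode (k, ix k x)"]) (simp_all add: e)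
  with k show False by simp
qed

text \<open>On a compact set each \<open>ix k\<close> is bounded, so that its value is read off from finitely many digits, the same for
  all points of the set; close codes share these digits by \<open>cantor_digits\<close>.\<close>

lemma uniformly_continuous_decode:
  assumes K: "compact K"
  shows "uniformly_continuous_on (code ` K) (inv code)"
  unfolding uniformly_continuous_on_def
proof (intro allI impI)
  fix e :: real assume "e > 0"
  then obtain k where k: "(1/2) ^ k < e / 2" using real_arch_pow_inv[of "e / 2" "1/2"] by auto
  have cov: "K \<subseteq> (\<Union>j\<in>UNIV. ball (d j) ((1/2) ^ k))" 
  proof
    fix y show "y \<in> (\<Union>j\<in>UNIV. ball (d j) ((1/2) ^ k))"
      by (rule UN_I[of "ix k y"]) (simp_all add: ix dist_commute[of _ y])
  qed
  obtain J where J: "finite J" "K \<subseteq> (\<Union>j\<in>J. ball (d j) ((1/2) ^ k))"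
    by (rule compactE_image[OF K _ cov]) auto
  obtain j0 where j0: "\<And>j. j \<in> J \<Longrightarrow> j \<le> j0" using finite_nat_set_iff_bounded_le[of J] J(1) by blast
  have le: "ix k y \<le> j0" if y: "y \<in> K" for y
  proof -
    obtain j where "j \<in> J" "dist y (d j) < (1/2) ^ k" using J(2) y by (auto simp: dist_commute)
    then show ?thesis using j0 Least_le[of "\<lambda>j. dist y (d j) < (1/2) ^ k" j] unfolding ix_def by fastforce
  qed
  obtain M where M: "\<And>j. j \<le> j0 \<Longrightarrow> prod_encode (k, j) \<le> M"
    using finite_nat_set_iff_bounded_le[of "(\<lambda>j. prod_encode (k, j)) ` {..j0}"] by auto
  show "\<exists>\<delta>>0. \<forall>x\<in>code ` K. \<forall>x'\<in>code ` K. dist x' x < \<delta> \<longrightarrow> dist (inv code x') (inv code x) < e"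
  proof (intro exI[of _ "(1/3) ^ Suc M"] conjI ballI impI)
    fix x x' assume "x \<in> code ` K" "x' \<in> code ` K" and dd: "dist x' x < (1/3) ^ Suc M"
    then obtain y y' where y: "y \<in> K" "y' \<in> K" "x = code y" "x' = code y'" by blast
    have "dist y' y < 2 * (1/2) ^ k"
      by (rule code_close[of _ _ M]) (use dd y le M in \<open>auto simp: dist_real_def\<close>)
    then show "dist (inv code x') (inv code x) < e" using k y by (simp add: inv_f_f[OF inj_code])
  qed simp
qed

end

lemma dense_seq_exists: "\<exists>d :: nat \<Rightarrow> 'b::polish_space. dense_seq d"
proof -
  obtain D :: "'b set" where D: "countable D" "\<And>X. open X \<Longrightarrow> X \<noteq> {} \<Longrightarrow> \<exists>d \<in> D. d \<in> X"
    using countable_dense_setE by blast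
  have ne: "D \<noteq> {}" using D(2)[of UNIV] by auto
  have "dense_seq (from_nat_into D)"
  proof
    fix x :: 'b and e :: real assume "e > 0"
    then obtain y where "y \<in> D" "y \<in> ball x e" using D(2)[of "ball x e"] by auto
    then show "\<exists>j. dist x (from_nat_into D j) < e" using from_nat_into_surj[OF D(1)] by fastforce
  qed
  then show ?thesis by blast
qed

lemma integral_diff_bound:
  fixes f g :: "'b::topological_space \<Rightarrow> real"
  assumes M: "M \<in> borel_probs" and f: "f \<in> borel_measurable borel" "\<And>x. \<bar>f x\<bar> \<le> B"
    and g: "g \<in> borel_measurable borel" "\<And>x. \<bar>g x\<bar> \<le> B"
    and K: "K \<in> sets borel" "\<And>x. x \<in> K \<Longrightarrow> f x = g x"
  shows "\<bar>(\<integral>x. f x \<partial>M) - (\<integral>x. g x \<partial>M)\<bar> \<le> 2 * B * measure M (- K)"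
proof -
  interpret prob_space M using borel_probsD(1)[OF M] .
  have Ks: "- K \<in> sets M" using K(1) borel_probsD(2,3)[OF M] sets.compl_sets[of K borel] by (simp add: Compl_eq_Diff_UNIV)
  have i: "integrable M f" "integrable M g" by (rule integrable_borel_probs[OF M f]) (rule integrable_borel_probs[OF M g])
  have "(\<integral>x. f x \<partial>M) - (\<integral>x. g x \<partial>M) = (\<integral>x. f x - g x \<partial>M)" using i by simp
  then have "\<bar>(\<integral>x. f x \<partial>M) - (\<integral>x. g x \<partial>M)\<bar> \<le> (\<integral>x. \<bar>f x - g x\<bar> \<partial>M)"
    using integral_abs_bound[of M "\<lambda>x. f x - g x"] by simp
  also have "\<dots> \<le> (\<integral>x. 2 * B * indicator (- K) x \<partial>M)"
  proof (rule integral_mono)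
    show "integrable M (\<lambda>x. 2 * B * indicator (- K) x)"
      using Ks by (intro integrable_mult_right) (simp add: emeasure_eq_measure)
    fix x
    show "\<bar>f x - g x\<bar> \<le> 2 * B * indicator (- K) x"
    proof (cases "x \<in> K")
      case True then show ?thesis using K(2) by simp
    next
      case False then show ?thesis using f(2)[of x] g(2)[of x] by (simp add: abs_le_iff)
    qed
  qed (use i in simp)
  also have "\<dots> = 2 * B * measure M (- K)" using Ks by simp
  finally show ?thesis .
qed

text \<open>Coding the space by reals reduces the theorem to Helly's selection theorem. On the code of each of the
  compact sets of almost full mass, decoding is uniformly continuous, hence extends to the closure of the code; the
  closures have almost full mass in the limit law \<open>\<nu>\<close> as well, and decoding \<open>\<nu>\<close> gives the limit measure. A
  bounded continuous function of the decoded point is continuous on the closed code of the compact set and extends to the line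
  by Tietze's theorem, so that its integrals converge.\<close>

theorem prokhorov:
  fixes M :: "nat \<Rightarrow> 'b::polish_space measure"
  assumes M: "\<And>n. M n \<in> borel_probs" and K: "\<And>i::nat. compact (K i)" "incseq K"
    and tight: "\<And>i n. measure (M n) (- K i) \<le> \<delta> i" and \<delta>: "\<delta> \<longlonglongrightarrow> 0"
  shows "\<exists>r N. strict_mono (r :: nat \<Rightarrow> nat) \<and> wconv (\<lambda>k. M (r k)) N"
proof -
  obtain d :: "nat \<Rightarrow> 'b" where "dense_seq d" using dense_seq_exists by blast
  then interpret dense_seq d .
  have Mp: "prob_space (M n)" and Ms [measurable_cong]: "sets (M n) = sets borel" for n
    using borel_probsD[OF M[of n]] by auto
  have cM: "code \<in> borel_measurable (M n)" for n by measurable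
  define V where "V n = distr (M n) borel code" for n
  have V: "V n \<in> borel_probs" for n
    unfolding V_def by (intro borel_probsI prob_space.prob_space_distr[OF Mp cM]) simp
  have intV: "(\<integral>x. f x \<partial>V n) = (\<integral>y. f (code y) \<partial>M n)" if "f \<in> borel_measurable borel" for f :: "real \<Rightarrow> real" and n
    unfolding V_def by (rule integral_distr[OF cM that])
  have rd: "real_distribution (V n)" for n
    unfolding real_distribution_def real_distribution_axioms_def using borel_probsD[OF V[of n]] by simp
  have "tight V"
    unfolding tight_def
  proof (intro conjI allI impI rd)
    fix \<epsilon> :: real assume "\<epsilon> > 0"
    have "measure (V n) {-1<..1} = 1" for n
    proof -
      have "code -` {-1<..1} \<inter> space (M n) = space (M n)"
      proof -
        have "-1 < code y" "code y \<le> 1" for y unfolding code_def using cantor_bounds by (auto intro: less_le_trans[of _ 0])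
        then show ?thesis by auto
      qed
      then show ?thesis unfolding V_def by (subst measure_distr[OF cM]) (simp_all add: prob_space.prob_space[OF Mp])
    qed
    then show "\<exists>a b. a < b \<and> (\<forall>n. 1 - \<epsilon> < measure (V n) {a<..b})"
      using \<open>\<epsilon> > 0\<close> by (intro exI[of _ "-1"] exI[of _ 1]) simp
  qed
  from tight_imp_convergent_subsubsequence[OF this strict_mono_id]
  obtain r \<nu> where r: "strict_mono r" "real_distribution \<nu>" "weak_conv_m (V \<circ> id \<circ> r) \<nu>" by blast
  interpret \<nu>: real_distribution \<nu> by fact
  have \<nu>p: "\<nu> \<in> borel_probs" by (intro borel_probsI \<nu>.prob_space_axioms \<nu>.events_eq_borel)
  have Vlim: "(\<lambda>n. \<integral>x. f x \<partial>V (r n)) \<longlonglongrightarrow> (\<integral>x. f x \<partial>\<nu>)"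
    if f: "continuous_on UNIV f" "\<And>x. \<bar>f x\<bar> \<le> B" for f :: "real \<Rightarrow> real" and B
    using weak_conv_imp_integral_bdd_continuous_conv[of "\<lambda>n. V (r n)" \<nu> f B] rd r f
    by (simp add: comp_def continuous_on_eq_continuous_at)
  define CL where "CL i = closure (code ` K i)" for i
  have CLc: "closed (CL i)" for i by (simp add: CL_def)
  have CLm: "CL i \<subseteq> CL j" if "i \<le> j" for i j
    unfolding CL_def using K(2) that by (intro closure_mono image_mono) (auto simp: incseq_def)
  have codeCL: "code y \<in> CL i" if "y \<in> K i" for y i
    unfolding CL_def using that by (intro subsetD[OF closure_subset] imageI)
  have Kb: "K i \<in> sets borel" for i using K(1)[of i] by (simp add: compact_imp_closed)
  have VCL: "1 - \<delta> i \<le> measure (V n) (CL i)" for n i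
  proof -
    interpret Mn: prob_space "M n" by (rule Mp)
    have "1 - \<delta> i \<le> measure (M n) (K i)"
      using tight[of n i] Mn.prob_compl[of "K i"] Kb[of i] borel_probsD(2,3)[OF M[of n]] by (simp add: Compl_eq_Diff_UNIV)
    also have "\<dots> \<le> measure (M n) (code -` CL i \<inter> space (M n))"
    proof (rule Mn.finite_measure_mono)
      show "code -` CL i \<inter> space (M n) \<in> sets (M n)"
        by (rule measurable_sets[OF cM]) (simp add: CLc)
      show "K i \<subseteq> code -` CL i \<inter> space (M n)" using codeCL borel_probsD(3)[OF M[of n]] by auto
    qed
    also have "\<dots> = measure (V n) (CL i)"
      unfolding V_def using CLc[of i] by (subst measure_distr[OF cM]) simp_all
    finally show ?thesis .
  qed
  have \<nu>CL: "measure \<nu> (- CL i) \<le> \<delta> i" for i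
  proof -
    have "1 - \<delta> i \<le> (\<integral>x. bump (CL i) m x \<partial>\<nu>)" for m
    proof (rule LIMSEQ_le_const)
      show "(\<lambda>n. \<integral>x. bump (CL i) m x \<partial>V (r n)) \<longlonglongrightarrow> (\<integral>x. bump (CL i) m x \<partial>\<nu>)"
        by (rule Vlim[OF continuous_bump bump_bounds(3)])
      have "1 - \<delta> i \<le> (\<integral>x. bump (CL i) m x \<partial>V n)" for n
      proof -
        interpret Vn: prob_space "V n" using borel_probsD(1)[OF V[of n]] .
        have s: "CL i \<in> sets (V n)" using CLc[of i] by (simp add: V_def)
        have "measure (V n) (CL i) = (\<integral>x. indicator (CL i) x \<partial>V n)" using s by simp
        also have "\<dots> \<le> (\<integral>x. bump (CL i) m x \<partial>V n)"
        proof (rule integral_mono)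
          show "integrable (V n) (indicat_real (CL i))" using s by (simp add: Vn.emeasure_eq_measure)
          show "integrable (V n) (bump (CL i) m)" by (rule integrable_borel_probs[OF V bump_borel bump_bounds(3)])
        qed (simp add: indicator_def bump_eq_1 bump_bounds)
        finally show ?thesis using VCL[of i n] by linarith
      qed
      then show "\<exists>N. \<forall>n\<ge>N. 1 - \<delta> i \<le> (\<integral>x. bump (CL i) m x \<partial>V (r n))" by blast
    qed
    moreover have "(\<lambda>m. \<integral>x. bump (CL i) m x \<partial>\<nu>) \<longlonglongrightarrow> measure \<nu> (CL i)"
      by (rule integral_bump_tendsto[OF \<nu>.finite_measure_axioms \<nu>.events_eq_borel CLc])
    ultimately have "1 - \<delta> i \<le> measure \<nu> (CL i)" by (intro LIMSEQ_le_const[of _ "measure \<nu> (CL i)" "1 - \<delta> i"]) auto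
    then show ?thesis using \<nu>.prob_compl[of "CL i"] CLc[of i] by (simp add: Compl_eq_Diff_UNIV)
  qed
  have "\<exists>g. continuous_on (CL i) g \<and> (\<forall>y\<in>K i. g (code y) = y) \<and>
    (\<forall>h. continuous_on (CL i) h \<longrightarrow> (\<forall>y\<in>K i. h (code y) = y) \<longrightarrow> (\<forall>x\<in>CL i. h x = g x))" for i
  proof -
    obtain g where g: "uniformly_continuous_on (CL i) g" "\<And>x. x \<in> code ` K i \<Longrightarrow> inv code x = g x"
      "\<And>Y h x. code ` K i \<subseteq> Y \<Longrightarrow> Y \<subseteq> CL i \<Longrightarrow> continuous_on Y h \<Longrightarrow> (\<And>x. x \<in> code ` K i \<Longrightarrow> inv code x = h x) \<Longrightarrow> x \<in> Y \<Longrightarrow> h x = g x"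
      unfolding CL_def by (rule uniformly_continuous_on_extension_on_closure[OF uniformly_continuous_decode[OF K(1)[of i]]]) blast
    show ?thesis
    proof (intro exI[of _ g] conjI ballI allI impI)
      show "continuous_on (CL i) g" using g(1) by (rule uniformly_continuous_imp_continuous)
      show "g (code y) = y" if "y \<in> K i" for y using g(2)[of "code y"] that by (simp add: inv_f_f[OF inj_code])
      fix h x assume h: "continuous_on (CL i) h" "\<forall>y\<in>K i. h (code y) = y" "x \<in> CL i"
      show "h x = g x"
        by (rule g(3)[of "CL i"]) (use h codeCL in \<open>auto simp: inv_f_f[OF inj_code]\<close>)
    qed
  qed
  then obtain \<phi> where \<phi>: "\<And>i. continuous_on (CL i) (\<phi> i)" "\<And>i y. y \<in> K i \<Longrightarrow> \<phi> i (code y) = y"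
    "\<And>i h x. continuous_on (CL i) h \<Longrightarrow> (\<And>y. y \<in> K i \<Longrightarrow> h (code y) = y) \<Longrightarrow> x \<in> CL i \<Longrightarrow> h x = \<phi> i x"
    by metis
  \<comment> \<open>the extensions are consistent because each is the only continuous one\<close>
  have \<phi>_eq: "\<phi> j x = \<phi> i x" if "i \<le> j" "x \<in> CL i" for i j x
  proof (rule \<phi>(3))
    show "continuous_on (CL i) (\<phi> j)" using \<phi>(1)[of j] CLm[OF that(1)] by (rule continuous_on_subset)
    show "\<phi> j (code y) = y" if "y \<in> K i" for y
      using \<phi>(2)[of y j] K(2) that \<open>i \<le> j\<close> by (auto simp: incseq_def)
  qed (rule that(2))
  define G where "G i x = (if x \<in> CL i then \<phi> i x else d 0)" for i x
  have Gm: "G i \<in> borel_measurable borel" for i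
    unfolding G_def by (rule borel_measurable_continuous_on_if[OF _ \<phi>(1)]) (use CLc in auto)
  \<comment> \<open>decoding on the union of the closed codes, which carries \<open>\<nu>\<close>; elsewhere the value is irrelevant\<close>
  define g where "g x = (if \<exists>i. x \<in> CL i then \<phi> (LEAST i. x \<in> CL i) x else d 0)" for x
  have g_eq: "g x = \<phi> i x" if "x \<in> CL i" for x i
    using that \<phi>_eq[OF Least_le[of "\<lambda>i. x \<in> CL i" i] LeastI[of "\<lambda>i. x \<in> CL i" i]] unfolding g_def by auto
  have gm [measurable]: "g \<in> borel_measurable borel"
  proof (rule borel_measurable_LIMSEQ_metric[OF Gm])
    fix x
    show "(\<lambda>i. G i x) \<longlonglongrightarrow> g x"
    proof (cases "\<exists>i. x \<in> CL i")
      case True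
      then obtain i where "x \<in> CL i" by blast
      then have "\<And>j. j \<ge> i \<Longrightarrow> G j x = g x" using CLm g_eq unfolding G_def by (metis subsetD)
      then show ?thesis by (intro tendsto_eventually) (auto simp: eventually_sequentially)
    next
      case False then show ?thesis by (simp add: G_def g_def)
    qed
  qed
  have g\<nu>: "g \<in> borel_measurable \<nu>" using gm by (simp cong: measurable_cong_sets)
  define N where "N = distr \<nu> borel g"
  have N: "N \<in> borel_probs" unfolding N_def by (intro borel_probsI \<nu>.prob_space_distr[OF g\<nu>]) simp
  have "(\<lambda>n. \<integral>x. f x \<partial>M (r n)) \<longlonglongrightarrow> (\<integral>x. f x \<partial>N)" if "f \<in> Cb euclidean" for f
  proof (rule LIMSEQ_I)
    fix e :: real assume e: "e > 0"
    obtain B where fB: "\<And>x. \<bar>f x\<bar> \<le> B" and fc: "continuous_on UNIV f" using \<open>f \<in> Cb euclidean\<close> unfolding Cb_euclidean_iff by blast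
    have fm [measurable]: "f \<in> borel_measurable borel" using fc by (rule borel_measurable_continuous_onI)
    have B: "B \<ge> 0" using fB[of "d 0"] by linarith
    have "(\<lambda>i. 4 * B * \<delta> i) \<longlonglongrightarrow> 4 * B * 0" by (intro tendsto_mult tendsto_const \<delta>)
    then have "\<forall>\<^sub>F i in sequentially. 4 * B * \<delta> i < e / 2" using e by (intro order_tendstoD(2)) auto
    then obtain i where i: "4 * B * \<delta> i < e / 2" by (auto simp: eventually_sequentially)
    have "continuous_on (CL i) (\<lambda>x. f (\<phi> i x))"
      by (rule continuous_on_compose2[OF fc \<phi>(1)]) auto
    then obtain F where F: "continuous_on UNIV F" "\<And>x. x \<in> CL i \<Longrightarrow> F x = f (\<phi> i x)" "\<And>x. \<bar>F x\<bar> \<le> B"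
      by (rule Tietze[where U=UNIV and B=B]) (use CLc B fB in auto)
    have Fm [measurable]: "F \<in> borel_measurable borel" using F(1) by (rule borel_measurable_continuous_onI)
    \<comment> \<open>both replacements of the decoded \<open>f\<close> by \<open>F\<close> cost at most the mass outside of the compact set\<close>
    have 1: "\<bar>(\<integral>x. f x \<partial>M (r n)) - (\<integral>x. F x \<partial>V (r n))\<bar> \<le> 2 * B * \<delta> i" for n
    proof -
      have "\<bar>(\<integral>x. f x \<partial>M (r n)) - (\<integral>y. F (code y) \<partial>M (r n))\<bar> \<le> 2 * B * measure (M (r n)) (- K i)"
        by (rule integral_diff_bound[OF M fm fB _ F(3) Kb]) (measurable, simp add: F(2) codeCL \<phi>(2))
      also have "\<dots> \<le> 2 * B * \<delta> i" using B tight by (intro mult_left_mono) auto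
      finally show ?thesis by (simp add: intV)
    qed
    have 2: "\<bar>(\<integral>x. f x \<partial>N) - (\<integral>x. F x \<partial>\<nu>)\<bar> \<le> 2 * B * \<delta> i"
    proof -
      have "(\<integral>x. f x \<partial>N) = (\<integral>x. f (g x) \<partial>\<nu>)" unfolding N_def by (rule integral_distr[OF g\<nu> fm])
      moreover have "\<bar>(\<integral>x. f (g x) \<partial>\<nu>) - (\<integral>x. F x \<partial>\<nu>)\<bar> \<le> 2 * B * measure \<nu> (- CL i)"
        by (rule integral_diff_bound[OF \<nu>p _ fB Fm F(3)]) (measurable, use CLc in \<open>simp_all add: F(2) g_eq\<close>)
      moreover have "2 * B * measure \<nu> (- CL i) \<le> 2 * B * \<delta> i" using B \<nu>CL by (intro mult_left_mono) auto
      ultimately show ?thesis by linarith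
    qed
    have "(\<lambda>n. \<integral>x. F x \<partial>V (r n)) \<longlonglongrightarrow> (\<integral>x. F x \<partial>\<nu>)" by (rule Vlim[OF F(1,3)])
    from LIMSEQ_D[OF this, of "e / 2"] e obtain n0 where n0: "\<And>n. n \<ge> n0 \<Longrightarrow> \<bar>(\<integral>x. F x \<partial>V (r n)) - (\<integral>x. F x \<partial>\<nu>)\<bar> < e / 2"
      by auto
    show "\<exists>no. \<forall>n\<ge>no. norm ((\<integral>x. f x \<partial>M (r n)) - (\<integral>x. f x \<partial>N)) < e"
    proof (intro exI[of _ n0] allI impI)
      fix n assume "n \<ge> n0"
      from n0[OF this] 1[of n] 2 i show "norm ((\<integral>x. f x \<partial>M (r n)) - (\<integral>x. f x \<partial>N)) < e"
        unfolding real_norm_def by linarith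
    qed
  qed
  then have "wconv (\<lambda>k. M (r k)) N" using M N by (simp add: wconv_def)
  with r(1) show ?thesis by blast
qed

text \<open>Markov's inequality turns the bound on the integral of \<open>\<tau>\<close> into tightness, and Fatou's lemma applied to the
  truncations of \<open>\<tau>\<close> preserves the bound in the limit.\<close>

lemma wcompact_moment:
  fixes \<tau> :: "'b::polish_space \<Rightarrow> real"
  assumes \<tau>: "continuous_on UNIV \<tau>" "\<And>x. 0 \<le> \<tau> x" and K: "\<And>i::nat. compact (K i)" "incseq K"
    and big: "\<And>i x. x \<notin> K i \<Longrightarrow> real i \<le> \<tau> x" and c: "c \<ge> 0"
  shows "wcompact {M \<in> borel_probs. (\<integral>\<^sup>+x. ennreal (\<tau> x) \<partial>M) \<le> ennreal c}"
  unfolding wcompact_def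
proof (intro conjI allI impI)
  fix M :: "nat \<Rightarrow> 'b measure" assume "\<forall>n. M n \<in> {M \<in> borel_probs. (\<integral>\<^sup>+x. ennreal (\<tau> x) \<partial>M) \<le> ennreal c}"
  then have M: "\<And>n. M n \<in> borel_probs" "\<And>n. (\<integral>\<^sup>+x. ennreal (\<tau> x) \<partial>M n) \<le> ennreal c" by auto
  have \<tau>m [measurable]: "\<tau> \<in> borel_measurable borel" using \<tau>(1) by (rule borel_measurable_continuous_onI)
  have tight: "measure (M n) (- K (Suc i)) \<le> c / real (Suc i)" for n i
  proof -
    interpret prob_space "M n" using borel_probsD(1)[OF M(1)] .
    note [measurable_cong] = borel_probsD(2)[OF M(1), of n]
    have Ks: "- K (Suc i) \<in> sets (M n)"
      using K(1)[of "Suc i"] borel_probsD(2)[OF M(1), of n] by (auto simp: compact_imp_closed open_Compl)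
    have "ennreal (real (Suc i)) * emeasure (M n) (- K (Suc i)) = (\<integral>\<^sup>+x. ennreal (real (Suc i)) * indicator (- K (Suc i)) x \<partial>M n)"
      using Ks by (simp add: nn_integral_cmult_indicator)
    also have "\<dots> \<le> (\<integral>\<^sup>+x. ennreal (\<tau> x) \<partial>M n)"
      using big[of _ "Suc i"] by (intro nn_integral_mono) (auto simp: indicator_def intro!: ennreal_leI simp del: of_nat_Suc)
    also have "\<dots> \<le> ennreal c" by (rule M(2))
    finally have "ennreal (real (Suc i) * measure (M n) (- K (Suc i))) \<le> ennreal c"
      by (simp add: emeasure_eq_measure ennreal_mult'' del: of_nat_Suc)
    then have "real (Suc i) * measure (M n) (- K (Suc i)) \<le> c" using c by (simp add: ennreal_le_iff del: of_nat_Suc)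
    then show ?thesis by (simp add: field_simps del: of_nat_Suc)
  qed
  have "(\<lambda>i. c * inverse (real (Suc i))) \<longlonglongrightarrow> c * 0" by (intro tendsto_mult tendsto_const LIMSEQ_inverse_real_of_nat)
  then have "(\<lambda>i. c / real (Suc i)) \<longlonglongrightarrow> 0" by (simp add: divide_inverse)
  moreover have "incseq (\<lambda>i. K (Suc i))" using K(2) by (simp add: incseq_def)
  ultimately obtain r N where r: "strict_mono (r :: nat \<Rightarrow> nat)" "wconv (\<lambda>k. M (r k)) N"
    using prokhorov[of M "\<lambda>i. K (Suc i)" "\<lambda>i. c / real (Suc i)"] M(1) K(1) tight by blast
  have N: "N \<in> borel_probs" using r(2) by (simp add: wconv_def)
  note [measurable_cong] = borel_probsD(2)[OF N]
  have "(\<integral>\<^sup>+x. ennreal (min (\<tau> x) (real m)) \<partial>N) \<le> ennreal c" for m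
  proof -
    have b: "\<bar>min (\<tau> x) (real m)\<bar> \<le> real m" for x using \<tau>(2)[of x] by (simp add: min_def)
    have fC: "(\<lambda>x. min (\<tau> x) (real m)) \<in> Cb euclidean"
      unfolding Cb_euclidean_iff using \<tau>(1) by (intro conjI exI[of _ "real m"] allI b continuous_intros)
    have fm: "(\<lambda>x. min (\<tau> x) (real m)) \<in> borel_measurable borel" by measurable
    have eqL: "(\<integral>\<^sup>+x. ennreal (min (\<tau> x) (real m)) \<partial>L) = ennreal (\<integral>x. min (\<tau> x) (real m) \<partial>L)" if "L \<in> borel_probs" for L
      by (rule nn_integral_eq_integral[OF integrable_borel_probs[OF that fm b]]) (use \<tau>(2) in auto)
    have "(\<integral>x. min (\<tau> x) (real m) \<partial>N) \<le> c"
    proof (rule LIMSEQ_le_const2)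
      show "(\<lambda>k. \<integral>x. min (\<tau> x) (real m) \<partial>M (r k)) \<longlonglongrightarrow> (\<integral>x. min (\<tau> x) (real m) \<partial>N)"
        using r(2) fC by (simp add: wconv_def)
      have "(\<integral>x. min (\<tau> x) (real m) \<partial>M k) \<le> c" for k
      proof -
        have "(\<integral>\<^sup>+x. ennreal (min (\<tau> x) (real m)) \<partial>M k) \<le> (\<integral>\<^sup>+x. ennreal (\<tau> x) \<partial>M k)"
          by (intro nn_integral_mono ennreal_leI) simp
        with M(2)[of k] eqL[OF M(1)[of k]] have "ennreal (\<integral>x. min (\<tau> x) (real m) \<partial>M k) \<le> ennreal c" by simp
        then show ?thesis using c by (simp add: ennreal_le_iff)
      qed
      then show "\<exists>N. \<forall>k\<ge>N. (\<integral>x. min (\<tau> x) (real m) \<partial>M (r k)) \<le> c" by blast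
    qed
    then show ?thesis unfolding eqL[OF N] by (rule ennreal_leI)
  qed
  moreover have "(\<integral>\<^sup>+x. ennreal (\<tau> x) \<partial>N) \<le> liminf (\<lambda>m. \<integral>\<^sup>+x. ennreal (min (\<tau> x) (real m)) \<partial>N)"
  proof -
    have "ennreal (\<tau> x) = liminf (\<lambda>m. ennreal (min (\<tau> x) (real m)))" for x
    proof -
      have "\<forall>\<^sub>F m in sequentially. \<tau> x \<le> real m"
      proof -
        obtain n where "\<tau> x < real n" using reals_Archimedean2 by blast
        then have "\<forall>m\<ge>n. \<tau> x \<le> real m" by (meson less_imp_le of_nat_mono order_trans)
        then show ?thesis by (auto simp: eventually_sequentially)
      qed
      then have "(\<lambda>m. ennreal (min (\<tau> x) (real m))) \<longlonglongrightarrow> ennreal (\<tau> x)"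
        by (intro tendsto_eventually) (auto elim!: eventually_mono simp: min_def)
      then show ?thesis by (intro lim_imp_Liminf[symmetric]) simp_all
    qed
    then have "(\<integral>\<^sup>+x. ennreal (\<tau> x) \<partial>N) = (\<integral>\<^sup>+x. liminf (\<lambda>m. ennreal (min (\<tau> x) (real m))) \<partial>N)" by simp
    also have "\<dots> \<le> liminf (\<lambda>m. \<integral>\<^sup>+x. ennreal (min (\<tau> x) (real m)) \<partial>N)"
      by (rule nn_integral_liminf) measurable
    finally show ?thesis .
  qed
  moreover have "liminf (\<lambda>m. \<integral>\<^sup>+x. ennreal (min (\<tau> x) (real m)) \<partial>N) \<le> ennreal c" if "\<And>m. (\<integral>\<^sup>+x. ennreal (min (\<tau> x) (real m)) \<partial>N) \<le> ennreal c"
    using Liminf_mono[of "\<lambda>m. \<integral>\<^sup>+x. ennreal (min (\<tau> x) (real m)) \<partial>N" "\<lambda>_. ennreal c" sequentially] that by (simp add: Liminf_const)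
  ultimately have "(\<integral>\<^sup>+x. ennreal (\<tau> x) \<partial>N) \<le> ennreal c" by (meson order_trans)
  with r N show "\<exists>r N. strict_mono r \<and> N \<in> {M \<in> borel_probs. (\<integral>\<^sup>+x. ennreal (\<tau> x) \<partial>M) \<le> ennreal c} \<and> wconv (\<lambda>k. M (r k)) N"
    by blast
qed auto

text \<open>The case \<open>\<tau> = 0\<close> with the whole space as compact set.\<close>

lemma wcompact_borel_probs:
  assumes "compact (UNIV :: 'b::polish_space set)"
  shows "wcompact (borel_probs :: 'b measure set)"
proof -
  have "wcompact {M \<in> (borel_probs :: 'b measure set). (\<integral>\<^sup>+x. ennreal 0 \<partial>M) \<le> ennreal 0}"
    by (rule wcompact_moment[where K="\<lambda>_. UNIV"]) (use assms in \<open>auto simp: incseq_def\<close>)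
  then show ?thesis by simp
qed

section \<open>Kernels, joint laws and mixtures\<close>

lemma kernel_measurable_subprob: "k \<in> borel \<rightarrow>\<^sub>M prob_algebra borel \<Longrightarrow> M \<in> borel_probs \<Longrightarrow> k \<in> M \<rightarrow>\<^sub>M subprob_algebra borel"
  using measurable_prob_algebraD[of k borel borel] measurable_cong_sets[OF borel_probsD(2)[of M] refl, of "subprob_algebra borel"] by auto

lemma bind_borel_probs:
  assumes "M \<in> borel_probs" "k \<in> borel \<rightarrow>\<^sub>M prob_algebra borel"
  shows "M \<bind> k \<in> borel_probs"
proof (rule borel_probsI)
  have M: "M \<in> space (prob_algebra borel)" using assms(1) by (simp add: borel_probs_eq)
  show "prob_space (M \<bind> k)" by (rule prob_space_bind'[OF M assms(2)])
  show "sets (M \<bind> k) = sets borel" by (rule sets_bind'[OF M assms(2)])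
qed

lemma integral_bind_kernel:
  fixes f :: "'c::topological_space \<Rightarrow> real"
  assumes M: "M \<in> borel_probs" and k: "k \<in> borel \<rightarrow>\<^sub>M prob_algebra borel"
    and f: "f \<in> borel_measurable borel" "\<And>x. \<bar>f x\<bar> \<le> B"
  shows "(\<integral>x. f x \<partial>(M \<bind> k)) = (\<integral>x. (\<integral>y. f y \<partial>k x) \<partial>M)"
proof (rule integral_bind[OF f(1)])
  show "k \<in> M \<rightarrow>\<^sub>M subprob_algebra borel" by (rule kernel_measurable_subprob[OF k M])
  show "finite_measure M" using borel_probsD(1)[OF M] by (rule prob_space.axioms(1))
  have "emeasure (k x) (space (k x)) = 1" for x
    using borel_probsD(1)[OF borel_probs_measurable_prob_algebra[OF k]] by (rule prob_space.emeasure_space_1)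
  then show "AE x in M. emeasure (k x) (space (k x)) \<le> ennreal 1" by simp
qed (rule f(2))

lemma nn_integral_bind_kernel:
  assumes M: "M \<in> borel_probs" and k: "k \<in> borel \<rightarrow>\<^sub>M prob_algebra borel" and f: "f \<in> borel_measurable borel"
  shows "(\<integral>\<^sup>+x. f x \<partial>(M \<bind> k)) = (\<integral>\<^sup>+x. (\<integral>\<^sup>+y. f y \<partial>k x) \<partial>M)"
  by (rule nn_integral_bind[OF f kernel_measurable_subprob[OF k M]])

lemma integral_kernel_measurable:
  fixes f :: "'c::topological_space \<Rightarrow> real"
  assumes k: "k \<in> borel \<rightarrow>\<^sub>M prob_algebra borel" and f: "f \<in> borel_measurable borel"
  shows "(\<lambda>x. \<integral>y. f y \<partial>k x) \<in> borel_measurable borel"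
  using measurable_compose[OF measurable_prob_algebraD[OF k] integral_measurable_subprob_algebra[OF f]] by simp

text \<open>The integral of a bounded continuous function under the bind is an iterated integral whose inner integrals
  converge continuously, so \<open>wconv_integral\<close> applies.\<close>

lemma wconv_bind:
  fixes N :: "'b::metric_space measure" and l :: "'b \<Rightarrow> 'c::metric_space measure"
  assumes w: "wconv M N" and k: "\<And>n. k n \<in> borel \<rightarrow>\<^sub>M prob_algebra borel" and l: "l \<in> borel \<rightarrow>\<^sub>M prob_algebra borel"
    and cont: "\<And>ys y. ys \<longlonglongrightarrow> y \<Longrightarrow> wconv (\<lambda>j. l (ys j)) (l y)"
    and conv: "\<And>r ys y. filterlim r at_top sequentially \<Longrightarrow> ys \<longlonglongrightarrow> y \<Longrightarrow> wconv (\<lambda>j. k (r j) (ys j)) (l y)"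
  shows "wconv (\<lambda>n. M n \<bind> k n) (N \<bind> l)"
  unfolding wconv_def
proof (intro conjI allI ballI)
  have M: "M n \<in> borel_probs" and N: "N \<in> borel_probs" for n using w by (auto simp: wconv_def)
  show "M n \<bind> k n \<in> borel_probs" "N \<bind> l \<in> borel_probs" for n by (intro bind_borel_probs M N k l)+
  fix f :: "'c \<Rightarrow> real" assume f: "f \<in> Cb euclidean"
  then obtain B where B: "\<And>x. \<bar>f x\<bar> \<le> B" unfolding Cb_euclidean_iff by blast
  have fm: "f \<in> borel_measurable borel" by (rule Cb_borel[OF f])
  have "(\<lambda>n. \<integral>x. (\<integral>y. f y \<partial>k n x) \<partial>M n) \<longlonglongrightarrow> (\<integral>x. (\<integral>y. f y \<partial>l x) \<partial>N)"
  proof (rule wconv_integral[OF w])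
    show "continuous_on UNIV (\<lambda>x. \<integral>y. f y \<partial>l x)"
      unfolding continuous_on_sequentially
    proof (intro allI ballI impI)
      fix x :: "nat \<Rightarrow> 'b" and a assume "(\<forall>n. x n \<in> UNIV) \<and> x \<longlonglongrightarrow> a"
      then show "((\<lambda>x. \<integral>y. f y \<partial>l x) \<circ> x) \<longlonglongrightarrow> (\<integral>y. f y \<partial>l a)"
        using cont[of x a] f by (simp add: wconv_def comp_def)
    qed
    show "(\<lambda>x. \<integral>y. f y \<partial>k n x) \<in> borel_measurable borel" for n by (rule integral_kernel_measurable[OF k fm])
    show "\<bar>\<integral>y. f y \<partial>k n x\<bar> \<le> B" for n x
      by (rule integral_bounded_borel_probs[OF borel_probs_measurable_prob_algebra[OF k] fm B])
    show "(\<lambda>j. \<integral>z. f z \<partial>k (r j) (ys j)) \<longlonglongrightarrow> (\<integral>z. f z \<partial>l y)" if "filterlim r at_top sequentially" "ys \<longlonglongrightarrow> y" for r ys y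
      using conv[OF that] f by (simp add: wconv_def)
  qed
  then show "(\<lambda>n. \<integral>x. f x \<partial>(M n \<bind> k n)) \<longlonglongrightarrow> (\<integral>x. f x \<partial>(N \<bind> l))"
    by (simp add: integral_bind_kernel[OF M k fm B] integral_bind_kernel[OF N l fm B])
qed

text \<open>The law of a pair whose first component has law \<open>\<xi>\<close> and whose second component has conditional law
  \<open>p x\<close> given the first one.\<close>

definition joint :: "'b::topological_space measure \<Rightarrow> ('b \<Rightarrow> 'c::topological_space measure) \<Rightarrow> ('b \<times> 'c) measure" where
  "joint \<xi> p = \<xi> \<bind> (\<lambda>x. distr (p x) borel (Pair x))"

lemma measurable_Pair_kernel:
  fixes p :: "'b::second_countable_topology \<Rightarrow> 'c::second_countable_topology measure"
  assumes p: "p \<in> borel \<rightarrow>\<^sub>M prob_algebra borel"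
  shows "(\<lambda>x. distr (p x) borel (Pair x)) \<in> borel \<rightarrow>\<^sub>M prob_algebra borel"
proof (rule measurable_distr_prob_space2[OF p])
  have "(\<lambda>(x::'b, y::'c). (x, y)) \<in> borel \<Otimes>\<^sub>M borel \<rightarrow>\<^sub>M borel"
    by (simp add: borel_prod measurable_ident_sets)
  then show "(\<lambda>(x, y). (x, y)) \<in> borel \<Otimes>\<^sub>M borel \<rightarrow>\<^sub>M (borel :: ('b \<times> 'c) measure)" .
qed

lemma joint_borel_probs:
  fixes \<xi> :: "'b::second_countable_topology measure" and p :: "'b \<Rightarrow> 'c::second_countable_topology measure"
  assumes "\<xi> \<in> borel_probs" "p \<in> borel \<rightarrow>\<^sub>M prob_algebra borel"
  shows "joint \<xi> p \<in> borel_probs"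
  unfolding joint_def by (intro bind_borel_probs assms measurable_Pair_kernel)

lemma measurable_Pair_borel:
  fixes x :: "'b::second_countable_topology"
  assumes "M \<in> (borel_probs :: 'c::second_countable_topology measure set)"
  shows "Pair x \<in> M \<rightarrow>\<^sub>M borel"
proof -
  have "Pair x \<in> (borel :: 'c measure) \<rightarrow>\<^sub>M borel \<Otimes>\<^sub>M borel" by measurable
  then have "Pair x \<in> (borel :: 'c measure) \<rightarrow>\<^sub>M borel" by (simp only: borel_prod)
  then show ?thesis by (simp only: measurable_cong_sets[OF borel_probsD(2)[OF assms] refl])
qed

lemma integral_joint:
  fixes \<xi> :: "'b::second_countable_topology measure" and p :: "'b \<Rightarrow> 'c::second_countable_topology measure"
    and f :: "'b \<times> 'c \<Rightarrow> real"
  assumes \<xi>: "\<xi> \<in> borel_probs" and p: "p \<in> borel \<rightarrow>\<^sub>M prob_algebra borel"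
    and f: "f \<in> borel_measurable borel" "\<And>z. \<bar>f z\<bar> \<le> B"
  shows "(\<integral>z. f z \<partial>joint \<xi> p) = (\<integral>x. (\<integral>a. f (x, a) \<partial>p x) \<partial>\<xi>)"
  unfolding joint_def integral_bind_kernel[OF \<xi> measurable_Pair_kernel[OF p] f]
  by (intro Bochner_Integration.integral_cong refl integral_distr f(1)
      measurable_Pair_borel borel_probs_measurable_prob_algebra[OF p])

lemma nn_integral_joint:
  fixes \<xi> :: "'b::second_countable_topology measure" and p :: "'b \<Rightarrow> 'c::second_countable_topology measure"
  assumes \<xi>: "\<xi> \<in> borel_probs" and p: "p \<in> borel \<rightarrow>\<^sub>M prob_algebra borel" and f: "f \<in> borel_measurable borel"
  shows "(\<integral>\<^sup>+z. f z \<partial>joint \<xi> p) = (\<integral>\<^sup>+x. (\<integral>\<^sup>+a. f (x, a) \<partial>p x) \<partial>\<xi>)"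
  unfolding joint_def nn_integral_bind_kernel[OF \<xi> measurable_Pair_kernel[OF p] f]
  by (rule nn_integral_cong, rule nn_integral_distr[OF measurable_Pair_borel[OF borel_probs_measurable_prob_algebra[OF p]]])
    (simp add: f)

lemma Times_borel:
  fixes B :: "'b::second_countable_topology set" and C :: "'c::second_countable_topology set"
  assumes "B \<in> sets borel" "C \<in> sets borel"
  shows "B \<times> C \<in> sets borel"
  using pair_measureI[OF assms] by (simp only: borel_prod)

lemma emeasure_joint_Times:
  fixes \<xi> :: "'b::second_countable_topology measure" and p :: "'b \<Rightarrow> 'c::second_countable_topology measure"
  assumes \<xi>: "\<xi> \<in> borel_probs" and p: "p \<in> borel \<rightarrow>\<^sub>M prob_algebra borel" and B: "B \<in> sets borel" "C \<in> sets borel"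
  shows "emeasure (joint \<xi> p) (B \<times> C) = (\<integral>\<^sup>+x\<in>B. emeasure (p x) C \<partial>\<xi>)"
proof -
  have BC: "B \<times> C \<in> sets borel" by (rule Times_borel[OF B])
  have "emeasure (joint \<xi> p) (B \<times> C) = (\<integral>\<^sup>+z. indicator (B \<times> C) z \<partial>joint \<xi> p)"
    using BC borel_probsD(2)[OF joint_borel_probs[OF \<xi> p]] by simp
  also have "\<dots> = (\<integral>\<^sup>+x. (\<integral>\<^sup>+a. indicator (B \<times> C) (x, a) \<partial>p x) \<partial>\<xi>)"
    by (rule nn_integral_joint[OF \<xi> p]) (use BC in measurable)
  also have "\<dots> = (\<integral>\<^sup>+x. emeasure (p x) C * indicator B x \<partial>\<xi>)"
  proof (rule nn_integral_cong)
    fix x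
    have s: "sets (p x) = sets borel" by (rule borel_probsD(2)[OF borel_probs_measurable_prob_algebra[OF p]])
    have "(\<integral>\<^sup>+a. indicator (B \<times> C) (x, a) \<partial>p x) = (\<integral>\<^sup>+a. indicator B x * indicator C a \<partial>p x)"
      by (intro nn_integral_cong) (auto simp: indicator_def)
    also have "\<dots> = emeasure (p x) C * indicator B x"
      using B(2) s by (simp add: nn_integral_cmult mult.commute)
    finally show "(\<integral>\<^sup>+a. indicator (B \<times> C) (x, a) \<partial>p x) = emeasure (p x) C * indicator B x" .
  qed
  finally show ?thesis .
qed

lemma marg_joint:
  fixes \<xi> :: "'b::second_countable_topology measure" and p :: "'b \<Rightarrow> 'c::second_countable_topology measure"
  assumes \<xi>: "\<xi> \<in> borel_probs" and p: "p \<in> borel \<rightarrow>\<^sub>M prob_algebra borel"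
  shows "marg (joint \<xi> p) = \<xi>"
proof (rule measure_eqI)
  show "sets (marg (joint \<xi> p)) = sets \<xi>" using borel_probsD(2)[OF \<xi>] by (simp add: marg_def)
  fix B assume "B \<in> sets (marg (joint \<xi> p))"
  then have B: "B \<in> sets borel" by (simp add: marg_def)
  have f: "fst \<in> joint \<xi> p \<rightarrow>\<^sub>M borel"
    using measurable_cong_sets[OF borel_probsD(2)[OF joint_borel_probs[OF \<xi> p]] refl, of borel] borel_measurable_continuous_onI[OF continuous_on_fst[OF continuous_on_id]] by auto
  have "emeasure (marg (joint \<xi> p)) B = emeasure (joint \<xi> p) (fst -` B \<inter> space (joint \<xi> p))"
    unfolding marg_def using B by (rule emeasure_distr[OF f])
  also have "fst -` B \<inter> space (joint \<xi> p) = B \<times> UNIV" using borel_probsD(3)[OF joint_borel_probs[OF \<xi> p]] by auto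
  also have "emeasure (joint \<xi> p) (B \<times> UNIV) = (\<integral>\<^sup>+x\<in>B. emeasure (p x) UNIV \<partial>\<xi>)"
    by (rule emeasure_joint_Times[OF \<xi> p B]) simp
  also have "\<dots> = (\<integral>\<^sup>+x. indicator B x \<partial>\<xi>)"
  proof (rule nn_integral_cong)
    fix x
    have px: "p x \<in> borel_probs" by (rule borel_probs_measurable_prob_algebra[OF p])
    have "emeasure (p x) UNIV = 1" using prob_space.emeasure_space_1[OF borel_probsD(1)[OF px]] borel_probsD(3)[OF px] by simp
    then show "emeasure (p x) UNIV * indicator B x = indicator B x" by simp
  qed
  also have "\<dots> = emeasure \<xi> B" using B borel_probsD(2)[OF \<xi>] by simp
  finally show "emeasure (marg (joint \<xi> p)) B = emeasure \<xi> B" .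
qed

lemma marg_borel_probs:
  fixes \<psi> :: "('b::second_countable_topology \<times> 'c::second_countable_topology) measure"
  assumes "\<psi> \<in> borel_probs"
  shows "fst \<in> \<psi> \<rightarrow>\<^sub>M borel" "snd \<in> \<psi> \<rightarrow>\<^sub>M borel" "marg \<psi> \<in> borel_probs"
proof -
  have "(fst :: 'b \<times> 'c \<Rightarrow> 'b) \<in> borel_measurable borel" "(snd :: 'b \<times> 'c \<Rightarrow> 'c) \<in> borel_measurable borel"
    by (intro borel_measurable_continuous_onI continuous_intros)+
  then show 1: "fst \<in> \<psi> \<rightarrow>\<^sub>M borel" "snd \<in> \<psi> \<rightarrow>\<^sub>M borel"
    using measurable_cong_sets[OF borel_probsD(2)[OF assms] refl] by auto
  show "marg \<psi> \<in> borel_probs" unfolding marg_def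
    by (intro borel_probsI prob_space.prob_space_distr[OF borel_probsD(1)[OF assms] 1(1)]) simp
qed

text \<open>Rectangles generate the Borel sets of the product.\<close>

lemma disintegrates_imp_joint:
  fixes \<psi> :: "('b::polish_space \<times> 'c::polish_space) measure"
  assumes \<psi>: "\<psi> \<in> borel_probs" and d: "disintegrates \<psi> p"
  shows "p \<in> borel \<rightarrow>\<^sub>M prob_algebra borel" "\<psi> = joint (marg \<psi>) p"
proof -
  show p: "p \<in> borel \<rightarrow>\<^sub>M prob_algebra borel" using d by (simp add: disintegrates_def kernel_imp_measurable)
  have J: "joint (marg \<psi>) p \<in> borel_probs" by (rule joint_borel_probs[OF marg_borel_probs(3)[OF \<psi>] p])
  let ?E = "{a \<times> b | a b. a \<in> sets (borel :: 'b measure) \<and> b \<in> sets (borel :: 'c measure)}"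
  have sb: "sets (borel :: ('b \<times> 'c) measure) = sigma_sets UNIV ?E"
    unfolding borel_prod[symmetric] sets_pair_measure by simp
  show "\<psi> = joint (marg \<psi>) p"
  proof (rule measure_eqI_generator_eq[where E="?E" and \<Omega>=UNIV and A="\<lambda>_. UNIV"])
    show "Int_stable ?E" by (rule Int_stable_pair_measure_generator)
    show "sets \<psi> = sigma_sets UNIV ?E" "sets (joint (marg \<psi>) p) = sigma_sets UNIV ?E"
      using borel_probsD(2)[OF \<psi>] borel_probsD(2)[OF J] sb by simp_all
    show "range (\<lambda>_::nat. UNIV) \<subseteq> ?E"
      by (auto intro!: exI[of _ UNIV])
    show "emeasure \<psi> UNIV \<noteq> \<infinity>" for i :: nat
      using prob_space.emeasure_space_1[OF borel_probsD(1)[OF \<psi>]] borel_probsD(3)[OF \<psi>] by simp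
    fix X assume "X \<in> ?E"
    then obtain a b where ab: "X = a \<times> b" "a \<in> sets borel" "b \<in> sets borel" by blast
    then show "emeasure \<psi> X = emeasure (joint (marg \<psi>) p) X"
      using d emeasure_joint_Times[OF marg_borel_probs(3)[OF \<psi>] p ab(2,3)] by (simp add: disintegrates_def)
  qed simp_all
qed

text \<open>A mixture is the bind of a Bernoulli distribution. This makes it a probability measure and reduces its integrals to those
  of a bind.\<close>

lemma mixture_eq_bind:
  assumes M: "M \<in> borel_probs" and N: "N \<in> borel_probs" and g: "0 \<le> \<gamma>" "\<gamma> \<le> 1"
  shows "mixture \<gamma> M N = measure_pmf (bernoulli_pmf \<gamma>) \<bind> (\<lambda>b. if b then M else N)" (is "_ = ?R")
    and "mixture \<gamma> M N \<in> borel_probs"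
proof -
  have k: "(\<lambda>b. if b then M else N) \<in> measure_pmf (bernoulli_pmf \<gamma>) \<rightarrow>\<^sub>M prob_algebra borel"
    using M N by (auto simp: borel_probs_eq)
  have s: "sets ?R = sets borel" by (rule sets_bind'[of _ "count_space UNIV"]) (use k in \<open>auto simp: space_prob_algebra prob_space_measure_pmf\<close>)
  have p: "prob_space ?R" by (rule prob_space_bind'[of _ "count_space UNIV"]) (use k in \<open>auto simp: space_prob_algebra prob_space_measure_pmf\<close>)
  have e: "emeasure ?R B = ennreal \<gamma> * emeasure M B + ennreal (1 - \<gamma>) * emeasure N B" if "B \<in> sets borel" for B
  proof -
    have "emeasure ?R B = (\<integral>\<^sup>+b. emeasure (if b then M else N) B \<partial>measure_pmf (bernoulli_pmf \<gamma>))"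
      by (rule emeasure_bind[OF _ measurable_prob_algebraD[OF k] that]) simp
    also have "\<dots> = ennreal \<gamma> * emeasure M B + ennreal (1 - \<gamma>) * emeasure N B"
      using g by (simp add: nn_integral_measure_pmf nn_integral_count_space_finite UNIV_bool mult.commute add.commute)
    finally show ?thesis .
  qed
  have "mixture \<gamma> M N = measure_of UNIV (sets borel) (emeasure ?R)"
    unfolding mixture_def borel_probsD(2,3)[OF M]
    by (rule measure_of_eq) (auto simp: e sets.sigma_sets_eq[of borel, simplified])
  also have "\<dots> = ?R" using measure_of_of_measure[of ?R] s sets_eq_imp_space_eq[OF s] by simp
  finally show 1: "mixture \<gamma> M N = ?R" .
  show "mixture \<gamma> M N \<in> borel_probs" unfolding 1 by (rule borel_probsI[OF p s])
qed

lemma integral_mixture: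
  fixes f :: "'c::topological_space \<Rightarrow> real"
  assumes M: "M \<in> borel_probs" and N: "N \<in> borel_probs" and g: "0 \<le> \<gamma>" "\<gamma> \<le> 1"
    and f: "f \<in> borel_measurable borel" "\<And>x. \<bar>f x\<bar> \<le> B"
  shows "(\<integral>x. f x \<partial>mixture \<gamma> M N) = \<gamma> * (\<integral>x. f x \<partial>M) + (1 - \<gamma>) * (\<integral>x. f x \<partial>N)"
proof -
  have k: "(\<lambda>b. if b then M else N) \<in> measure_pmf (bernoulli_pmf \<gamma>) \<rightarrow>\<^sub>M prob_algebra borel"
    using M N by (auto simp: borel_probs_eq)
  have "(\<integral>x. f x \<partial>mixture \<gamma> M N) = (\<integral>b. (\<integral>x. f x \<partial>(if b then M else N)) \<partial>measure_pmf (bernoulli_pmf \<gamma>))"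
    unfolding mixture_eq_bind(1)[OF M N g]
  proof (rule integral_bind[OF f(1) f(2) measurable_prob_algebraD[OF k] measure_pmf.finite_measure_axioms])
    have "emeasure (if b then M else N) (space (if b then M else N)) = 1" for b
      using prob_space.emeasure_space_1[OF borel_probsD(1)[OF M]] prob_space.emeasure_space_1[OF borel_probsD(1)[OF N]] by simp
    then show "AE b in measure_pmf (bernoulli_pmf \<gamma>). emeasure (if b then M else N) (space (if b then M else N)) \<le> ennreal 1" by simp
  qed
  then show ?thesis using g by (simp add: integral_measure_pmf[of UNIV] UNIV_bool)
qed

lemma nn_integral_mixture:
  assumes M: "M \<in> borel_probs" and N: "N \<in> borel_probs" and g: "0 \<le> \<gamma>" "\<gamma> \<le> 1"
    and f: "f \<in> borel_measurable borel"
  shows "(\<integral>\<^sup>+x. f x \<partial>mixture \<gamma> M N) = ennreal \<gamma> * (\<integral>\<^sup>+x. f x \<partial>M) + ennreal (1 - \<gamma>) * (\<integral>\<^sup>+x. f x \<partial>N)"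
proof -
  have k: "(\<lambda>b. if b then M else N) \<in> measure_pmf (bernoulli_pmf \<gamma>) \<rightarrow>\<^sub>M prob_algebra borel"
    using M N by (auto simp: borel_probs_eq)
  have "(\<integral>\<^sup>+x. f x \<partial>mixture \<gamma> M N) = (\<integral>\<^sup>+b. (\<integral>\<^sup>+x. f x \<partial>(if b then M else N)) \<partial>measure_pmf (bernoulli_pmf \<gamma>))"
    unfolding mixture_eq_bind(1)[OF M N g] by (rule nn_integral_bind[OF f measurable_prob_algebraD[OF k]])
  then show ?thesis
    using g by (simp add: nn_integral_measure_pmf nn_integral_count_space_finite UNIV_bool mult.commute add.commute)
qed

lemma crd_mixture:
  assumes "M \<in> borel_probs" "N \<in> borel_probs" "0 \<le> \<gamma>" "\<gamma> \<le> 1"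
  shows "crd (mixture \<gamma> M N) = (\<lambda>j. \<gamma> * crd M j + (1 - \<gamma>) * crd N j)"
  unfolding crd_def by (rule ext) (rule integral_mixture[OF assms tf_borel tf_bounds(3)])

lemma geo_Fubini:
  fixes f :: "nat \<Rightarrow> 'b \<Rightarrow> real"
  assumes N: "prob_space N" and f: "\<And>j. f j \<in> borel_measurable N" "\<And>j z. \<bar>f j z\<bar> \<le> B"
  shows "(\<integral>z. (\<integral>j. f j z \<partial>geo) \<partial>N) = (\<integral>j. (\<integral>z. f j z \<partial>N) \<partial>geo)"
    and "(\<lambda>z. \<integral>j. f j z \<partial>geo) \<in> borel_measurable N"
proof -
  interpret N: prob_space N by fact
  interpret G: prob_space geo by (rule prob_space_geo)
  interpret pair_prob_space geo N ..
  have "case_prod f \<in> borel_measurable (count_space UNIV \<Otimes>\<^sub>M N)"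
    by (rule measurable_pair_measure_countable1) (use f in auto)
  moreover have "sets (count_space UNIV \<Otimes>\<^sub>M N) = sets (geo \<Otimes>\<^sub>M N)"
    by (rule sets_pair_measure_cong) simp_all
  ultimately have m: "case_prod f \<in> borel_measurable (geo \<Otimes>\<^sub>M N)" by (simp cong: measurable_cong_sets)
  have i: "integrable (geo \<Otimes>\<^sub>M N) (case_prod f)"
    by (rule P.integrable_const_bound[of _ B]) (use f m in auto)
  show "(\<integral>z. (\<integral>j. f j z \<partial>geo) \<partial>N) = (\<integral>j. (\<integral>z. f j z \<partial>N) \<partial>geo)"
    by (rule Fubini_integral[OF i])
  have "(\<lambda>(z, j). f j z) \<in> borel_measurable (N \<Otimes>\<^sub>M geo)" 
    using measurable_pair_swap[OF m] by (simp add: case_prod_beta)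
  then show "(\<lambda>z. \<integral>j. f j z \<partial>geo) \<in> borel_measurable N"
    by (rule G.borel_measurable_lebesgue_integral)
qed

section \<open>Disintegration\<close>

lemma ip_diff_right:
  assumes "\<And>j. \<bar>u j\<bar> \<le> A" "\<And>j. \<bar>v j\<bar> \<le> B" "\<And>j. \<bar>w j\<bar> \<le> C"
  shows "ip u (\<lambda>j. v j - w j) = ip u v - ip u w"
  unfolding ip_def right_diff_distrib
  by (rule Bochner_Integration.integral_diff[OF integrable_ip[OF assms(1,2)] integrable_ip[OF assms(1,3)]])

lemma ip_abs_le_1:
  assumes "\<And>j. \<bar>u j\<bar> \<le> 1" "\<And>j. \<bar>v j\<bar> \<le> 1"
  shows "\<bar>ip u v\<bar> \<le> 1"
proof -
  interpret prob_space geo by (rule prob_space_geo)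
  have "\<bar>ip u v\<bar> \<le> (\<integral>j. \<bar>u j * v j\<bar> \<partial>geo)" unfolding ip_def by (rule integral_abs_bound)
  also have "\<dots> \<le> (\<integral>j. 1 \<partial>geo)"
  proof (rule integral_mono)
    show "integrable geo (\<lambda>j. \<bar>u j * v j\<bar>)" using integrable_ip[OF assms] by (rule integrable_abs)
    show "\<bar>u j * v j\<bar> \<le> 1" for j
      unfolding abs_mult using mult_mono[OF assms(1)[of j] assms(2)[of j]] by simp
  qed simp
  finally show ?thesis using prob_space by simp
qed

lemma return_borel_probs: "return borel a \<in> borel_probs"
  by (intro borel_probsI prob_space_return) simp_all

lemma crd_return: "crd (return borel a) = (\<lambda>j. tf j a)"
  unfolding crd_def by (rule ext) (rule integral_return, simp_all)

text \<open>Taking coordinates turns mixtures into convex combinations and preserves compactness.\<close>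

lemma cube_body_crd:
  assumes "wcompact C" "C \<noteq> {}"
    and "\<And>M N \<gamma>. M \<in> C \<Longrightarrow> N \<in> C \<Longrightarrow> 0 < \<gamma> \<Longrightarrow> \<gamma> < 1 \<Longrightarrow> mixture \<gamma> M N \<in> C"
  shows "cube_body (crd ` C)"
proof
  have Cp: "C \<subseteq> borel_probs" using assms(1) by (simp add: wcompact_def)
  show "compact (crd ` C)" by (rule compact_crd_image[OF assms(1)])
  show "crd ` C \<subseteq> cube" using Cp crd_cube by blast
  show "crd ` C \<noteq> {}" using assms(2) by simp
  show "cvx (crd ` C)" unfolding cvx_def
  proof (intro ballI allI impI)
    fix a b and \<gamma> :: real assume "a \<in> crd ` C" "b \<in> crd ` C" and g: "0 < \<gamma>" "\<gamma> < 1"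
    then obtain M N where MN: "M \<in> C" "a = crd M" "N \<in> C" "b = crd N" by blast
    then have "crd (mixture \<gamma> M N) = (\<lambda>j. \<gamma> * a j + (1 - \<gamma>) * b j)"
      using crd_mixture[of M N \<gamma>] g Cp by auto
    then show "(\<lambda>j. \<gamma> * a j + (1 - \<gamma>) * b j) \<in> crd ` C"
      using assms(3)[OF MN(1,3) g] by (metis image_eqI)
  qed
qed

definition decode :: "(nat \<Rightarrow> real) \<Rightarrow> 'b::{metric_space, second_countable_topology} measure" where
  "decode = inv_into borel_probs crd"

lemma decode:
  assumes "z \<in> crd ` (borel_probs :: 'b::{metric_space, second_countable_topology} measure set)"
  shows "(decode z :: 'b measure) \<in> borel_probs" "crd (decode z :: 'b measure) = z"
  unfolding decode_def by (rule inv_into_into[OF assms], rule f_inv_into_f[OF assms])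

text \<open>Restricted to the coordinates of measures, \<open>decode\<close> is weakly continuous by compactness. So the preimage of a
  weakly open set under \<open>decode\<close> is relatively open, and its preimage under \<open>c\<close> is Borel.\<close>

lemma kernel_decode:
  fixes c :: "'b::topological_space \<Rightarrow> nat \<Rightarrow> real"
  assumes K: "wcompact (borel_probs :: 'c::{metric_space, second_countable_topology} measure set)"
    and c: "c \<in> borel_measurable borel" "\<And>x. c x \<in> crd ` (borel_probs :: 'c measure set)"
  shows "kernel (\<lambda>x. decode (c x) :: 'c measure)"
  unfolding kernel_def borel_of_def
proof (rule measurable_measure_of)
  show "{U. openin weak_topology U} \<subseteq> Pow (topspace (weak_topology :: 'c measure topology))"
    by (auto dest: openin_subset)
  show "(\<lambda>x. decode (c x)) \<in> space borel \<rightarrow> topspace (weak_topology :: 'c measure topology)"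
    using decode(1)[OF c(2)] by (simp add: topspace_weak)
  fix U :: "'c measure set" assume "U \<in> {U. openin weak_topology U}"
  then have U: "openin weak_topology U" by simp
  define W where "W = {z \<in> crd ` (borel_probs :: 'c measure set). decode z \<notin> U}"
  have cl: "closed (crd ` (borel_probs :: 'c measure set))" by (rule compact_imp_closed[OF compact_crd_image[OF K]])
  have "closed W"
    unfolding closed_sequential_limits
  proof (intro allI impI, elim conjE)
    fix x l assume xW: "\<forall>n. x n \<in> W" and xl: "x \<longlonglongrightarrow> l"
    then have xI: "\<And>n. x n \<in> crd ` (borel_probs :: 'c measure set)" by (simp add: W_def)
    then have l: "l \<in> crd ` (borel_probs :: 'c measure set)" using cl xl unfolding closed_sequential_limits by blast
    have "wconv (\<lambda>n. decode (x n)) (decode l :: 'c measure)"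
      by (rule wcompact_crd_conv[OF K decode(1)[OF xI] decode(1)[OF l]]) (simp add: decode(2)[OF xI] decode(2)[OF l] xl)
    then have lim: "limitin weak_topology (\<lambda>n. decode (x n)) (decode l :: 'c measure) sequentially" by (rule wconv_imp_limitin)
    have "decode l \<notin> U"
    proof
      assume "decode l \<in> U"
      then have "\<forall>\<^sub>F n in sequentially. decode (x n) \<in> U" using lim U unfolding limitin_def by blast
      then have "\<forall>\<^sub>F n in sequentially. False" using xW by (auto simp: W_def elim: eventually_mono)
      then show False by simp
    qed
    then show "l \<in> W" using l by (simp add: W_def)
  qed
  then have "c -` W \<inter> space borel \<in> sets borel" by (intro measurable_sets[OF c(1)]) simp
  moreover have "(\<lambda>x. decode (c x)) -` U \<inter> space borel = space borel - (c -` W \<inter> space borel)"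
    using c(2) by (auto simp: W_def)
  ultimately show "(\<lambda>x. decode (c x)) -` U \<inter> space borel \<in> sets borel" by (metis sets.compl_sets)
qed

text \<open>The conditional expectation given the first coordinate, as a function of that coordinate: the
  Radon-Nikodym density of the image under \<open>fst\<close> of the measure with density \<open>h\<close>. This image is at most \<open>marg \<psi>\<close>,
  so that the density is almost everywhere at most \<open>1\<close> and can be truncated.\<close>

lemma cond_exp_fst:
  fixes \<psi> :: "('b::second_countable_topology \<times> 'c::second_countable_topology) measure" and h :: "'b \<times> 'c \<Rightarrow> real"
  assumes \<psi>: "\<psi> \<in> borel_probs" and h: "h \<in> borel_measurable borel" "\<And>z. 0 \<le> h z" "\<And>z. h z \<le> 1"
  shows "\<exists>l :: 'b \<Rightarrow> real. l \<in> borel_measurable borel \<and> (\<forall>x. 0 \<le> l x \<and> l x \<le> 1) \<and>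
    (\<forall>\<phi> :: 'b \<Rightarrow> real. \<phi> \<in> borel_measurable borel \<longrightarrow> (\<integral>z. \<phi> (fst z) * h z \<partial>\<psi>) = (\<integral>x. \<phi> x * l x \<partial>marg \<psi>))"
proof -
  note \<psi>s = borel_probsD(2)[OF \<psi>]
  note [measurable] = h(1)
  have fst_m: "fst \<in> \<psi> \<rightarrow>\<^sub>M borel" and marg: "marg \<psi> \<in> borel_probs" by (rule marg_borel_probs[OF \<psi>])+
  have hm: "h \<in> borel_measurable \<psi>" using h(1) by (simp only: measurable_cong_sets[OF \<psi>s refl])
  interpret \<xi>: prob_space "marg \<psi>" using borel_probsD(1)[OF marg] .
  note \<xi>s [measurable_cong] = borel_probsD(2)[OF marg]
  define D where "D = density \<psi> (\<lambda>z. ennreal (h z))"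
  define N where "N = distr D borel (fst :: 'b \<times> 'c \<Rightarrow> 'b)"
  have Ds: "sets D = sets \<psi>" by (simp add: D_def)
  have fD: "fst \<in> D \<rightarrow>\<^sub>M borel" using fst_m by (simp only: measurable_cong_sets[OF Ds refl])
  have Nle: "emeasure N B \<le> emeasure (marg \<psi>) B" if B: "B \<in> sets borel" for B
  proof -
    have Bs: "fst -` B \<inter> space \<psi> \<in> sets \<psi>" by (rule measurable_sets[OF fst_m B])
    have "emeasure N B = emeasure D (fst -` B \<inter> space D)" unfolding N_def by (rule emeasure_distr[OF fD B])
    also have "\<dots> = (\<integral>\<^sup>+z. ennreal (h z) * indicator (fst -` B \<inter> space \<psi>) z \<partial>\<psi>)"
      unfolding D_def using Bs hm by (simp add: emeasure_density)
    also have "\<dots> \<le> (\<integral>\<^sup>+z. indicator (fst -` B \<inter> space \<psi>) z \<partial>\<psi>)"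
      using h(2,3) by (intro nn_integral_mono) (simp add: indicator_def)
    also have "\<dots> = emeasure \<psi> (fst -` B \<inter> space \<psi>)" using Bs by simp
    also have "\<dots> = emeasure (marg \<psi>) B" unfolding marg_def by (rule emeasure_distr[OF fst_m B, symmetric])
    finally show ?thesis .
  qed
  have Ns: "sets N = sets (marg \<psi>)" using \<xi>s by (simp add: N_def)
  have ac: "absolutely_continuous (marg \<psi>) N"
    unfolding absolutely_continuous_def
  proof
    fix B assume "B \<in> null_sets (marg \<psi>)"
    then have B: "B \<in> sets borel" "emeasure (marg \<psi>) B = 0" using \<xi>s by (auto simp: null_sets_def)
    then show "B \<in> null_sets N" using Nle[OF B(1)] Ns \<xi>s by (simp add: null_sets_def)
  qed
  obtain f where f: "f \<in> borel_measurable (marg \<psi>)" "density (marg \<psi>) f = N"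
    using \<xi>.Radon_Nikodym[OF ac Ns] by blast
  \<comment> \<open>the mass of \<open>f - 1\<close> on the set where \<open>f > 1\<close> vanishes\<close>
  have f1: "AE x in marg \<psi>. f x \<le> 1"
  proof -
    define B where "B = {x \<in> space (marg \<psi>). 1 < f x}"
    have Bs: "B \<in> sets (marg \<psi>)" unfolding B_def using f(1) by measurable
    then have Bb: "B \<in> sets borel" using \<xi>s by simp
    have m: "(\<lambda>x. (f x - 1) * indicator B x) \<in> borel_measurable (marg \<psi>)" using f(1) Bs by measurable
    have "emeasure (marg \<psi>) B + (\<integral>\<^sup>+x. (f x - 1) * indicator B x \<partial>marg \<psi>) =
        (\<integral>\<^sup>+x. indicator B x + (f x - 1) * indicator B x \<partial>marg \<psi>)"
      using Bs m by (subst nn_integral_add) auto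
    also have "\<dots> = (\<integral>\<^sup>+x. f x * indicator B x \<partial>marg \<psi>)"
      by (intro nn_integral_cong) (auto simp: B_def indicator_def add_diff_inverse_ennreal less_imp_le)
    also have "\<dots> = emeasure N B" using f Bs by (simp add: emeasure_density flip: f(2))
    also have "\<dots> \<le> emeasure (marg \<psi>) B + 0" using Nle[OF Bb] by simp
    finally have "(\<integral>\<^sup>+x. (f x - 1) * indicator B x \<partial>marg \<psi>) \<le> 0"
      by (simp only: ennreal_add_left_cancel_le) (simp add: \<xi>.emeasure_eq_measure)
    then have "(\<integral>\<^sup>+x. (f x - 1) * indicator B x \<partial>marg \<psi>) = 0" by simp
    then have "AE x in marg \<psi>. (f x - 1) * indicator B x = 0" using m by (simp add: nn_integral_0_iff_AE)
    then show ?thesis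
    proof (rule AE_mp, intro AE_I2 impI)
      fix x assume x: "x \<in> space (marg \<psi>)" "(f x - 1) * indicator B x = 0"
      show "f x \<le> 1"
      proof (rule ccontr)
        assume "\<not> f x \<le> 1"
        then have "1 < f x" by simp
        with x have "f x - 1 = 0" by (simp add: B_def)
        with \<open>1 < f x\<close> show False by (metis diff_eq_0_iff_ennreal leD)
      qed
    qed
  qed
  define l where "l x = enn2real (min 1 (f x))" for x
  have fb: "f \<in> borel_measurable borel" using f(1) by (simp only: measurable_cong_sets[OF \<xi>s refl])
  have lm: "l \<in> borel_measurable borel" unfolding l_def using fb by measurable
  have lm': "l \<in> borel_measurable (marg \<psi>)" using lm by (simp only: measurable_cong_sets[OF \<xi>s refl])
  have l01: "0 \<le> l x" "l x \<le> 1" for x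
    using enn2real_mono[of "min 1 (f x)" 1] by (simp_all add: l_def)
  have lN: "density (marg \<psi>) (\<lambda>x. ennreal (l x)) = N"
    unfolding f(2)[symmetric]
  proof (rule density_cong)
    show "AE x in marg \<psi>. ennreal (l x) = f x"
      using f1 by (rule AE_mp, intro AE_I2 impI) (simp add: l_def min_absorb2 order_le_less_trans)
  qed (use lm' f(1) in auto)
  have "(\<integral>z. \<phi> (fst z) * h z \<partial>\<psi>) = (\<integral>x. \<phi> x * l x \<partial>marg \<psi>)" if \<phi>: "\<phi> \<in> borel_measurable borel" for \<phi> :: "'b \<Rightarrow> real"
  proof -
    have \<phi>m: "\<phi> \<in> borel_measurable (marg \<psi>)" using \<phi> by (simp only: measurable_cong_sets[OF \<xi>s refl])
    have "(\<integral>x. \<phi> x * l x \<partial>marg \<psi>) = (\<integral>x. \<phi> x \<partial>N)"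
      unfolding lN[symmetric] using \<phi>m lm' l01 by (subst integral_density) (auto simp: mult.commute)
    also have "\<dots> = (\<integral>z. \<phi> (fst z) \<partial>D)" unfolding N_def by (rule integral_distr[OF fD \<phi>])
    also have "\<dots> = (\<integral>z. \<phi> (fst z) * h z \<partial>\<psi>)"
      unfolding D_def using measurable_compose[OF fst_m \<phi>] hm h(2) by (subst integral_density) (auto simp: mult.commute)
    finally show ?thesis by simp
  qed
  with lm l01 show ?thesis by (intro exI[of _ l]) blast
qed

text \<open>For fixed \<open>B\<close>, the measure \<open>\<theta> (B \<times> C)\<close> of a rectangle is a finite measure in \<open>C\<close>; this one is determined by
  its coordinates.\<close>

lemma section_measure:
  fixes \<theta> :: "('b::second_countable_topology \<times> 'c::{metric_space, second_countable_topology}) measure"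
  assumes \<theta>: "\<theta> \<in> borel_probs" and B: "B \<in> sets borel"
  defines "M \<equiv> distr (density \<theta> (\<lambda>z. ennreal (indicator B (fst z)))) borel (snd :: 'b \<times> 'c \<Rightarrow> 'c)"
  shows "finite_measure M" "sets M = sets borel"
    and "crd M j = (\<integral>z. indicator B (fst z) * tf j (snd z) \<partial>\<theta>)"
    and "C \<in> sets borel \<Longrightarrow> emeasure M C = emeasure \<theta> (B \<times> C)"
proof -
  note \<theta>s = borel_probsD(2)[OF \<theta>]
  define D where "D = density \<theta> (\<lambda>z. ennreal (indicator B (fst z)))"
  have fs: "fst \<in> \<theta> \<rightarrow>\<^sub>M borel" "snd \<in> \<theta> \<rightarrow>\<^sub>M borel" by (rule marg_borel_probs[OF \<theta>])+
  have Bm: "(\<lambda>z. indicat_real B (fst z)) \<in> borel_measurable \<theta>"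
    by (rule measurable_compose[OF fs(1)]) (use B in simp)
  have sD: "snd \<in> D \<rightarrow>\<^sub>M borel" using fs(2) by (simp add: D_def)
  have M: "M = distr D borel snd" by (simp add: M_def D_def)
  show s: "sets M = sets borel" by (simp add: M)
  show e: "emeasure M C = emeasure \<theta> (B \<times> C)" if C: "C \<in> sets borel" for C
  proof -
    have Cs: "snd -` C \<inter> space \<theta> \<in> sets \<theta>" by (rule measurable_sets[OF fs(2) C])
    have BC: "B \<times> C \<in> sets \<theta>" using Times_borel[OF B C] \<theta>s by simp
    have "emeasure M C = emeasure D (snd -` C \<inter> space D)" unfolding M by (rule emeasure_distr[OF sD C])
    also have "\<dots> = (\<integral>\<^sup>+z. ennreal (indicator B (fst z)) * indicator (snd -` C \<inter> space \<theta>) z \<partial>\<theta>)"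
      unfolding D_def using Cs Bm by (simp add: emeasure_density)
    also have "\<dots> = (\<integral>\<^sup>+z. indicator (B \<times> C) z \<partial>\<theta>)"
      using borel_probsD(3)[OF \<theta>] by (intro nn_integral_cong) (auto simp: indicator_def)
    finally show ?thesis using BC by simp
  qed
  show "finite_measure M"
  proof
    interpret prob_space \<theta> using borel_probsD(1)[OF \<theta>] .
    have "space M = UNIV" using sets_eq_imp_space_eq[OF s] by simp
    then show "emeasure M (space M) \<noteq> \<infinity>" using e[of UNIV] by (simp add: emeasure_eq_measure)
  qed
  show "crd M j = (\<integral>z. indicator B (fst z) * tf j (snd z) \<partial>\<theta>)"
  proof -
    have "crd M j = (\<integral>z. tf j (snd z) \<partial>D)" unfolding M crd_def by (rule integral_distr[OF sD tf_borel])
    also have "\<dots> = (\<integral>z. indicator B (fst z) * tf j (snd z) \<partial>\<theta>)"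
      unfolding D_def using measurable_compose[OF fs(2) tf_borel[of j]] Bm by (subst integral_density) auto
    finally show ?thesis .
  qed
qed

text \<open>Let \<open>L x\<close> be the sequence of conditional expectations of the test functions given \<open>x\<close>. If \<open>L x\<close> are the coordinates
  of a probability measure, this measure is the value of the kernel sought. To see that this holds almost surely, let \<open>c x\<close> be the point nearest to \<open>L x\<close> in the convex compact set of all coordinates of
  probability measures. The variational inequality of \<open>c x\<close> at the coordinates of the point mass at \<open>a\<close>, integrated over
  \<open>(x, a)\<close> with respect to \<open>\<psi>\<close>, states that the mean squared distance of \<open>L x\<close> from \<open>c x\<close> is at most \<open>0\<close>.\<close>

theorem disintegration_exists:
  fixes \<psi> :: "('b::polish_space \<times> 'c::polish_space) measure"
  assumes A: "compact (UNIV :: 'c set)" and \<psi>: "\<psi> \<in> borel_probs"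
  shows "\<exists>p. disintegrates \<psi> p"
proof -
  define I where "I = crd ` (borel_probs :: 'c measure set)"
  have K: "wcompact (borel_probs :: 'c measure set)" by (rule wcompact_borel_probs[OF A])
  interpret I: cube_body I unfolding I_def
  proof (rule cube_body_crd[OF K])
    show "(borel_probs :: 'c measure set) \<noteq> {}" using return_borel_probs by blast
    show "mixture \<gamma> M N \<in> borel_probs" if "M \<in> borel_probs" "N \<in> borel_probs" "0 < \<gamma>" "\<gamma> < 1" for \<gamma> and M N :: "'c measure"
      by (rule mixture_eq_bind(2)) (use that in simp_all)
  qed
  have marg: "marg \<psi> \<in> borel_probs" and fst_m: "fst \<in> \<psi> \<rightarrow>\<^sub>M borel" and snd_m: "snd \<in> \<psi> \<rightarrow>\<^sub>M borel"
    by (rule marg_borel_probs[OF \<psi>])+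
  interpret \<xi>: prob_space "marg \<psi>" using borel_probsD(1)[OF marg] .
  note \<xi>s = borel_probsD(2)[OF marg]
  have sndb: "(snd :: 'b \<times> 'c \<Rightarrow> 'c) \<in> borel_measurable borel"
    by (intro borel_measurable_continuous_onI continuous_intros)
  have tfs: "(\<lambda>z :: 'b \<times> 'c. tf j (snd z)) \<in> borel_measurable borel" for j
    by (rule measurable_compose[OF sndb tf_borel])
  define Q where "Q j l \<longleftrightarrow> l \<in> borel_measurable borel \<and> (\<forall>x. 0 \<le> l x \<and> l x \<le> 1) \<and>
    (\<forall>\<phi> :: 'b \<Rightarrow> real. \<phi> \<in> borel_measurable borel \<longrightarrow> (\<integral>z. \<phi> (fst z) * tf j (snd z) \<partial>\<psi>) = (\<integral>x. \<phi> x * l x \<partial>marg \<psi>))"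
    for j and l :: "'b \<Rightarrow> real"
  have "\<exists>l. Q j l" for j
    unfolding Q_def by (intro cond_exp_fst[OF \<psi> tfs] tf_bounds)
  then obtain L :: "nat \<Rightarrow> 'b \<Rightarrow> real" where "\<And>j. Q j (L j)" by metis
  then have L: "\<And>j. L j \<in> borel_measurable borel" "\<And>j x. 0 \<le> L j x" "\<And>j x. L j x \<le> 1"
    "\<And>j \<phi>. \<phi> \<in> borel_measurable borel \<Longrightarrow> (\<integral>z. \<phi> (fst z) * tf j (snd z) \<partial>\<psi>) = (\<integral>x. \<phi> x * L j x \<partial>marg \<psi>)"
    unfolding Q_def by blast+
  have Lc: "(\<lambda>j. L j x) \<in> cube" for x using L(2,3) by (simp add: cube_def)
  define c where "c x = prj I (\<lambda>j. L j x)" for x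
  have cI: "c x \<in> I" for x unfolding c_def by (rule I.prj_in[OF Lc])
  have cc: "c x \<in> cube" for x using cI I.C(2) by blast
  have cm: "c \<in> borel_measurable borel"
  proof -
    have "(\<lambda>z. if z \<in> cube then prj I z else (\<lambda>_. 0)) \<in> borel_measurable borel"
      by (rule borel_measurable_continuous_on_if[OF _ I.continuous_on_prj continuous_on_const])
        (simp add: compact_imp_closed[OF compact_cube])
    moreover have "(\<lambda>x j. L j x) \<in> borel_measurable borel"
      by (rule measurable_coordinatewise_then_product) (rule L(1))
    ultimately have "(\<lambda>x. if (\<lambda>j. L j x) \<in> cube then prj I (\<lambda>j. L j x) else (\<lambda>_. 0)) \<in> borel_measurable borel"
      by (rule measurable_compose[rotated])
    then show ?thesis using Lc by (simp add: c_def[abs_def])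
  qed
  have cjm: "(\<lambda>x. c x j) \<in> borel_measurable borel" for j by (rule measurable_product_then_coordinatewise[OF cm])
  define u where "u x j = L j x - c x j" for x j
  have ub: "\<bar>u x j\<bar> \<le> 1" for x j unfolding u_def using cube_diff_bound[OF Lc cc] by simp
  have um: "(\<lambda>x. u x j) \<in> borel_measurable borel" for j unfolding u_def using L(1) cjm by measurable
  define w where "w j = (\<integral>x. (u x j)\<^sup>2 \<partial>marg \<psi>)" for j
  have u2m: "(\<lambda>x. (u x j)\<^sup>2) \<in> borel_measurable borel" and u2b: "\<bar>(u x j)\<^sup>2\<bar> \<le> 1" for j x
    using um[of j] ub[of x j] by (measurable, simp add: abs_square_le_1)
  have u2i: "integrable (marg \<psi>) (\<lambda>x. (u x j)\<^sup>2)" for j by (rule integrable_borel_probs[OF marg u2m u2b])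
  have w01: "0 \<le> w j" "\<bar>w j\<bar> \<le> 1" for j
    unfolding w_def by (rule Bochner_Integration.integral_nonneg, simp) (rule integral_bounded_borel_probs[OF marg u2m u2b])
  have prod_le: "\<bar>a * b\<bar> \<le> 1" if "\<bar>a\<bar> \<le> 1" "\<bar>b\<bar> \<le> 1" for a b :: real
    using mult_mono[OF that] by (simp add: abs_mult)
  \<comment> \<open>the defining property of the conditional expectation replaces \<open>tf j (snd z)\<close> by \<open>L j (fst z)\<close>\<close>
  have fz: "(\<integral>z. u (fst z) j * (tf j (snd z) - c (fst z) j) \<partial>\<psi>) = w j" for j
  proof -
    have m: "(\<lambda>z. u (fst z) j * tf j (snd z)) \<in> borel_measurable \<psi>" "(\<lambda>z. u (fst z) j * c (fst z) j) \<in> borel_measurable \<psi>"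
      using measurable_compose[OF fst_m um[of j]] measurable_compose[OF snd_m tf_borel[of j]] measurable_compose[OF fst_m cjm[of j]] by auto
    interpret \<psi>: prob_space \<psi> using borel_probsD(1)[OF \<psi>] .
    have i: "integrable \<psi> (\<lambda>z. u (fst z) j * tf j (snd z))" "integrable \<psi> (\<lambda>z. u (fst z) j * c (fst z) j)"
    proof -
      have ae: "AE z in \<psi>. norm (u (fst z) j * tf j (snd z)) \<le> 1" "AE z in \<psi>. norm (u (fst z) j * c (fst z) j) \<le> 1"
        unfolding real_norm_def by (intro AE_I2 prod_le[OF ub tf_bounds(3)] prod_le[OF ub cubeD(3)[OF cc]])+
      show "integrable \<psi> (\<lambda>z. u (fst z) j * tf j (snd z))" "integrable \<psi> (\<lambda>z. u (fst z) j * c (fst z) j)"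
        by (rule \<psi>.integrable_const_bound[OF ae(1) m(1)], rule \<psi>.integrable_const_bound[OF ae(2) m(2)])
    qed
    have i': "integrable (marg \<psi>) (\<lambda>x. u x j * L j x)" "integrable (marg \<psi>) (\<lambda>x. u x j * c x j)"
    proof -
      show "integrable (marg \<psi>) (\<lambda>x. u x j * L j x)"
        by (rule integrable_borel_probs[OF marg _ prod_le[OF ub cubeD(3)[OF Lc]]]) (use um[of j] L(1)[of j] in simp)
      show "integrable (marg \<psi>) (\<lambda>x. u x j * c x j)"
        by (rule integrable_borel_probs[OF marg _ prod_le[OF ub cubeD(3)[OF cc]]]) (use um[of j] cjm[of j] in simp)
    qed
    have "(\<integral>z. u (fst z) j * (tf j (snd z) - c (fst z) j) \<partial>\<psi>) =
      (\<integral>z. u (fst z) j * tf j (snd z) \<partial>\<psi>) - (\<integral>z. u (fst z) j * c (fst z) j \<partial>\<psi>)"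
      unfolding right_diff_distrib by (rule Bochner_Integration.integral_diff[OF i])
    also have "(\<integral>z. u (fst z) j * tf j (snd z) \<partial>\<psi>) = (\<integral>x. u x j * L j x \<partial>marg \<psi>)" by (rule L(4)[OF um])
    also have "(\<integral>z. u (fst z) j * c (fst z) j \<partial>\<psi>) = (\<integral>x. u x j * c x j \<partial>marg \<psi>)"
      unfolding marg_def by (rule integral_distr[OF fst_m, symmetric]) (use um[of j] cjm[of j] in simp)
    also have "(\<integral>x. u x j * L j x \<partial>marg \<psi>) - (\<integral>x. u x j * c x j \<partial>marg \<psi>) = w j"
      unfolding w_def Bochner_Integration.integral_diff[OF i', symmetric]
      by (simp add: u_def power2_eq_square algebra_simps)
    finally show ?thesis .
  qed
  have "(\<integral>j. w j \<partial>geo) \<le> 0"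
  proof -
    have "(\<integral>j. w j \<partial>geo) = (\<integral>z. (\<integral>j. u (fst z) j * (tf j (snd z) - c (fst z) j) \<partial>geo) \<partial>\<psi>)"
    proof (subst geo_Fubini(1)[OF borel_probsD(1)[OF \<psi>]])
      show "(\<lambda>z. u (fst z) j * (tf j (snd z) - c (fst z) j)) \<in> borel_measurable \<psi>" for j
        using measurable_compose[OF fst_m um[of j]] measurable_compose[OF snd_m tf_borel[of j]] measurable_compose[OF fst_m cjm[of j]] by auto
      show "\<bar>u (fst z) j * (tf j (snd z) - c (fst z) j)\<bar> \<le> 1" for j and z :: "'b \<times> 'c"
      proof (rule prod_le[OF ub])
        show "\<bar>tf j (snd z) - c (fst z) j\<bar> \<le> 1"
          using tf_bounds(1,2)[of j "snd z"] cubeD(1,2)[OF cc, of "fst z" j] by linarith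
      qed
    qed (simp add: fz)
    also have "\<dots> = - (\<integral>z. - (\<integral>j. u (fst z) j * (tf j (snd z) - c (fst z) j) \<partial>geo) \<partial>\<psi>)" by simp
    also have "\<dots> \<le> 0"
    proof -
      have "(\<integral>j. u x j * (tf j a - c x j) \<partial>geo) \<le> 0" for x and a :: 'c
      proof -
        have "(\<lambda>j. tf j a) \<in> I" unfolding I_def crd_return[symmetric] by (rule imageI[OF return_borel_probs])
        from I.prj_char[OF Lc this] show ?thesis by (simp add: ip_def u_def c_def)
      qed
      then have "0 \<le> (\<integral>z. - (\<integral>j. u (fst z) j * (tf j (snd z) - c (fst z) j) \<partial>geo) \<partial>\<psi>)"
        by (intro Bochner_Integration.integral_nonneg) simp
      then show ?thesis by simp
    qed
    finally show ?thesis .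
  qed
  then have "ip (\<lambda>j. sqrt (w j)) (\<lambda>j. sqrt (w j)) \<le> 0" using w01(1) by (simp add: ip_def)
  then have "sqrt (w j) = 0" for j
  proof (rule ip_self_le_0[rotated])
    show "\<bar>sqrt (w j)\<bar> \<le> 1" for j using w01[of j] by simp
  qed
  then have w0: "w j = 0" for j by simp
  have "AE x in marg \<psi>. u x j = 0" for j
    using integral_nonneg_eq_0_iff_AE[OF u2i[of j]] w0[of j] by (simp add: w_def)
  then have "AE x in marg \<psi>. \<forall>j. u x j = 0" by (simp add: AE_all_countable)
  then have Lc_eq: "AE x in marg \<psi>. \<forall>j. L j x = c x j" by (simp add: u_def)
  \<comment> \<open>the projected coordinates are coordinates of a measure for every \<open>x\<close>\<close>
  define p where "p x = (decode (c x) :: 'c measure)" for x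
  have kp: "kernel p" unfolding p_def by (rule kernel_decode[OF K cm]) (use cI in \<open>simp add: I_def\<close>)
  have pm: "p \<in> borel \<rightarrow>\<^sub>M prob_algebra borel" by (rule kernel_imp_measurable[OF kp])
  have crdp: "crd (p x) = c x" for x unfolding p_def by (rule decode(2)) (use cI in \<open>simp add: I_def\<close>)
  define J where "J = joint (marg \<psi>) p"
  have J: "J \<in> borel_probs" unfolding J_def by (rule joint_borel_probs[OF marg pm])
  have "disintegrates \<psi> p" unfolding disintegrates_def
  proof (intro conjI kp ballI)
    fix B :: "'b set" and C :: "'c set" assume B: "B \<in> sets borel" and C: "C \<in> sets borel"
    define M1 where "M1 = distr (density \<psi> (\<lambda>z. ennreal (indicator B (fst z)))) borel (snd :: 'b \<times> 'c \<Rightarrow> 'c)"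
    define M2 where "M2 = distr (density J (\<lambda>z. ennreal (indicator B (fst z)))) borel (snd :: 'b \<times> 'c \<Rightarrow> 'c)"
    note S1 = section_measure[OF \<psi> B, folded M1_def] and S2 = section_measure[OF J B, folded M2_def]
    have "M1 = M2"
    proof (rule crd_inj_finite[OF S1(1,2) S2(1,2)])
      fix j
      have bm: "indicat_real B \<in> borel_measurable borel" using B by simp
      have "crd M2 j = (\<integral>x. (\<integral>a. indicator B x * tf j a \<partial>p x) \<partial>marg \<psi>)"
        unfolding S2(3) J_def
      proof (subst integral_joint[OF marg pm, of _ 1])
        have "(fst :: 'b \<times> 'c \<Rightarrow> 'b) \<in> borel_measurable borel"
          by (intro borel_measurable_continuous_onI continuous_intros)
        from measurable_compose[OF this bm]
        show "(\<lambda>z :: 'b \<times> 'c. indicator B (fst z) * tf j (snd z)) \<in> borel_measurable borel" using tfs[of j] by simp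
        show "\<bar>indicator B (fst z) * tf j (snd z)\<bar> \<le> 1" for z :: "'b \<times> 'c"
          using tf_bounds(3)[of j "snd z"] by (simp add: indicator_def)
      qed simp
      also have "\<dots> = (\<integral>x. indicator B x * c x j \<partial>marg \<psi>)"
        by (simp add: crdp[symmetric] crd_def)
      also have "\<dots> = (\<integral>x. indicator B x * L j x \<partial>marg \<psi>)"
      proof (rule integral_cong_AE)
        have "indicat_real B \<in> borel_measurable (marg \<psi>)" "L j \<in> borel_measurable (marg \<psi>)" "(\<lambda>x. c x j) \<in> borel_measurable (marg \<psi>)"
          using bm L(1)[of j] cjm[of j] by (simp_all only: measurable_cong_sets[OF \<xi>s refl])
        then show "(\<lambda>x. indicat_real B x * c x j) \<in> borel_measurable (marg \<psi>)" "(\<lambda>x. indicat_real B x * L j x) \<in> borel_measurable (marg \<psi>)"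
          by simp_all
        show "AE x in marg \<psi>. indicat_real B x * c x j = indicat_real B x * L j x"
          using Lc_eq by (rule AE_mp, intro AE_I2 impI) simp
      qed
      also have "\<dots> = crd M1 j" unfolding S1(3) by (rule L(4)[OF bm, symmetric])
      finally show "crd M1 j = crd M2 j" by simp
    qed
    then have "emeasure \<psi> (B \<times> C) = emeasure J (B \<times> C)" using S1(4)[OF C] S2(4)[OF C] by simp
    then show "emeasure \<psi> (B \<times> C) = (\<integral>\<^sup>+x\<in>B. emeasure (p x) C \<partial>marg \<psi>)"
      unfolding J_def emeasure_joint_Times[OF marg pm B C] .
  qed
  then show ?thesis by blast
qed

section \<open>Weak limits of kernels with values in convex sets\<close>

text \<open>The continuous function whose integral is the linear functional \<open>ip u\<close> of the coordinates.\<close>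

definition tcomb :: "(nat \<Rightarrow> real) \<Rightarrow> 'c::{metric_space, second_countable_topology} \<Rightarrow> real" where
  "tcomb u a = ip u (\<lambda>j. tf j a)"

lemma tcomb_bound: "(\<And>j. \<bar>u j\<bar> \<le> 1) \<Longrightarrow> \<bar>tcomb u a\<bar> \<le> 1"
  unfolding tcomb_def by (rule ip_abs_le_1) (auto simp: tf_bounds)

lemma continuous_tcomb:
  assumes "\<And>j. \<bar>u j\<bar> \<le> 1"
  shows "continuous_on UNIV (tcomb u :: 'c::{metric_space, second_countable_topology} \<Rightarrow> real)"
  unfolding continuous_on_sequentially
proof (intro allI ballI impI)
  fix x :: "nat \<Rightarrow> 'c" and a assume "(\<forall>n. x n \<in> UNIV) \<and> x \<longlonglongrightarrow> a"
  then have x: "x \<longlonglongrightarrow> a" by simp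
  have "(\<lambda>n. tf j (x n)) \<longlonglongrightarrow> tf j a" for j
    using continuous_tf[of j] x by (auto simp: continuous_on_eq_continuous_at intro: isCont_tendsto_compose)
  then show "(tcomb u \<circ> x) \<longlonglongrightarrow> tcomb u a"
    unfolding tcomb_def comp_def by (intro ip_tendsto[of _ 1 _ 1] assms tf_bounds(3) tendsto_const)
qed

lemma integral_tcomb:
  fixes M :: "'c::{metric_space, second_countable_topology} measure"
  assumes M: "M \<in> borel_probs" and u: "\<And>j. \<bar>u j\<bar> \<le> 1"
  shows "(\<integral>a. tcomb u a \<partial>M) = ip u (crd M)"
proof -
  have "(\<integral>a. (\<integral>j. u j * tf j a \<partial>geo) \<partial>M) = (\<integral>j. (\<integral>a. u j * tf j a \<partial>M) \<partial>geo)"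
  proof (rule geo_Fubini(1)[OF borel_probsD(1)[OF M], where B=1])
    show "(\<lambda>a. u j * tf j a) \<in> borel_measurable M" for j
      unfolding measurable_cong_sets[OF borel_probsD(2)[OF M] refl] by measurable
    show "\<bar>u j * tf j z\<bar> \<le> 1" for j z
      unfolding abs_mult using mult_mono[OF u[of j] tf_bounds(3)[of j z]] by simp
  qed
  then show ?thesis by (simp add: tcomb_def ip_def crd_def)
qed

lemma continuous_on_ip:
  assumes "\<And>j. \<bar>u j\<bar> \<le> 1"
  shows "continuous_on cube (ip u)"
  unfolding continuous_on_sequentially
proof (intro allI ballI impI)
  fix x a assume "(\<forall>n. x n \<in> cube) \<and> x \<longlonglongrightarrow> a"
  then have x: "\<And>n. x n \<in> cube" "\<And>j. (\<lambda>n. x n j) \<longlonglongrightarrow> a j" by (simp_all add: tendsto_fun_iff)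
  show "(ip u \<circ> x) \<longlonglongrightarrow> ip u a"
    unfolding comp_def by (rule ip_tendsto[of "\<lambda>_. u" 1 x 1]) (use assms cubeD(3)[OF x(1)] x(2) in simp_all)
qed

text \<open>A compact subset of an open set has positive distance from the complement of that set.\<close>

lemma compact_neighborhood:
  fixes K :: "'b::metric_space set"
  assumes "compact K" "open U" "K \<subseteq> U"
  obtains m0 where "\<And>m x. m \<ge> m0 \<Longrightarrow> 0 < bump K m x \<Longrightarrow> x \<in> U"
proof -
  obtain e where e: "0 < e" "\<And>x. x \<in> K \<Longrightarrow> ball x e \<subseteq> U"
    by (rule Heine_Borel_lemma[OF assms(1), of "{U}"]) (use assms in auto)
  obtain m0 where m0: "real m0 > 1 / e" using reals_Archimedean2 by blast
  show ?thesis
  proof (rule that)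
    fix m x assume m: "m \<ge> m0" and b: "0 < bump K m x"
    have ne: "K \<noteq> {}" using b by (auto simp: bump_def)
    have "real m * infdist x K < 1" using b ne by (simp add: bump_def split: if_splits)
    moreover have "real m * e > 1"
    proof -
      have "real m > 1 / e" using m m0 by linarith
      then show ?thesis using e(1) by (simp add: field_simps)
    qed
    ultimately have "real m * infdist x K < real m * e" by linarith
    then have "infdist x K < e" by (simp add: mult_less_cancel_left)
    then have "(INF a\<in>K. dist x a) < e" using ne by (simp add: infdist_def)
    moreover have "bdd_below ((\<lambda>a. dist x a) ` K)" by (rule bdd_belowI[of _ 0]) auto
    ultimately obtain a where "a \<in> K" "dist x a < e" using ne by (auto simp: cINF_less_iff)
    then show "x \<in> U" using e(2)[of a] by (auto simp: dist_commute)
  qed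
qed

text \<open>Otherwise the reverse strict inequality holds on a compact subset \<open>K\<close> of \<open>U\<close> of positive measure, by inner regularity.
  For a continuous function supported in \<open>U\<close> and close to the indicator of \<open>K\<close>, the product of it with \<open>tcomb u - q\<close>
  has a nonpositive integral under all late joint laws, hence under the limit, where in the limit to the indicator of \<open>K\<close>
  it would have to be positive.\<close>

lemma limit_kernel_le:
  fixes l :: "nat \<Rightarrow> 'b::polish_space \<Rightarrow> 'c::polish_space measure"
  assumes w: "wconv (\<lambda>n. joint (\<xi> n) (l n)) (joint \<mu> p)"
    and \<xi>: "\<And>n. \<xi> n \<in> borel_probs" and l: "\<And>n. l n \<in> borel \<rightarrow>\<^sub>M prob_algebra borel"
    and \<mu>: "\<mu> \<in> borel_probs" and p: "p \<in> borel \<rightarrow>\<^sub>M prob_algebra borel"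
    and u: "\<And>j. \<bar>u j\<bar> \<le> 1" and U: "open U" "\<And>n x. n \<ge> N \<Longrightarrow> x \<in> U \<Longrightarrow> ip u (crd (l n x)) \<le> q"
  shows "AE x in \<mu>. x \<in> U \<longrightarrow> ip u (crd (p x)) \<le> q"
proof -
  interpret \<mu>: prob_space \<mu> using borel_probsD(1)[OF \<mu>] .
  note \<mu>s = borel_probsD(2)[OF \<mu>]
  have px: "p x \<in> borel_probs" for x by (rule borel_probs_measurable_prob_algebra[OF p])
  have lx: "l n x \<in> borel_probs" for n x by (rule borel_probs_measurable_prob_algebra[OF l])
  have fum: "(tcomb u :: 'c \<Rightarrow> real) \<in> borel_measurable borel" by (rule borel_measurable_continuous_onI[OF continuous_tcomb[OF u]])
  have fub: "\<bar>tcomb u a\<bar> \<le> 1" for a :: 'c by (rule tcomb_bound) (rule u)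
  define h where "h x = ip u (crd (p x)) - q" for x
  have hm: "h \<in> borel_measurable borel"
    unfolding h_def integral_tcomb[OF px u, symmetric] using integral_kernel_measurable[OF p fum] by measurable
  have ipb: "\<bar>ip u (crd M)\<bar> \<le> 1" if "M \<in> borel_probs" for M :: "'c measure"
    by (rule ip_abs_le_1[OF u cubeD(3)[OF crd_cube[OF that]]])
  have hb: "\<bar>h x\<bar> \<le> 1 + \<bar>q\<bar>" for x using ipb[OF px, of x] unfolding h_def by linarith
  define S where "S = {x \<in> U. 0 < h x}"
  have Sm: "S \<in> sets borel"
  proof -
    have "{x \<in> space borel. 0 < h x} \<in> sets borel" using hm by measurable
    then have "U \<inter> {x. 0 < h x} \<in> sets borel" using U(1) by auto
    then show ?thesis by (simp add: S_def Int_def)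
  qed
  have "emeasure \<mu> S = 0"
  proof (rule ccontr)
    assume "emeasure \<mu> S \<noteq> 0"
    then have "0 < emeasure \<mu> S" by (simp add: zero_less_iff_neq_zero)
    also have "emeasure \<mu> S = (SUP K \<in> {K. K \<subseteq> S \<and> compact K}. emeasure \<mu> K)"
      by (rule inner_regular[OF \<mu>s _ Sm]) simp
    finally obtain K where K: "K \<subseteq> S" "compact K" "0 < emeasure \<mu> K" by (auto simp: less_SUP_iff)
    obtain m0 where m0: "\<And>m x. m \<ge> m0 \<Longrightarrow> 0 < bump K m x \<Longrightarrow> x \<in> U"
      by (rule compact_neighborhood[OF K(2) U(1)]) (use K(1) in \<open>auto simp: S_def\<close>)
    have Kc: "closed K" by (rule compact_imp_closed[OF K(2)])
    have Kb: "K \<in> sets \<mu>" using Kc \<mu>s by simp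
    have hm\<mu>: "h \<in> borel_measurable \<mu>" using hm by (simp only: measurable_cong_sets[OF \<mu>s refl])
    have bm\<mu>: "bump K m \<in> borel_measurable \<mu>" for m using bump_borel[of K m] by (simp only: measurable_cong_sets[OF \<mu>s refl])
    have bhb: "\<bar>bump K m x * h x\<bar> \<le> 1 + \<bar>q\<bar>" for m x
      unfolding abs_mult using mult_mono[OF bump_bounds(3)[of K m x] hb[of x]] by simp
    have le: "(\<integral>x. bump K m x * h x \<partial>\<mu>) \<le> 0" if m: "m \<ge> m0" for m
    proof -
      define g where "g z = bump K m (fst z) * (tcomb u (snd z) - q)" for z :: "'b \<times> 'c"
      have gc: "continuous_on UNIV g" unfolding g_def
        by (intro continuous_intros continuous_on_compose2[OF continuous_bump] continuous_on_compose2[OF continuous_tcomb[OF u]]) auto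
      have gb: "\<bar>g z\<bar> \<le> 1 * (1 + \<bar>q\<bar>)" for z
        unfolding g_def abs_mult
      proof (rule mult_mono[OF bump_bounds(3)])
        show "\<bar>tcomb u (snd z) - q\<bar> \<le> 1 + \<bar>q\<bar>" using fub[of "snd z"] by linarith
      qed simp_all
      have gm: "g \<in> borel_measurable borel" by (rule borel_measurable_continuous_onI[OF gc])
      have inner: "(\<integral>a. g (x, a) \<partial>M) = bump K m x * (ip u (crd M) - q)" if M: "M \<in> borel_probs" for x and M :: "'c measure"
      proof -
        interpret M: prob_space M using borel_probsD(1)[OF M] .
        have "integrable M (tcomb u)" by (rule integrable_borel_probs[OF M fum fub])
        then show ?thesis by (simp add: g_def integral_tcomb[OF M u] M.prob_space)
      qed
      have "(\<lambda>n. \<integral>z. g z \<partial>joint (\<xi> n) (l n)) \<longlonglongrightarrow> (\<integral>z. g z \<partial>joint \<mu> p)"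
      proof -
        have "g \<in> Cb euclidean" unfolding Cb_euclidean_iff by (intro conjI gc exI[of _ "1 * (1 + \<bar>q\<bar>)"] allI gb)
        then show ?thesis using w by (simp add: wconv_def)
      qed
      moreover have "(\<integral>z. g z \<partial>joint (\<xi> n) (l n)) \<le> 0" if n: "n \<ge> N" for n
      proof -
        have "(\<integral>z. g z \<partial>joint (\<xi> n) (l n)) = (\<integral>x. bump K m x * (ip u (crd (l n x)) - q) \<partial>\<xi> n)"
          unfolding integral_joint[OF \<xi> l gm gb] inner[OF lx] ..
        also have "\<dots> = - (\<integral>x. bump K m x * (q - ip u (crd (l n x))) \<partial>\<xi> n)"
          unfolding Bochner_Integration.integral_minus[symmetric] by (simp add: algebra_simps)
        also have "\<dots> \<le> 0"
        proof -
          have "0 \<le> bump K m x * (q - ip u (crd (l n x)))" for x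
          proof (cases "0 < bump K m x")
            case True
            then have "x \<in> U" by (rule m0[OF m])
            from U(2)[OF n this] True show ?thesis by simp
          next
            case False
            then have "bump K m x = 0" using bump_bounds(1)[of K m x] by linarith
            then show ?thesis by simp
          qed
          then show ?thesis by (simp add: Bochner_Integration.integral_nonneg)
        qed
        finally show ?thesis .
      qed
      ultimately have "(\<integral>z. g z \<partial>joint \<mu> p) \<le> 0" by (intro LIMSEQ_le_const2[of _ "\<integral>z. g z \<partial>joint \<mu> p"]) auto
      then show ?thesis unfolding integral_joint[OF \<mu> p gm gb] inner[OF px] by (simp add: h_def)
    qed
    have "(\<lambda>m. \<integral>x. bump K m x * h x \<partial>\<mu>) \<longlonglongrightarrow> (\<integral>x. indicator K x * h x \<partial>\<mu>)"
    proof (rule integral_dominated_convergence[where w="\<lambda>x. 1 + \<bar>q\<bar>"])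
      show "(\<lambda>x. indicator K x * h x) \<in> borel_measurable \<mu>" using Kb hm\<mu> by simp
      show "(\<lambda>x. bump K m x * h x) \<in> borel_measurable \<mu>" for m using bm\<mu>[of m] hm\<mu> by simp
      show "AE x in \<mu>. (\<lambda>m. bump K m x * h x) \<longlonglongrightarrow> indicator K x * h x"
        by (intro AE_I2 tendsto_mult tendsto_const bump_tendsto Kc)
      show "AE x in \<mu>. norm (bump K m x * h x) \<le> 1 + \<bar>q\<bar>" for m
        by (intro AE_I2) (simp add: bhb)
    qed simp
    then have le0: "(\<integral>x. indicator K x * h x \<partial>\<mu>) \<le> 0"
      by (rule LIMSEQ_le_const2) (use le in blast)
    have pos: "0 \<le> indicator K x * h x" for x using K(1) by (auto simp: indicator_def S_def)
    have ib: "integrable \<mu> (\<lambda>x. indicator K x * h x)"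
    proof (rule \<mu>.integrable_const_bound[of _ "1 + \<bar>q\<bar>"])
      show "AE x in \<mu>. norm (indicator K x * h x) \<le> 1 + \<bar>q\<bar>"
        using hb by (intro AE_I2) (simp add: indicator_def)
      show "(\<lambda>x. indicator K x * h x) \<in> borel_measurable \<mu>" using Kb hm\<mu> by simp
    qed
    have "(\<integral>x. indicator K x * h x \<partial>\<mu>) = 0"
      using le0 Bochner_Integration.integral_nonneg[of \<mu> "\<lambda>x. indicator K x * h x"] pos by (simp add: antisym)
    then have "AE x in \<mu>. indicator K x * h x = 0" using integral_nonneg_eq_0_iff_AE[OF ib] pos by simp
    then have "AE x in \<mu>. x \<notin> K"
      by (rule AE_mp, intro AE_I2 impI) (use K(1) in \<open>auto simp: S_def indicator_def\<close>)
    then have "emeasure \<mu> K = 0" using AE_iff_measurable[OF Kb, of "\<lambda>x. x \<notin> K"] sets.sets_into_space[OF Kb] by auto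
    then show False using K(3) by simp
  qed
  then have "AE x in \<mu>. x \<notin> S" using Sm \<mu>s by (intro AE_not_in) (simp add: null_sets_def)
  then show ?thesis by (rule AE_mp, intro AE_I2 impI) (auto simp: S_def h_def not_less)
qed

text \<open>A value \<open>p x\<close> outside of \<open>\<Lambda> x\<close> is separated from this set by the functional \<open>ip u\<close>, where \<open>u\<close> points from the
  nearest point of \<open>\<Lambda> x\<close> to \<open>p x\<close>. By compactness and \<open>lim\<close>, the inequality that separates holds for the values \<open>l n y\<close> for
  all late \<open>n\<close> and all \<open>y\<close> near \<open>x\<close>. So \<open>(crd (p x), x)\<close> is in one of the open sets of a
  family indexed by \<open>u\<close>, a level \<open>q\<close> and a time \<open>N\<close>. Countably many of them have the same union by Lindelof's
  theorem, and each is avoided almost surely by \<open>limit_kernel_le\<close>.\<close>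

theorem limit_kernel_in_convex:
  fixes l :: "nat \<Rightarrow> 'b::polish_space \<Rightarrow> 'c::polish_space measure"
  assumes A: "compact (UNIV :: 'c set)"
    and w: "wconv (\<lambda>n. joint (\<xi> n) (l n)) (joint \<mu> p)"
    and \<xi>: "\<And>n. \<xi> n \<in> borel_probs" and l: "\<And>n. l n \<in> borel \<rightarrow>\<^sub>M prob_algebra borel"
    and \<mu>: "\<mu> \<in> borel_probs" and p: "p \<in> borel \<rightarrow>\<^sub>M prob_algebra borel"
    and \<Lambda>: "\<And>x. wcompact (\<Lambda> x)"
      "\<And>x M N \<gamma>. M \<in> \<Lambda> x \<Longrightarrow> N \<in> \<Lambda> x \<Longrightarrow> 0 < \<gamma> \<Longrightarrow> \<gamma> < 1 \<Longrightarrow> mixture \<gamma> M N \<in> \<Lambda> x"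
    and lim: "\<And>r xs x M. filterlim r at_top sequentially \<Longrightarrow> xs \<longlonglongrightarrow> x \<Longrightarrow> wconv (\<lambda>k. l (r k) (xs k)) M \<Longrightarrow> M \<in> \<Lambda> x"
  shows "AE x in \<mu>. p x \<in> \<Lambda> x"
proof -
  have K: "wcompact (borel_probs :: 'c measure set)" by (rule wcompact_borel_probs[OF A])
  have px: "p x \<in> borel_probs" for x by (rule borel_probs_measurable_prob_algebra[OF p])
  have lx: "l n x \<in> borel_probs" for n x by (rule borel_probs_measurable_prob_algebra[OF l])
  have \<Lambda>p: "\<Lambda> x \<subseteq> borel_probs" for x using \<Lambda>(1)[of x] by (simp add: wcompact_def)
  have subseq: "\<exists>s M. strict_mono (s :: nat \<Rightarrow> nat) \<and> wconv (\<lambda>k. L (s k)) M" if "\<And>n. L n \<in> borel_probs" for L :: "nat \<Rightarrow> 'c measure"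
    using K that unfolding wcompact_def by (elim conjE allE[of _ L] impE) auto
  have ne: "\<Lambda> x \<noteq> {}" for x
  proof -
    obtain s M where s: "strict_mono (s :: nat \<Rightarrow> nat)" "wconv (\<lambda>k. l (s k) x) M" using subseq[of "\<lambda>n. l n x"] lx by blast
    then have "M \<in> \<Lambda> x" by (intro lim[of s "\<lambda>_. x"]) (auto simp: filterlim_subseq)
    then show ?thesis by blast
  qed
  have body: "cube_body (crd ` \<Lambda> x)" for x by (rule cube_body_crd[OF \<Lambda>(1) ne \<Lambda>(2)])
  define D :: "(nat \<Rightarrow> real) set" where "D = {u. \<forall>j. \<bar>u j\<bar> \<le> 1}"
  define U where "U u q N = interior {x. \<forall>n\<ge>N. ip u (crd (l n x)) \<le> q}" for u q and N :: nat
  have bad: "\<exists>u\<in>D. \<exists>q N. x \<in> U u q N \<and> q < ip u (crd (p x))" if x: "p x \<notin> \<Lambda> x" for x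
  proof -
    interpret I: cube_body "crd ` \<Lambda> x" by (rule body)
    define z where "z = crd (p x)"
    have zc: "z \<in> cube" unfolding z_def by (rule crd_cube[OF px])
    have zI: "z \<notin> crd ` \<Lambda> x"
    proof
      assume "z \<in> crd ` \<Lambda> x"
      then obtain M where "M \<in> \<Lambda> x" "crd (p x) = crd M" by (auto simp: z_def)
      then show False using x crd_inj[OF px, of M x] \<Lambda>p[of x] by auto
    qed
    define c where "c = prj (crd ` \<Lambda> x) z"
    have cI: "c \<in> crd ` \<Lambda> x" unfolding c_def by (rule I.prj_in[OF zc])
    then have cc: "c \<in> cube" using I.C(2) by blast
    define u where "u = (\<lambda>j. z j - c j)"
    have ub: "\<bar>u j\<bar> \<le> 1" for j unfolding u_def by (rule cube_diff_bound[OF zc cc])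
    have pos: "ip u u > 0"
    proof (rule ccontr)
      assume "\<not> ip u u > 0"
      then have "ip u u \<le> 0" by simp
      then have "u j = 0" for j by (rule ip_self_le_0[rotated]) (rule ub)
      then have "z = c" by (auto simp: u_def)
      then show False using cI zI by simp
    qed
    have uz: "ip u z = ip u c + ip u u"
      using ip_diff_right[OF ub cubeD(3)[OF zc] cubeD(3)[OF cc]] by (simp add: u_def)
    have uI: "ip u c' \<le> ip u c" if "c' \<in> crd ` \<Lambda> x" for c'
    proof -
      have "c' \<in> cube" using that I.C(2) by blast
      then have "ip u (\<lambda>j. c' j - c j) = ip u c' - ip u c" by (intro ip_diff_right[OF ub cubeD(3) cubeD(3)[OF cc]])
      then show ?thesis using I.prj_char[OF zc that] by (simp add: u_def c_def)
    qed
    \<comment> \<open>halfway between the maximum of \<open>ip u\<close> on the convex set and its value at \<open>z\<close>\<close>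
    define q where "q = ip u c + ip u u / 2"
    have "\<exists>N. x \<in> U u q N"
    proof (rule ccontr)
      assume "\<nexists>N. x \<in> U u q N"
      then have nU: "x \<notin> U u q N" for N by blast
      have "\<exists>y n. dist x y < inverse (real (Suc N)) \<and> n \<ge> N \<and> q < ip u (crd (l n y))" for N
      proof (rule ccontr)
        assume no: "\<nexists>y n. dist x y < inverse (real (Suc N)) \<and> n \<ge> N \<and> q < ip u (crd (l n y))"
        have "ball x (inverse (real (Suc N))) \<subseteq> {x. \<forall>n\<ge>N. ip u (crd (l n x)) \<le> q}"
        proof
          fix y assume "y \<in> ball x (inverse (real (Suc N)))"
          then have "dist x y < inverse (real (Suc N))" by simp
          then show "y \<in> {x. \<forall>n\<ge>N. ip u (crd (l n x)) \<le> q}" using no by (auto simp: not_less[symmetric])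
        qed
        then have "x \<in> U u q N"
          unfolding U_def mem_interior by (intro exI[of _ "inverse (real (Suc N))"]) simp
        then show False using nU by blast
      qed
      then obtain y n where yn: "\<And>N. dist x (y N) < inverse (real (Suc N))" "\<And>N. n N \<ge> N" "\<And>N. q < ip u (crd (l (n N) (y N)))"
        by metis
      have yx: "y \<longlonglongrightarrow> x"
        by (rule tendsto_dist_iff[THEN iffD2], rule tendsto_sandwich[OF _ _ tendsto_const LIMSEQ_inverse_real_of_nat])
          (use yn(1) in \<open>auto intro!: always_eventually less_imp_le simp: dist_commute\<close>)
      have nt: "filterlim n at_top sequentially"
        by (rule filterlim_at_top_mono[OF filterlim_ident]) (use yn(2) in auto)
      obtain s M where s: "strict_mono (s :: nat \<Rightarrow> nat)" "wconv (\<lambda>k. l (n (s k)) (y (s k))) M"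
        using subseq[of "\<lambda>k. l (n k) (y k)"] lx by blast
      have "M \<in> \<Lambda> x"
      proof (rule lim[OF _ _ s(2)])
        show "filterlim (\<lambda>k. n (s k)) at_top sequentially" by (rule filterlim_compose[OF nt filterlim_subseq[OF s(1)]])
        show "(\<lambda>k. y (s k)) \<longlonglongrightarrow> x" using LIMSEQ_subseq_LIMSEQ[OF yx s(1)] by (simp add: comp_def)
      qed
      then have "ip u (crd M) \<le> ip u c" by (intro uI) simp
      moreover have "q \<le> ip u (crd M)"
      proof (rule LIMSEQ_le_const)
        have "(\<lambda>k. crd (l (n (s k)) (y (s k)))) \<longlonglongrightarrow> crd M" by (rule wconv_crd[OF s(2)])
        then show "(\<lambda>k. ip u (crd (l (n (s k)) (y (s k))))) \<longlonglongrightarrow> ip u (crd M)"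
          by (intro ip_tendsto[of "\<lambda>_. u" 1 _ 1]) (simp_all add: ub cubeD(3)[OF crd_cube[OF lx]] tendsto_fun_iff)
        show "\<exists>N. \<forall>k\<ge>N. q \<le> ip u (crd (l (n (s k)) (y (s k))))" using yn(3) by (meson less_imp_le)
      qed
      ultimately show False using pos by (simp add: q_def)
    qed
    then obtain N where "x \<in> U u q N" by blast
    moreover have "q < ip u (crd (p x))" using uz pos by (simp add: q_def flip: z_def)
    moreover have "u \<in> D" using ub by (simp add: D_def)
    ultimately show ?thesis by blast
  qed
  define F where "F = {({z \<in> cube. q < ip u z} \<times> U u q N) | u q N. u \<in> D}"
  have "openin (top_of_set (cube \<times> UNIV)) S" if "S \<in> F" for S
  proof -
    obtain u q N where S: "S = {z \<in> cube. q < ip u z} \<times> U u q N" "u \<in> D" using \<open>S \<in> F\<close> by (auto simp: F_def)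
    have "openin (top_of_set cube) (cube \<inter> ip u -` {q<..})"
      by (rule continuous_openin_preimage_gen[OF continuous_on_ip]) (use S(2) in \<open>auto simp: D_def\<close>)
    moreover have "cube \<inter> ip u -` {q<..} = {z \<in> cube. q < ip u z}" by auto
    moreover have "openin (top_of_set UNIV) (U u q N)" by (simp add: U_def)
    ultimately show ?thesis unfolding S(1) using openin_Times by metis
  qed
  from Lindelof_openin[OF this] obtain F' where F': "F' \<subseteq> F" "countable F'" "\<Union>F' = \<Union>F" by metis
  have null: "AE x in \<mu>. (crd (p x), x) \<notin> S" if "S \<in> F'" for S
  proof -
    obtain u q N where S: "S = {z \<in> cube. q < ip u z} \<times> U u q N" "u \<in> D" using \<open>S \<in> F'\<close> F'(1) by (auto simp: F_def)
    have "AE x in \<mu>. x \<in> U u q N \<longrightarrow> ip u (crd (p x)) \<le> q"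
    proof (rule limit_kernel_le[OF w \<xi> l \<mu> p])
      show "\<bar>u j\<bar> \<le> 1" for j using S(2) by (simp add: D_def)
      show "open (U u q N)" by (simp add: U_def)
      fix n x assume n: "n \<ge> N" and "x \<in> U u q N"
      then have "x \<in> {x. \<forall>n\<ge>N. ip u (crd (l n x)) \<le> q}" unfolding U_def using interior_subset by blast
      then show "ip u (crd (l n x)) \<le> q" using n by simp
    qed
    then show ?thesis by (rule AE_mp, intro AE_I2 impI) (auto simp: S(1))
  qed
  have "AE x in \<mu>. \<forall>S\<in>F'. (crd (p x), x) \<notin> S" using null by (simp add: AE_ball_countable[OF F'(2)])
  then show ?thesis
  proof (rule AE_mp, intro AE_I2 impI)
    fix x assume "\<forall>S\<in>F'. (crd (p x), x) \<notin> S"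
    then have nF: "(crd (p x), x) \<notin> \<Union>F" unfolding F'(3)[symmetric] by blast
    show "p x \<in> \<Lambda> x"
    proof (rule ccontr)
      assume "p x \<notin> \<Lambda> x"
      from bad[OF this] obtain u q N where uqN: "u \<in> D" "x \<in> U u q N" "q < ip u (crd (p x))" by blast
      then have "(crd (p x), x) \<in> {z \<in> cube. q < ip u z} \<times> U u q N" using crd_cube[OF px] by simp
      then show False using nF uqN(1) unfolding F_def by blast
    qed
  qed
qed

section \<open>Minimisers, and fixed points of sequences of measures\<close>

lemma kernel_of_wconv:
  fixes k :: "'b::metric_space \<Rightarrow> 'c::metric_space measure"
  assumes "\<And>x. k x \<in> borel_probs" "\<And>xs x. xs \<longlonglongrightarrow> x \<Longrightarrow> wconv (\<lambda>n. k (xs n)) (k x)"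
  shows "k \<in> borel \<rightarrow>\<^sub>M prob_algebra borel"
proof (rule measurable_prob_algebra_Cb[OF assms(1)])
  fix f :: "'c \<Rightarrow> real" assume f: "f \<in> Cb euclidean"
  have "continuous_on UNIV (\<lambda>x. \<integral>y. f y \<partial>k x)"
    unfolding continuous_on_sequentially
  proof (intro allI ballI impI)
    fix xs :: "nat \<Rightarrow> 'b" and x assume "(\<forall>n. xs n \<in> UNIV) \<and> xs \<longlonglongrightarrow> x"
    then show "((\<lambda>x. \<integral>y. f y \<partial>k x) \<circ> xs) \<longlonglongrightarrow> (\<integral>y. f y \<partial>k x)"
      using assms(2)[of xs x] f by (simp add: wconv_def comp_def)
  qed
  then show "(\<lambda>x. \<integral>y. f y \<partial>k x) \<in> borel_measurable borel" by (rule borel_measurable_continuous_onI)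
qed

lemma wcompact_subseq:
  assumes "wcompact C" "\<And>n. M n \<in> C"
  obtains r N where "strict_mono (r :: nat \<Rightarrow> nat)" "N \<in> C" "wconv (\<lambda>k. M (r k)) N"
  using assms unfolding wcompact_def by (elim conjE allE[of _ M] impE) auto

text \<open>Under \<open>Pair (xs n)\<close>, the integral of \<open>f\<close> becomes that of \<open>f (xs n, a)\<close> over \<open>a\<close>, which converges continuously.\<close>

lemma wconv_Pair:
  fixes l :: "'c::{metric_space, second_countable_topology} measure" and x :: "'b::{metric_space, second_countable_topology}"
  assumes xs: "xs \<longlonglongrightarrow> x" and w: "wconv ls l"
  shows "wconv (\<lambda>n. distr (ls n) borel (Pair (xs n))) (distr l borel (Pair x))"
  unfolding wconv_def
proof (intro conjI allI ballI)
  have ls: "ls n \<in> borel_probs" and l: "l \<in> borel_probs" for n using w by (auto simp: wconv_def)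
  note pm = measurable_Pair_borel[OF ls] measurable_Pair_borel[OF l]
  show "distr (ls n) borel (Pair (xs n)) \<in> borel_probs" "distr l borel (Pair x) \<in> borel_probs" for n
    by (rule borel_probsI[OF prob_space.prob_space_distr[OF borel_probsD(1)[OF ls] pm(1)]], simp)
      (rule borel_probsI[OF prob_space.prob_space_distr[OF borel_probsD(1)[OF l] pm(2)]], simp)
  fix f :: "'b \<times> 'c \<Rightarrow> real" assume f: "f \<in> Cb euclidean"
  then obtain B where B: "\<And>z. \<bar>f z\<bar> \<le> B" and fc: "continuous_on UNIV f" unfolding Cb_euclidean_iff by blast
  have fm: "f \<in> borel_measurable borel" by (rule Cb_borel[OF f])
  have fx: "continuous_on UNIV (\<lambda>a. f (y, a))" for y
    by (intro continuous_on_compose2[OF fc] continuous_intros) auto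
  have "(\<lambda>n. \<integral>a. f (xs n, a) \<partial>ls n) \<longlonglongrightarrow> (\<integral>a. f (x, a) \<partial>l)"
  proof (rule wconv_integral[OF w fx])
    show "(\<lambda>a. f (xs n, a)) \<in> borel_measurable borel" for n by (rule borel_measurable_continuous_onI[OF fx])
    show "\<bar>f (xs n, a)\<bar> \<le> B" for n a by (rule B)
    fix r :: "nat \<Rightarrow> nat" and ys :: "nat \<Rightarrow> 'c" and y assume r: "filterlim r at_top sequentially" and ys: "ys \<longlonglongrightarrow> y"
    have "(\<lambda>k. (xs (r k), ys k)) \<longlonglongrightarrow> (x, y)" by (intro tendsto_Pair filterlim_compose[OF xs r] ys)
    then show "(\<lambda>k. f (xs (r k), ys k)) \<longlonglongrightarrow> f (x, y)"
      using fc by (auto simp: continuous_on_eq_continuous_at intro: isCont_tendsto_compose)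
  qed
  then show "(\<lambda>n. \<integral>z. f z \<partial>distr (ls n) borel (Pair (xs n))) \<longlonglongrightarrow> (\<integral>z. f z \<partial>distr l borel (Pair x))"
    by (simp add: integral_distr[OF pm(1) fm] integral_distr[OF pm(2) fm])
qed

lemma wconv_joint:
  fixes l :: "'b::{metric_space, second_countable_topology} \<Rightarrow> 'c::{metric_space, second_countable_topology} measure"
  assumes w: "wconv M N" and k: "\<And>n. k n \<in> borel \<rightarrow>\<^sub>M prob_algebra borel" and l: "l \<in> borel \<rightarrow>\<^sub>M prob_algebra borel"
    and cont: "\<And>ys y. ys \<longlonglongrightarrow> y \<Longrightarrow> wconv (\<lambda>j. l (ys j)) (l y)"
    and conv: "\<And>r ys y. filterlim r at_top sequentially \<Longrightarrow> ys \<longlonglongrightarrow> y \<Longrightarrow> wconv (\<lambda>j. k (r j) (ys j)) (l y)"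
  shows "wconv (\<lambda>n. joint (M n) (k n)) (joint N l)"
  unfolding joint_def
proof (rule wconv_bind[OF w measurable_Pair_kernel[OF k] measurable_Pair_kernel[OF l]])
  show "wconv (\<lambda>j. distr (l (ys j)) borel (Pair (ys j))) (distr (l y) borel (Pair y))" if "ys \<longlonglongrightarrow> y" for ys y
    by (rule wconv_Pair[OF that cont[OF that]])
  show "wconv (\<lambda>j. distr (k (r j) (ys j)) borel (Pair (ys j))) (distr (l y) borel (Pair y))"
    if "filterlim r at_top sequentially" "ys \<longlonglongrightarrow> y" for r ys y
    by (rule wconv_Pair[OF that(2) conv[OF that]])
qed

lemma wconv_marg:
  fixes M :: "nat \<Rightarrow> ('b::second_countable_topology \<times> 'c::second_countable_topology) measure"
  assumes "wconv M N"
  shows "wconv (\<lambda>n. marg (M n)) (marg N)"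
  unfolding wconv_def
proof (intro conjI allI ballI)
  have M: "M n \<in> borel_probs" and N: "N \<in> borel_probs" for n using assms by (auto simp: wconv_def)
  show "marg (M n) \<in> borel_probs" "marg N \<in> borel_probs" for n by (rule marg_borel_probs(3)[OF M], rule marg_borel_probs(3)[OF N])
  fix f :: "'b \<Rightarrow> real" assume f: "f \<in> Cb euclidean"
  then obtain B where B: "\<And>z. \<bar>f z\<bar> \<le> B" and fc: "continuous_on UNIV f" unfolding Cb_euclidean_iff by blast
  have "continuous_on UNIV (\<lambda>z :: 'b \<times> 'c. f (fst z))"
    by (intro continuous_on_compose2[OF fc] continuous_intros) auto
  then have "(\<lambda>z :: 'b \<times> 'c. f (fst z)) \<in> Cb euclidean"
    unfolding Cb_euclidean_iff by (intro conjI exI[of _ B] allI B)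
  then have "(\<lambda>n. \<integral>z. f (fst z) \<partial>M n) \<longlonglongrightarrow> (\<integral>z. f (fst z) \<partial>N)" using assms by (simp add: wconv_def)
  then show "(\<lambda>n. \<integral>x. f x \<partial>marg (M n)) \<longlonglongrightarrow> (\<integral>x. f x \<partial>marg N)"
    unfolding marg_def integral_distr[OF marg_borel_probs(1)[OF M] Cb_borel[OF f]]
      integral_distr[OF marg_borel_probs(1)[OF N] Cb_borel[OF f]] .
qed

lemma wcompact_attains_min:
  fixes g :: "'c::{metric_space, second_countable_topology} measure \<Rightarrow> real"
  assumes C: "wcompact C" "C \<noteq> {}"
    and g: "\<And>ms m. (\<And>n. ms n \<in> C) \<Longrightarrow> m \<in> C \<Longrightarrow> wconv ms m \<Longrightarrow> (\<lambda>n. g (ms n)) \<longlonglongrightarrow> g m"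
  shows "\<exists>m\<in>C. \<forall>m'\<in>C. g m \<le> g m'"
proof -
  have Cp: "C \<subseteq> borel_probs" using C by (simp add: wcompact_def)
  have inj: "inj_on crd C" using crd_inj Cp by (intro inj_onI) blast
  define f where "f z = g (inv_into C crd z)" for z
  have "continuous_on (crd ` C) f"
    unfolding continuous_on_sequentially
  proof (intro allI ballI impI)
    fix x a assume a: "a \<in> crd ` C" and "(\<forall>n. x n \<in> crd ` C) \<and> x \<longlonglongrightarrow> a"
    then have x: "\<And>n. x n \<in> crd ` C" "x \<longlonglongrightarrow> a" by auto
    have i: "\<And>n. inv_into C crd (x n) \<in> C" "inv_into C crd a \<in> C" by (intro inv_into_into x a)+
    have "wconv (\<lambda>n. inv_into C crd (x n)) (inv_into C crd a)"
    proof (rule wcompact_crd_conv[OF C(1) i(1)])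
      show "inv_into C crd a \<in> borel_probs" using i(2) Cp by blast
      show "(\<lambda>n. crd (inv_into C crd (x n))) \<longlonglongrightarrow> crd (inv_into C crd a)"
        using x by (simp add: f_inv_into_f[OF x(1)] f_inv_into_f[OF a])
    qed
    from g[OF i this] show "(f \<circ> x) \<longlonglongrightarrow> f a" by (simp add: f_def comp_def)
  qed
  from continuous_attains_inf[OF compact_crd_image[OF C(1)] _ this] C(2)
  obtain z where z: "z \<in> crd ` C" "\<And>y. y \<in> crd ` C \<Longrightarrow> f z \<le> f y" by blast
  then obtain m where m: "m \<in> C" "z = crd m" by blast
  have "g m \<le> g m'" if "m' \<in> C" for m'
    using z(2)[OF imageI[OF that]] m by (simp add: f_def inv_into_f_f[OF inj] that)
  with m show ?thesis by blast
qed

text \<open>Functions on probability measures that converge continuously, together with minimisers of them. Subsequential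
  limits of the minimisers minimise the limit function; over a compact space the minimal values converge as well.\<close>

locale gamma_limit =
  fixes g :: "nat \<Rightarrow> 'c::{metric_space, second_countable_topology} measure \<Rightarrow> real" and g0 :: "'c measure \<Rightarrow> real"
    and m :: "nat \<Rightarrow> 'c measure"
  assumes g: "\<And>r ms N. filterlim r at_top sequentially \<Longrightarrow> wconv ms N \<Longrightarrow> (\<lambda>k. g (r k) (ms k)) \<longlonglongrightarrow> g0 N"
    and m: "\<And>n. m n \<in> borel_probs" "\<And>n m'. m' \<in> borel_probs \<Longrightarrow> g n (m n) \<le> g n m'"
begin

lemma limit_minimiser:
  assumes r: "filterlim r at_top sequentially" and w: "wconv (\<lambda>k. m (r k)) N" and m': "m' \<in> borel_probs"
  shows "g0 N \<le> g0 m'"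
  by (rule LIMSEQ_le[OF g[OF r w] g[OF r wconv_const[OF m']]]) (simp add: m(2)[OF m'])

lemma min_values_tendsto:
  assumes K: "wcompact (borel_probs :: 'c measure set)"
    and m0: "m0 \<in> borel_probs" "\<And>m'. m' \<in> borel_probs \<Longrightarrow> g0 m0 \<le> g0 m'"
  shows "(\<lambda>n. g n (m n)) \<longlonglongrightarrow> g0 m0"
proof (rule tendsto_by_subseq)
  fix r :: "nat \<Rightarrow> nat" assume r: "strict_mono r"
  obtain s N where s: "strict_mono (s :: nat \<Rightarrow> nat)" "N \<in> borel_probs" "wconv (\<lambda>k. m (r (s k))) N"
    by (rule wcompact_subseq[OF K, of "\<lambda>k. m (r k)"]) (rule m(1))
  have rs: "filterlim (\<lambda>k. r (s k)) at_top sequentially"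
    by (rule filterlim_compose[OF filterlim_subseq[OF r] filterlim_subseq[OF s(1)]])
  have "g0 N = g0 m0" by (rule antisym[OF limit_minimiser[OF rs s(3) m0(1)] m0(2)[OF s(2)]])
  then show "\<exists>s. strict_mono s \<and> (\<lambda>k. g (r (s k)) (m (r (s k)))) \<longlonglongrightarrow> g0 m0"
    using s(1) g[OF rs s(3)] by auto
qed

end

text \<open>Infinite products of weakly compact sets of measures. Pairing the index of the factor with the index of the test
  function turns a sequence of measures into one point of the Hilbert cube. The product becomes a closed
  subset of the cube, so that it inherits compactness from the cube, and fixed points of maps of the
  product come from fixed points in the cube.\<close>

locale measure_box =
  fixes C :: "nat \<Rightarrow> 'b::{metric_space, second_countable_topology} measure set"
  assumes wc: "\<And>t. wcompact (C t)"
begin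

definition coords :: "(nat \<Rightarrow> 'b measure) \<Rightarrow> nat \<Rightarrow> real" where
  "coords \<Xi> m = crd (\<Xi> (fst (prod_decode m))) (snd (prod_decode m))"

definition slice :: "(nat \<Rightarrow> real) \<Rightarrow> nat \<Rightarrow> nat \<Rightarrow> real" where
  "slice z t j = z (prod_encode (t, j))"

definition uncoords :: "(nat \<Rightarrow> real) \<Rightarrow> nat \<Rightarrow> 'b measure" where
  "uncoords z t = inv_into (C t) crd (slice z t)"

lemma C_probs: "M \<in> C t \<Longrightarrow> M \<in> borel_probs" using wc[of t] by (auto simp: wcompact_def)

lemma slice_coords: "slice (coords \<Xi>) t = crd (\<Xi> t)" by (rule ext) (simp add: slice_def coords_def)

lemma coords_eqI: "(\<And>t. slice z t = slice w t) \<Longrightarrow> z = w"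
proof
  fix m assume "\<And>t. slice z t = slice w t"
  then have "slice z (fst (prod_decode m)) (snd (prod_decode m)) = slice w (fst (prod_decode m)) (snd (prod_decode m))" by simp
  then show "z m = w m" by (simp add: slice_def)
qed

definition box :: "(nat \<Rightarrow> real) set" where
  "box = {z. \<forall>t. slice z t \<in> crd ` C t}"

lemma coords_in_box: "(\<And>t. \<Xi> t \<in> C t) \<Longrightarrow> coords \<Xi> \<in> box"
  by (simp add: box_def slice_coords)

lemma uncoords:
  assumes "z \<in> box"
  shows "uncoords z t \<in> C t" "crd (uncoords z t) = slice z t" "coords (uncoords z) = z"
proof -
  have s: "slice z t \<in> crd ` C t" for t using assms by (simp add: box_def)
  show "uncoords z t \<in> C t" unfolding uncoords_def by (rule inv_into_into[OF s])
  have c: "crd (uncoords z t) = slice z t" for t unfolding uncoords_def by (rule f_inv_into_f[OF s])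
  show "crd (uncoords z t) = slice z t" by (rule c)
  show "coords (uncoords z) = z" by (rule coords_eqI) (simp add: slice_coords c)
qed

lemma slice_tendsto: "x \<longlonglongrightarrow> l \<Longrightarrow> (\<lambda>n. slice (x n) t) \<longlonglongrightarrow> slice l t"
  by (simp add: tendsto_fun_iff slice_def)

lemma box_subset_cube: "box \<subseteq> cube"
proof
  fix z assume z: "z \<in> box"
  have "0 \<le> z m \<and> z m \<le> 1" for m
  proof -
    have "slice z (fst (prod_decode m)) \<in> cube"
      using uncoords(1,2)[OF z, of "fst (prod_decode m)"] crd_cube[OF C_probs] by metis
    from cubeD(1,2)[OF this, of "snd (prod_decode m)"] show ?thesis by (simp add: slice_def)
  qed
  then show "z \<in> cube" by (simp add: cube_def)
qed

lemma compact_box: "compact box"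
proof -
  have "closed box"
    unfolding closed_sequential_limits
  proof (intro allI impI, elim conjE)
    fix x l assume x: "\<forall>n. x n \<in> box" "x \<longlonglongrightarrow> l"
    have "slice l t \<in> crd ` C t" for t
    proof -
      have "closed (crd ` C t)" by (rule compact_imp_closed[OF compact_crd_image[OF wc]])
      moreover have "slice (x n) t \<in> crd ` C t" for n using x(1) by (simp add: box_def)
      ultimately show ?thesis by (rule closed_sequentially[OF _ _ slice_tendsto[OF x(2), of t]])
    qed
    then show "l \<in> box" by (simp add: box_def)
  qed
  then have "compact (cube \<inter> box)" by (rule compact_Int_closed[OF compact_cube])
  then show ?thesis using box_subset_cube by (simp add: inf.absorb2)
qed

lemma wconv_uncoords:
  assumes "\<And>n. x n \<in> box" "l \<in> box" "x \<longlonglongrightarrow> l"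
  shows "wconv (\<lambda>n. uncoords (x n) t) (uncoords l t)"
proof (rule wcompact_crd_conv[OF wc uncoords(1)[OF assms(1)] C_probs[OF uncoords(1)[OF assms(2)]]])
  show "(\<lambda>n. crd (uncoords (x n) t)) \<longlonglongrightarrow> crd (uncoords l t)"
    unfolding uncoords(2)[OF assms(1)] uncoords(2)[OF assms(2)] by (rule slice_tendsto[OF assms(3)])
qed

lemma uncoords_coords:
  assumes "\<And>t. \<Xi> t \<in> C t"
  shows "uncoords (coords \<Xi>) t = \<Xi> t"
proof (rule crd_inj)
  have b: "coords \<Xi> \<in> box" by (rule coords_in_box[OF assms])
  show "uncoords (coords \<Xi>) t \<in> borel_probs" "\<Xi> t \<in> borel_probs"
    by (rule C_probs[OF uncoords(1)[OF b]], rule C_probs[OF assms])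
  show "crd (uncoords (coords \<Xi>) t) = crd (\<Xi> t)" by (simp add: uncoords(2)[OF b] slice_coords)
qed

lemma subseq:
  assumes "\<And>n t. \<Xi> n t \<in> C t"
  obtains r \<Xi>' where "strict_mono (r :: nat \<Rightarrow> nat)" "\<And>t. \<Xi>' t \<in> C t" "\<And>t. wconv (\<lambda>k. \<Xi> (r k) t) (\<Xi>' t)"
proof -
  have b: "coords (\<Xi> n) \<in> box" for n by (rule coords_in_box[OF assms])
  obtain z r where zr: "z \<in> box" "strict_mono (r :: nat \<Rightarrow> nat)" "((\<lambda>n. coords (\<Xi> n)) \<circ> r) \<longlonglongrightarrow> z"
    using compact_cube_subseq[OF compact_box, of "\<lambda>n. coords (\<Xi> n)"] b by blast
  show ?thesis
  proof (rule that[OF zr(2)])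
    show "uncoords z t \<in> C t" for t by (rule uncoords(1)[OF zr(1)])
    show "wconv (\<lambda>k. \<Xi> (r k) t) (uncoords z t)" for t
      using wconv_uncoords[OF b zr(1), of r t] zr(3) uncoords_coords[OF assms] by (simp add: comp_def)
  qed
qed

theorem fixpoint:
  assumes conv: "\<And>t M N \<gamma>. M \<in> C t \<Longrightarrow> N \<in> C t \<Longrightarrow> 0 < \<gamma> \<Longrightarrow> \<gamma> < 1 \<Longrightarrow> mixture \<gamma> M N \<in> C t"
    and ne: "\<And>t. C t \<noteq> {}"
    and F: "\<And>\<Xi> t. (\<And>t. \<Xi> t \<in> C t) \<Longrightarrow> F \<Xi> t \<in> C t"
    and cont: "\<And>\<Xi>s \<Xi> t. (\<And>n t. \<Xi>s n t \<in> C t) \<Longrightarrow> (\<And>t. \<Xi> t \<in> C t) \<Longrightarrow>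
      (\<And>t. wconv (\<lambda>n. \<Xi>s n t) (\<Xi> t)) \<Longrightarrow> wconv (\<lambda>n. F (\<Xi>s n) t) (F \<Xi> t)"
  obtains \<Xi> where "\<And>t. \<Xi> t \<in> C t" "F \<Xi> = \<Xi>"
proof -
  have body: "cube_body box"
  proof
    have "(SOME M. M \<in> C t) \<in> C t" for t using ne[of t] by (simp add: some_in_eq)
    then have "coords (\<lambda>t. SOME M. M \<in> C t) \<in> box" by (rule coords_in_box)
    then show "box \<noteq> {}" by blast
    show "cvx box" unfolding cvx_def
    proof (intro ballI allI impI)
      fix a b and \<gamma> :: real assume ab: "a \<in> box" "b \<in> box" and g: "0 < \<gamma>" "\<gamma> < 1"
      have "slice (\<lambda>j. \<gamma> * a j + (1 - \<gamma>) * b j) t \<in> crd ` C t" for t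
      proof -
        have "slice (\<lambda>j. \<gamma> * a j + (1 - \<gamma>) * b j) t = crd (mixture \<gamma> (uncoords a t) (uncoords b t))"
          using crd_mixture[OF C_probs[OF uncoords(1)[OF ab(1)]] C_probs[OF uncoords(1)[OF ab(2)]], of \<gamma> t t] g
          by (simp add: uncoords(2)[OF ab(1)] uncoords(2)[OF ab(2)]) (simp add: slice_def[abs_def])
        then show ?thesis using conv[OF uncoords(1)[OF ab(1)] uncoords(1)[OF ab(2)] g] by simp
      qed
      then show "(\<lambda>j. \<gamma> * a j + (1 - \<gamma>) * b j) \<in> box" by (simp add: box_def)
    qed
  qed (rule compact_box box_subset_cube)+
  interpret B: cube_body box by (rule body)
  define H where "H z = coords (F (uncoords z))" for z
  have Hb: "H z \<in> box" if "z \<in> box" for z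
    unfolding H_def by (rule coords_in_box, rule F, rule uncoords(1)[OF that])
  have "continuous_on box H"
    unfolding continuous_on_sequentially
  proof (intro allI ballI impI)
    fix x a assume a: "a \<in> box" and "(\<forall>n. x n \<in> box) \<and> x \<longlonglongrightarrow> a"
    then have x: "\<And>n. x n \<in> box" "x \<longlonglongrightarrow> a" by auto
    have "wconv (\<lambda>n. F (uncoords (x n)) t) (F (uncoords a) t)" for t
      by (rule cont[OF uncoords(1)[OF x(1)] uncoords(1)[OF a] wconv_uncoords[OF x(1) a x(2)]])
    from wconv_crd[OF this] show "(H \<circ> x) \<longlonglongrightarrow> H a"
      by (simp add: H_def coords_def tendsto_fun_iff)
  qed
  then obtain z where z: "z \<in> box" "H z = z" using B.fixpoint[of H] Hb by metis
  have FC: "F (uncoords z) t \<in> C t" for t by (rule F, rule uncoords(1)[OF z(1)])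
  have "F (uncoords z) t = uncoords z t" for t
  proof (rule crd_inj)
    show "F (uncoords z) t \<in> borel_probs" "uncoords z t \<in> borel_probs"
      by (rule C_probs[OF FC], rule C_probs[OF uncoords(1)[OF z(1)]])
    show "crd (F (uncoords z) t) = crd (uncoords z t)"
      using z(2) slice_coords[of "F (uncoords z)" t] uncoords(2)[OF z(1), of t] by (simp add: H_def)
  qed
  then show ?thesis using that[of "uncoords z"] uncoords(1)[OF z(1)] by blast
qed

end

section \<open>Existence of an equilibrium\<close>

lemma abs_le_sup_norm: assumes "f \<in> Bb" shows "\<bar>f x\<bar> \<le> sup_norm f"
proof -
  obtain b where "\<And>x. \<bar>f x\<bar> \<le> b" using assms by (auto simp: Bb_def bounded_iff)
  then have "bdd_above (range (\<lambda>x. \<bar>f x\<bar>))" by (intro bdd_aboveI[of _ b]) auto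
  then show ?thesis unfolding sup_norm_def by (rule cSUP_upper[rotated]) simp
qed

lemma sup_norm_le: "(\<And>x. \<bar>v x\<bar> \<le> B) \<Longrightarrow> sup_norm v \<le> B"
  unfolding sup_norm_def by (rule cSUP_least) auto

text \<open>The parallelogram identity.\<close>

lemma ip_midpoint:
  assumes "a \<in> cube" "b \<in> cube"
  shows "ip (\<lambda>j. 1/2 * a j + (1 - 1/2) * b j) (\<lambda>j. 1/2 * a j + (1 - 1/2) * b j) =
    1/2 * ip a a + 1/2 * ip b b - 1/4 * ip (\<lambda>j. a j - b j) (\<lambda>j. a j - b j)"
proof -
  have i: "integrable geo (\<lambda>j. a j * a j)" "integrable geo (\<lambda>j. b j * b j)"
    "integrable geo (\<lambda>j. (a j - b j) * (a j - b j))"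
    by (rule integrable_ip[OF cubeD(3)[OF assms(1)] cubeD(3)[OF assms(1)]],
        rule integrable_ip[OF cubeD(3)[OF assms(2)] cubeD(3)[OF assms(2)]],
        rule integrable_ip[OF cube_diff_bound[OF assms] cube_diff_bound[OF assms]])
  have "ip (\<lambda>j. 1/2 * a j + (1 - 1/2) * b j) (\<lambda>j. 1/2 * a j + (1 - 1/2) * b j) =
    (\<integral>j. 1/2 * (a j * a j) + 1/2 * (b j * b j) - 1/4 * ((a j - b j) * (a j - b j)) \<partial>geo)"
    unfolding ip_def by (intro Bochner_Integration.integral_cong refl) (simp add: field_simps)
  also have "\<dots> = 1/2 * ip a a + 1/2 * ip b b - 1/4 * ip (\<lambda>j. a j - b j) (\<lambda>j. a j - b j)"
    unfolding ip_def using i by simp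
  finally show ?thesis .
qed

lemma S_comp_step: "t < T \<Longrightarrow> S_comp G t T \<Xi> v = S_opt G t (\<Xi> t) (S_comp G (Suc t) T \<Xi> v)"
  by (simp add: S_comp_def upt_conv_Cons)

lemma S_comp_cong: "(\<And>r. t \<le> r \<Longrightarrow> r < T \<Longrightarrow> \<Xi> r = \<Xi>' r) \<Longrightarrow> S_comp G t T \<Xi> = S_comp G t T \<Xi>'"
  unfolding S_comp_def by (intro arg_cong2[where f="\<lambda>xs. foldr (\<circ>) xs"] map_cong refl) auto

instance prod :: (polish_space, polish_space) polish_space ..

text \<open>The moment function \<open>\<tau>\<close> is a version of \<open>\<sigma>\<close> that is shifted to be nonnegative; since the growth factor
  \<open>ccheck\<close> is at least \<open>1\<close>, the shift preserves the growth condition, and integrals of \<open>\<tau>\<close> can be handled in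
  \<open>ennreal\<close>.\<close>

locale mean_field_game =
  fixes T :: nat
    and P :: "nat \<Rightarrow> 'x::polish_space \<Rightarrow> 'x measure \<Rightarrow> 'a::polish_space \<Rightarrow> 'x measure"
    and \<xi>0 :: "'x measure"
    and G :: "nat \<Rightarrow> 'x measure \<Rightarrow> 'a measure \<Rightarrow> ('x \<Rightarrow> real) \<Rightarrow> 'x \<Rightarrow> real"
    and V :: "'x \<times> 'x measure \<Rightarrow> real"
    and c0 c1 cbar ccheck :: real
    and K :: "nat \<Rightarrow> 'x set"
    and \<tau> :: "'x \<Rightarrow> real" and c\<tau> :: real
  assumes T: "T \<ge> 2"
    and \<xi>0: "\<xi>0 \<in> borel_probs"
    and G_Bb: "\<And>t \<xi> l v. t \<in> {1..T-1} \<Longrightarrow> \<xi> \<in> borel_probs \<Longrightarrow> l \<in> borel_probs \<Longrightarrow> v \<in> Bb \<Longrightarrow>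
      G t \<xi> l v \<in> Bb"
    and V: "V \<in> Cb (prod_topology euclidean weak_topology)"
    and A_compact: "compact (UNIV :: 'a set)"
    and c1: "c1 > 0"
    and G_growth: "\<And>t \<xi> l v. t \<in> {1..T-1} \<Longrightarrow> \<xi> \<in> borel_probs \<Longrightarrow> l \<in> borel_probs \<Longrightarrow> v \<in> Bb \<Longrightarrow>
      sup_norm (G t \<xi> l v) \<le> c0 + c1 * sup_norm v"
    and G_lipschitz: "\<And>t \<xi> l x v v'. t \<in> {1..T-1} \<Longrightarrow> \<xi> \<in> borel_probs \<Longrightarrow> l \<in> borel_probs \<Longrightarrow>
      v \<in> Bb \<Longrightarrow> v' \<in> Bb \<Longrightarrow>
      \<bar>G t \<xi> l v x - G t \<xi> l v' x\<bar> \<le> cbar * (\<integral>y. \<bar>v y - v' y\<bar> \<partial>Q P t x \<xi> l)"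
    and G_convex: "\<And>t \<xi> l l' v \<gamma> x. t \<in> {1..T-1} \<Longrightarrow> \<xi> \<in> borel_probs \<Longrightarrow>
      l \<in> borel_probs \<Longrightarrow> l' \<in> borel_probs \<Longrightarrow> v \<in> Bb \<Longrightarrow> 0 < \<gamma> \<Longrightarrow> \<gamma> < 1 \<Longrightarrow>
      G t \<xi> (mixture \<gamma> l l') v x \<le> \<gamma> * G t \<xi> l v x + (1 - \<gamma>) * G t \<xi> l' v x"
    and K_incseq: "incseq K"
    and K_compact: "\<And>i. compact (K i)"
    and ccheck: "ccheck \<ge> 1"
    and \<tau>_cont: "continuous_on UNIV \<tau>"
    and \<tau>_nonneg: "\<And>x. 0 \<le> \<tau> x"
    and \<tau>_big: "\<And>i x. x \<notin> K i \<Longrightarrow> real i \<le> \<tau> x"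
    and c\<tau>: "c\<tau> \<ge> 0"
    and \<tau>_init: "(\<integral>\<^sup>+x. ennreal (\<tau> x) \<partial>\<xi>0) \<le> ennreal c\<tau>"
    and \<tau>_step: "\<And>t x \<xi> a. t \<in> {1..T-1} \<Longrightarrow> \<xi> \<in> borel_probs \<Longrightarrow>
      (\<integral>\<^sup>+y. ennreal (\<tau> y) \<partial>P t x \<xi> a) \<le> ennreal ccheck * ennreal (\<tau> x)"
    and P_cont: "\<And>t. t \<in> {1..T-1} \<Longrightarrow>
      continuous_map (prod_topology euclidean (prod_topology weak_topology euclidean))
        weak_topology (\<lambda>(x, \<xi>, a). P t x \<xi> a)"
    and G_cont: "\<And>t v. t \<in> {1..T-1} \<Longrightarrow> v \<in> Cb euclidean \<Longrightarrow>
      continuous_map (prod_topology euclidean (prod_topology weak_topology weak_topology))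
        euclideanreal (\<lambda>(x, \<xi>, l). G t \<xi> l v x)"
begin

lemma K_A: "wcompact (borel_probs :: 'a measure set)"
  by (rule wcompact_borel_probs[OF A_compact])

lemma P_probs: "t \<in> {1..T-1} \<Longrightarrow> \<xi> \<in> borel_probs \<Longrightarrow> P t x \<xi> a \<in> borel_probs"
  using continuous_map_image_subset_topspace[OF P_cont[of t]] by (auto simp: topspace_weak image_subset_iff)

lemma P_tendsto:
  assumes "t \<in> {1..T-1}" "xs \<longlonglongrightarrow> x" "wconv \<xi>s \<xi>" "as \<longlonglongrightarrow> a"
  shows "wconv (\<lambda>n. P t (xs n) (\<xi>s n) (as n)) (P t x \<xi> a)"
proof (rule limitin_imp_wconv)
  have "limitin (prod_topology euclidean (prod_topology weak_topology euclidean)) (\<lambda>n. (xs n, \<xi>s n, as n)) (x, \<xi>, a) sequentially"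
    using assms wconv_imp_limitin[OF assms(3)] by (simp add: limitin_pairwise comp_def)
  from continuous_map_limit[OF P_cont[OF assms(1)] this]
  show "limitin weak_topology (\<lambda>n. P t (xs n) (\<xi>s n) (as n)) (P t x \<xi> a) sequentially" by (simp add: comp_def)
  show "P t (xs n) (\<xi>s n) (as n) \<in> borel_probs" for n
    using assms(3) by (intro P_probs assms(1)) (simp add: wconv_def)
qed

lemma P_kernel_action:
  assumes "t \<in> {1..T-1}" "\<xi> \<in> borel_probs"
  shows "P t x \<xi> \<in> borel \<rightarrow>\<^sub>M prob_algebra borel"
  by (rule kernel_of_wconv[OF P_probs[OF assms]]) (rule P_tendsto[OF assms(1) tendsto_const wconv_const[OF assms(2)]])

lemma P_kernel:
  assumes "t \<in> {1..T-1}" "\<xi> \<in> borel_probs"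
  shows "(\<lambda>(x, a). P t x \<xi> a) \<in> borel \<rightarrow>\<^sub>M prob_algebra borel"
proof (rule kernel_of_wconv)
  show "(case z of (x, a) \<Rightarrow> P t x \<xi> a) \<in> borel_probs" for z by (simp add: case_prod_beta P_probs[OF assms])
  show "wconv (\<lambda>n. case zs n of (x, a) \<Rightarrow> P t x \<xi> a) (case z of (x, a) \<Rightarrow> P t x \<xi> a)" if "zs \<longlonglongrightarrow> z" for zs z
    unfolding case_prod_beta
    by (rule P_tendsto[OF assms(1) tendsto_fst[OF that] wconv_const[OF assms(2)] tendsto_snd[OF that]])
qed

lemma next_law_tendsto:
  assumes t: "t \<in> {1..T-1}" and w: "wconv \<psi>s \<psi>"
  shows "wconv (\<lambda>n. next_law P t (\<psi>s n)) (next_law P t \<psi>)"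
  unfolding next_law_def
proof (rule wconv_bind[OF w])
  have m: "wconv (\<lambda>n. marg (\<psi>s n)) (marg \<psi>)" by (rule wconv_marg[OF w])
  then have mp: "marg (\<psi>s n) \<in> borel_probs" "marg \<psi> \<in> borel_probs" for n by (auto simp: wconv_def)
  show "(\<lambda>(y, a). P t y (marg (\<psi>s n)) a) \<in> borel \<rightarrow>\<^sub>M prob_algebra borel" for n by (rule P_kernel[OF t mp(1)])
  show "(\<lambda>(y, a). P t y (marg \<psi>) a) \<in> borel \<rightarrow>\<^sub>M prob_algebra borel" by (rule P_kernel[OF t mp(2)])
  show "wconv (\<lambda>n. case zs n of (x, a) \<Rightarrow> P t x (marg \<psi>) a) (case z of (x, a) \<Rightarrow> P t x (marg \<psi>) a)" if "zs \<longlonglongrightarrow> z" for zs z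
    unfolding case_prod_beta
    by (rule P_tendsto[OF t tendsto_fst[OF that] wconv_const[OF mp(2)] tendsto_snd[OF that]])
  show "wconv (\<lambda>k. case zs k of (x, a) \<Rightarrow> P t x (marg (\<psi>s (r k))) a) (case z of (x, a) \<Rightarrow> P t x (marg \<psi>) a)"
    if "filterlim r at_top sequentially" "zs \<longlonglongrightarrow> z" for r zs z
    unfolding case_prod_beta
    by (rule P_tendsto[OF t tendsto_fst[OF that(2)] wconv_compose[OF m that(1)] tendsto_snd[OF that(2)]])
qed

lemma next_law_moment:
  assumes t: "t \<in> {1..T-1}" and \<psi>: "\<psi> \<in> borel_probs"
  shows "(\<integral>\<^sup>+x. ennreal (\<tau> x) \<partial>next_law P t \<psi>) \<le> ennreal ccheck * (\<integral>\<^sup>+x. ennreal (\<tau> x) \<partial>marg \<psi>)"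
proof -
  have mp: "marg \<psi> \<in> borel_probs" by (rule marg_borel_probs(3)[OF \<psi>])
  have \<tau>m: "(\<lambda>x. ennreal (\<tau> x)) \<in> borel_measurable borel"
    using borel_measurable_continuous_onI[OF \<tau>_cont] by simp
  have fm: "(\<lambda>z. ennreal (\<tau> (fst z))) \<in> borel_measurable \<psi>" by (rule measurable_compose[OF marg_borel_probs(1)[OF \<psi>] \<tau>m])
  have "(\<integral>\<^sup>+x. ennreal (\<tau> x) \<partial>next_law P t \<psi>) = (\<integral>\<^sup>+z. (\<integral>\<^sup>+y. ennreal (\<tau> y) \<partial>(case z of (x, a) \<Rightarrow> P t x (marg \<psi>) a)) \<partial>\<psi>)"
    unfolding next_law_def by (rule nn_integral_bind_kernel[OF \<psi> P_kernel[OF t mp] \<tau>m])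
  also have "\<dots> \<le> (\<integral>\<^sup>+z. ennreal ccheck * ennreal (\<tau> (fst z)) \<partial>\<psi>)"
    by (intro nn_integral_mono) (simp add: case_prod_beta \<tau>_step[OF t mp])
  also have "\<dots> = ennreal ccheck * (\<integral>\<^sup>+z. ennreal (\<tau> (fst z)) \<partial>\<psi>)" by (rule nn_integral_cmult[OF fm])
  also have "(\<integral>\<^sup>+z. ennreal (\<tau> (fst z)) \<partial>\<psi>) = (\<integral>\<^sup>+x. ennreal (\<tau> x) \<partial>marg \<psi>)"
    unfolding marg_def by (rule nn_integral_distr[OF marg_borel_probs(1)[OF \<psi>], symmetric]) (simp add: \<tau>m)
  finally show ?thesis .
qed

text \<open>The operator is continuous in its parameters only for a fixed function \<open>v\<close>. Replacing \<open>vs n\<close> by \<open>v\<close> costs, by the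
  Lipschitz condition, at most a multiple of the integral of \<open>\<bar>vs n - v\<bar>\<close> under the transition laws; these converge weakly
  and the integrands converge continuously to \<open>0\<close>.\<close>

lemma G_tendsto:
  assumes t: "t \<in> {1..T-1}" and \<xi>: "wconv \<xi>s \<xi>" and l: "wconv ls l" and x: "xs \<longlonglongrightarrow> x"
    and vs: "\<And>n. vs n \<in> Bb" and v: "v \<in> Cb euclidean" and B: "\<And>n y. \<bar>vs n y\<bar> \<le> B"
    and conv: "\<And>r ys y. filterlim r at_top sequentially \<Longrightarrow> ys \<longlonglongrightarrow> y \<Longrightarrow> (\<lambda>k. vs (r k) (ys k)) \<longlonglongrightarrow> v y"
  shows "(\<lambda>n. G t (\<xi>s n) (ls n) (vs n) (xs n)) \<longlonglongrightarrow> G t \<xi> l v x"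
proof -
  have p: "\<xi>s n \<in> borel_probs" "\<xi> \<in> borel_probs" "ls n \<in> borel_probs" "l \<in> borel_probs" for n
    using \<xi> l by (auto simp: wconv_def)
  have vB: "v \<in> Bb" using v Cb_subset_Bb by blast
  have vb: "\<bar>v y\<bar> \<le> B" for y
  proof (rule LIMSEQ_le_const2)
    show "(\<lambda>k. \<bar>vs k y\<bar>) \<longlonglongrightarrow> \<bar>v y\<bar>"
      using conv[of "\<lambda>k. k" "\<lambda>k. y" y] by (intro tendsto_rabs) (simp add: filterlim_ident)
  qed (use B in blast)
  have vc: "v (ys k) \<in> UNIV \<and> (\<lambda>k. v (ys k)) \<longlonglongrightarrow> v y" if "ys \<longlonglongrightarrow> y" for ys y k
    using v that by (auto simp: Cb_euclidean_iff continuous_on_eq_continuous_at intro: isCont_tendsto_compose)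
  have Qc: "wconv (\<lambda>n. Q P t (xs n) (\<xi>s n) (ls n)) (Q P t x \<xi> l)"
    unfolding Q_def
  proof (rule wconv_bind[OF l P_kernel_action[OF t p(1)] P_kernel_action[OF t p(2)]])
    show "wconv (\<lambda>j. P t x \<xi> (ys j)) (P t x \<xi> y)" if "ys \<longlonglongrightarrow> y" for ys y
      by (rule P_tendsto[OF t tendsto_const wconv_const[OF p(2)] that])
    show "wconv (\<lambda>j. P t (xs (r j)) (\<xi>s (r j)) (ys j)) (P t x \<xi> y)" if "filterlim r at_top sequentially" "ys \<longlonglongrightarrow> y" for r ys y
      by (rule P_tendsto[OF t filterlim_compose[OF x that(1)] wconv_compose[OF \<xi> that(1)] that(2)])
  qed
  have "(\<lambda>n. \<integral>y. \<bar>vs n y - v y\<bar> \<partial>Q P t (xs n) (\<xi>s n) (ls n)) \<longlonglongrightarrow> (\<integral>y. 0 \<partial>Q P t x \<xi> l)"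
  proof (rule wconv_integral[OF Qc continuous_on_const])
    show "(\<lambda>y. \<bar>vs n y - v y\<bar>) \<in> borel_measurable borel" for n
    proof -
      have [measurable]: "vs n \<in> borel_measurable borel" "v \<in> borel_measurable borel" using vs[of n] vB by (auto simp: Bb_def)
      show ?thesis by measurable
    qed
    show "\<bar>\<bar>vs n y - v y\<bar>\<bar> \<le> 2 * B" for n y using B[of n y] vb[of y] by linarith
    show "(\<lambda>k. \<bar>vs (r k) (ys k) - v (ys k)\<bar>) \<longlonglongrightarrow> 0" if "filterlim r at_top sequentially" "ys \<longlonglongrightarrow> y" for r ys y
      using tendsto_rabs[OF tendsto_diff[OF conv[OF that] conjunct2[OF vc[OF that(2)]]]] by simp
  qed
  then have d: "(\<lambda>n. cbar * (\<integral>y. \<bar>vs n y - v y\<bar> \<partial>Q P t (xs n) (\<xi>s n) (ls n))) \<longlonglongrightarrow> 0"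
    using tendsto_mult_left[of _ 0 sequentially cbar] by simp
  have "(\<lambda>n. G t (\<xi>s n) (ls n) (vs n) (xs n) - G t (\<xi>s n) (ls n) v (xs n)) \<longlonglongrightarrow> 0"
    by (rule Lim_null_comparison[OF _ d]) (intro always_eventually allI, simp add: G_lipschitz[OF t p(1,3) vs vB])
  moreover have "(\<lambda>n. G t (\<xi>s n) (ls n) v (xs n)) \<longlonglongrightarrow> G t \<xi> l v x"
  proof -
    have "limitin (prod_topology euclidean (prod_topology weak_topology weak_topology)) (\<lambda>n. (xs n, \<xi>s n, ls n)) (x, \<xi>, l) sequentially"
      using x wconv_imp_limitin[OF \<xi>] wconv_imp_limitin[OF l] by (simp add: limitin_pairwise comp_def)
    from continuous_map_limit[OF G_cont[OF t v] this] show ?thesis by (simp add: comp_def)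
  qed
  ultimately show ?thesis using tendsto_add[of _ 0 sequentially _ "G t \<xi> l v x"] by fastforce
qed

definition laws :: "(nat \<Rightarrow> 'x measure) \<Rightarrow> bool" where
  "laws \<Xi> \<longleftrightarrow> (\<forall>t\<in>{1..T}. \<Xi> t \<in> borel_probs)"

text \<open>Weak convergence of the laws at the times \<open>1, \<dots>, T\<close>, where the law at time \<open>T\<close> is the argument of
  the terminal cost.\<close>

definition fconv :: "(nat \<Rightarrow> nat \<Rightarrow> 'x measure) \<Rightarrow> (nat \<Rightarrow> 'x measure) \<Rightarrow> bool" where
  "fconv \<Xi>s \<Xi> \<longleftrightarrow> (\<forall>t\<in>{1..T}. wconv (\<lambda>n. \<Xi>s n t) (\<Xi> t))"

lemma fconv_compose:
  assumes "fconv \<Xi>s \<Xi>" "filterlim r at_top sequentially"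
  shows "fconv (\<lambda>k. \<Xi>s (r k)) \<Xi>"
  unfolding fconv_def
proof
  fix t assume "t \<in> {1..T}"
  then have "wconv (\<lambda>n. \<Xi>s n t) (\<Xi> t)" using assms(1) by (simp add: fconv_def)
  from wconv_compose[OF this assms(2)] show "wconv (\<lambda>k. \<Xi>s (r k) t) (\<Xi> t)" .
qed

lemma fconv_const: "laws \<Xi> \<Longrightarrow> fconv (\<lambda>_. \<Xi>) \<Xi>"
  by (simp add: fconv_def laws_def wconv_const)

lemma fconv_laws: "fconv \<Xi>s \<Xi> \<Longrightarrow> laws (\<Xi>s n)" "fconv \<Xi>s \<Xi> \<Longrightarrow> laws \<Xi>"
  by (auto simp: fconv_def laws_def wconv_def)

lemma laws_probs: "laws \<Xi> \<Longrightarrow> t \<in> {1..T-1} \<Longrightarrow> \<Xi> t \<in> borel_probs"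
  by (auto simp: laws_def)

lemma fconvD: "fconv \<Xi>s \<Xi> \<Longrightarrow> t \<in> {1..T-1} \<Longrightarrow> wconv (\<lambda>n. \<Xi>s n t) (\<Xi> t)"
  by (auto simp: fconv_def)

definition val :: "nat \<Rightarrow> (nat \<Rightarrow> 'x measure) \<Rightarrow> 'x \<Rightarrow> real" where
  "val t \<Xi> = S_comp G t T \<Xi> (\<lambda>x. V (x, \<Xi> T))"

text \<open>Joint continuity of the value function in the state and in all laws, with a bound that is uniform in the laws. This is what
  passes from time \<open>Suc t\<close> to time \<open>t\<close>.\<close>

definition regular :: "nat \<Rightarrow> bool" where
  "regular t \<longleftrightarrow> (\<exists>B. \<forall>\<Xi> x. laws \<Xi> \<longrightarrow> \<bar>val t \<Xi> x\<bar> \<le> B) \<and>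
    (\<forall>\<Xi>s \<Xi> xs x. fconv \<Xi>s \<Xi> \<longrightarrow> xs \<longlonglongrightarrow> x \<longrightarrow> (\<lambda>n. val t (\<Xi>s n) (xs n)) \<longlonglongrightarrow> val t \<Xi> x)"

lemma regularD:
  assumes "regular t"
  obtains B where "\<And>\<Xi> x. laws \<Xi> \<Longrightarrow> \<bar>val t \<Xi> x\<bar> \<le> B"
  using assms unfolding regular_def by blast

lemma val_tendsto: "regular t \<Longrightarrow> fconv \<Xi>s \<Xi> \<Longrightarrow> xs \<longlonglongrightarrow> x \<Longrightarrow> (\<lambda>n. val t (\<Xi>s n) (xs n)) \<longlonglongrightarrow> val t \<Xi> x"
  unfolding regular_def by blast

lemma val_Cb:
  assumes r: "regular t" and \<Xi>: "laws \<Xi>"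
  shows "val t \<Xi> \<in> Cb euclidean"
proof -
  obtain B where "\<And>x. \<bar>val t \<Xi> x\<bar> \<le> B" using regularD[OF r] \<Xi> by metis
  moreover have "continuous_on UNIV (val t \<Xi>)"
    unfolding continuous_on_sequentially using val_tendsto[OF r fconv_const[OF \<Xi>]] by (simp add: comp_def)
  ultimately show ?thesis by (auto simp: Cb_euclidean_iff)
qed

lemma val_Bb: "regular t \<Longrightarrow> laws \<Xi> \<Longrightarrow> val t \<Xi> \<in> Bb"
  by (rule subsetD[OF Cb_subset_Bb val_Cb])

text \<open>The cost of the randomised action \<open>\<mu>\<close>, penalised by a strictly convex and weakly continuous function of \<open>\<mu>\<close>.\<close>

definition cost :: "real \<Rightarrow> nat \<Rightarrow> (nat \<Rightarrow> 'x measure) \<Rightarrow> 'x \<Rightarrow> 'a measure \<Rightarrow> real" where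
  "cost \<epsilon> t \<Xi> x \<mu> = G t (\<Xi> t) \<mu> (val (Suc t) \<Xi>) x + \<epsilon> * ip (crd \<mu>) (crd \<mu>)"

definition minimiser :: "real \<Rightarrow> nat \<Rightarrow> (nat \<Rightarrow> 'x measure) \<Rightarrow> 'x \<Rightarrow> 'a measure \<Rightarrow> bool" where
  "minimiser \<epsilon> t \<Xi> x \<mu> \<longleftrightarrow> \<mu> \<in> borel_probs \<and> (\<forall>\<nu>\<in>borel_probs. cost \<epsilon> t \<Xi> x \<mu> \<le> cost \<epsilon> t \<Xi> x \<nu>)"

definition best :: "real \<Rightarrow> nat \<Rightarrow> (nat \<Rightarrow> 'x measure) \<Rightarrow> 'x \<Rightarrow> 'a measure" where
  "best \<epsilon> t \<Xi> x = (SOME \<mu>. minimiser \<epsilon> t \<Xi> x \<mu>)"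

lemma cost_tendsto:
  assumes t: "t \<in> {1..T-1}" and r: "regular (Suc t)" and \<epsilon>: "\<epsilon>s \<longlonglongrightarrow> \<epsilon>" and \<Xi>: "fconv \<Xi>s \<Xi>"
    and x: "xs \<longlonglongrightarrow> x" and w: "wconv ms m"
  shows "(\<lambda>n. cost (\<epsilon>s n) t (\<Xi>s n) (xs n) (ms n)) \<longlonglongrightarrow> cost \<epsilon> t \<Xi> x m"
proof -
  obtain B where B: "\<And>\<Xi> x. laws \<Xi> \<Longrightarrow> \<bar>val (Suc t) \<Xi> x\<bar> \<le> B" using regularD[OF r] by metis
  have "(\<lambda>n. G t (\<Xi>s n t) (ms n) (val (Suc t) (\<Xi>s n)) (xs n)) \<longlonglongrightarrow> G t (\<Xi> t) m (val (Suc t) \<Xi>) x"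
  proof (rule G_tendsto[OF t fconvD[OF \<Xi> t] w x])
    show "val (Suc t) (\<Xi>s n) \<in> Bb" for n by (rule val_Bb[OF r fconv_laws(1)[OF \<Xi>]])
    show "val (Suc t) \<Xi> \<in> Cb euclidean" by (rule val_Cb[OF r fconv_laws(2)[OF \<Xi>]])
    show "\<bar>val (Suc t) (\<Xi>s n) y\<bar> \<le> B" for n y by (rule B[OF fconv_laws(1)[OF \<Xi>]])
    show "(\<lambda>k. val (Suc t) (\<Xi>s (q k)) (ys k)) \<longlonglongrightarrow> val (Suc t) \<Xi> y" if "filterlim q at_top sequentially" "ys \<longlonglongrightarrow> y" for q ys y
      by (rule val_tendsto[OF r fconv_compose[OF \<Xi> that(1)] that(2)])
  qed
  moreover have "(\<lambda>n. ip (crd (ms n)) (crd (ms n))) \<longlonglongrightarrow> ip (crd m) (crd m)"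
  proof -
    have "ms n \<in> borel_probs" for n using w by (simp add: wconv_def)
    then have "\<bar>crd (ms n) j\<bar> \<le> 1" for n j by (intro cubeD(3) crd_cube)
    then show ?thesis using wconv_crd[OF w] by (intro ip_tendsto[of _ 1 _ 1]) (simp_all add: tendsto_fun_iff)
  qed
  ultimately show ?thesis unfolding cost_def by (intro tendsto_add tendsto_mult \<epsilon>)
qed

lemma minimiser_exists:
  assumes t: "t \<in> {1..T-1}" and r: "regular (Suc t)" and \<Xi>: "laws \<Xi>"
  shows "minimiser \<epsilon> t \<Xi> x (best \<epsilon> t \<Xi> x)"
proof -
  have "\<exists>m\<in>borel_probs. \<forall>m'\<in>borel_probs. cost \<epsilon> t \<Xi> x m \<le> cost \<epsilon> t \<Xi> x m'"
  proof (rule wcompact_attains_min[OF K_A])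
    show "(borel_probs :: 'a measure set) \<noteq> {}" using return_borel_probs by blast
    show "(\<lambda>n. cost \<epsilon> t \<Xi> x (ms n)) \<longlonglongrightarrow> cost \<epsilon> t \<Xi> x m" if "wconv ms m" for ms m
      by (rule cost_tendsto[OF t r tendsto_const fconv_const[OF \<Xi>] tendsto_const that])
  qed
  then show ?thesis unfolding best_def by (intro someI_ex[of "minimiser \<epsilon> t \<Xi> x"]) (auto simp: minimiser_def)
qed

lemma gamma_limit_cost:
  assumes t: "t \<in> {1..T-1}" and r: "regular (Suc t)" and \<epsilon>: "\<epsilon>s \<longlonglongrightarrow> \<epsilon>" and \<Xi>: "fconv \<Xi>s \<Xi>" and x: "xs \<longlonglongrightarrow> x"
  shows "gamma_limit (\<lambda>n. cost (\<epsilon>s n) t (\<Xi>s n) (xs n)) (cost \<epsilon> t \<Xi> x) (\<lambda>n. best (\<epsilon>s n) t (\<Xi>s n) (xs n))"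
proof
  show "(\<lambda>k. cost (\<epsilon>s (q k)) t (\<Xi>s (q k)) (xs (q k)) (ms k)) \<longlonglongrightarrow> cost \<epsilon> t \<Xi> x N"
    if q: "filterlim q at_top sequentially" and "wconv ms N" for q ms N
    by (rule cost_tendsto[OF t r filterlim_compose[OF \<epsilon> q] fconv_compose[OF \<Xi> q] filterlim_compose[OF x q] that(2)])
  show "best (\<epsilon>s n) t (\<Xi>s n) (xs n) \<in> borel_probs"
    "m' \<in> borel_probs \<Longrightarrow> cost (\<epsilon>s n) t (\<Xi>s n) (xs n) (best (\<epsilon>s n) t (\<Xi>s n) (xs n)) \<le> cost (\<epsilon>s n) t (\<Xi>s n) (xs n) m'" for n m'
    using minimiser_exists[OF t r fconv_laws(1)[OF \<Xi>], of "\<epsilon>s n" n "xs n"] by (simp_all add: minimiser_def)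
qed

lemma val_eq_cost:
  assumes t: "t \<in> {1..T-1}" and m: "minimiser 0 t \<Xi> x \<mu>"
  shows "val t \<Xi> x = G t (\<Xi> t) \<mu> (val (Suc t) \<Xi>) x"
proof -
  have "val t \<Xi> x = (INF \<nu>\<in>borel_probs. G t (\<Xi> t) \<nu> (val (Suc t) \<Xi>) x)"
    using t T unfolding val_def by (subst S_comp_step) (auto simp: S_opt_def)
  also have "\<dots> = G t (\<Xi> t) \<mu> (val (Suc t) \<Xi>) x"
    by (rule cInf_eq_minimum) (use m in \<open>auto simp: minimiser_def cost_def\<close>)
  finally show ?thesis .
qed

text \<open>The value at time \<open>t\<close> is the minimum of costs that converge continuously over the compact set of randomised
  actions.\<close>

lemma regular_step:
  assumes t: "t \<in> {1..T-1}" and r: "regular (Suc t)"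
  shows "regular t"
  unfolding regular_def
proof (intro conjI allI impI)
  have v: "val t \<Xi> x = cost 0 t \<Xi> x (best 0 t \<Xi> x)" if "laws \<Xi>" for \<Xi> x
    using val_eq_cost[OF t minimiser_exists[OF t r that]] by (simp add: cost_def)
  obtain B where B: "\<And>\<Xi> x. laws \<Xi> \<Longrightarrow> \<bar>val (Suc t) \<Xi> x\<bar> \<le> B" using regularD[OF r] by metis
  have "\<bar>val t \<Xi> x\<bar> \<le> c0 + c1 * B" if \<Xi>: "laws \<Xi>" for \<Xi> x
  proof -
    have b: "best 0 t \<Xi> x \<in> borel_probs" using minimiser_exists[OF t r \<Xi>] by (simp add: minimiser_def)
    have vB: "val (Suc t) \<Xi> \<in> Bb" by (rule val_Bb[OF r \<Xi>])
    have "\<bar>val t \<Xi> x\<bar> \<le> sup_norm (G t (\<Xi> t) (best 0 t \<Xi> x) (val (Suc t) \<Xi>))"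
      unfolding val_eq_cost[OF t minimiser_exists[OF t r \<Xi>]]
      by (rule abs_le_sup_norm[OF G_Bb[OF t laws_probs[OF \<Xi> t] b vB]])
    also have "\<dots> \<le> c0 + c1 * sup_norm (val (Suc t) \<Xi>)" by (rule G_growth[OF t laws_probs[OF \<Xi> t] b vB])
    also have "\<dots> \<le> c0 + c1 * B" using c1 sup_norm_le[of "val (Suc t) \<Xi>" B] B[OF \<Xi>] by simp
    finally show ?thesis .
  qed
  then show "\<exists>B. \<forall>\<Xi> x. laws \<Xi> \<longrightarrow> \<bar>val t \<Xi> x\<bar> \<le> B" by blast
  fix \<Xi>s \<Xi> and xs :: "nat \<Rightarrow> 'x" and x assume \<Xi>: "fconv \<Xi>s \<Xi>" and x: "xs \<longlonglongrightarrow> x"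
  interpret gamma_limit "\<lambda>n. cost 0 t (\<Xi>s n) (xs n)" "cost 0 t \<Xi> x" "\<lambda>n. best 0 t (\<Xi>s n) (xs n)"
    by (rule gamma_limit_cost[OF t r tendsto_const \<Xi> x])
  have "(\<lambda>n. cost 0 t (\<Xi>s n) (xs n) (best 0 t (\<Xi>s n) (xs n))) \<longlonglongrightarrow> cost 0 t \<Xi> x (best 0 t \<Xi> x)"
    by (rule min_values_tendsto[OF K_A])
      (use minimiser_exists[OF t r fconv_laws(2)[OF \<Xi>], of 0 x] in \<open>simp_all add: minimiser_def\<close>)
  then show "(\<lambda>n. val t (\<Xi>s n) (xs n)) \<longlonglongrightarrow> val t \<Xi> x"
    by (simp add: v fconv_laws(1)[OF \<Xi>] fconv_laws(2)[OF \<Xi>])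
qed

lemma regular_T: "regular T"
  unfolding regular_def
proof (intro conjI allI impI)
  have v: "val T \<Xi> x = V (x, \<Xi> T)" for \<Xi> x by (simp add: val_def S_comp_def)
  have Tin: "T \<in> {1..T}" using T by simp
  obtain B where "\<And>z. z \<in> topspace (prod_topology euclidean weak_topology) \<Longrightarrow> \<bar>V z\<bar> \<le> B"
    using V by (auto simp: Cb_def bounded_iff)
  then have "\<And>\<Xi> x. laws \<Xi> \<Longrightarrow> \<bar>val T \<Xi> x\<bar> \<le> B"
    using Tin by (simp add: v laws_def topspace_weak)
  then show "\<exists>B. \<forall>\<Xi> x. laws \<Xi> \<longrightarrow> \<bar>val T \<Xi> x\<bar> \<le> B" by blast
  fix \<Xi>s \<Xi> and xs :: "nat \<Rightarrow> 'x" and x assume \<Xi>: "fconv \<Xi>s \<Xi>" and x: "xs \<longlonglongrightarrow> x"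
  have "wconv (\<lambda>n. \<Xi>s n T) (\<Xi> T)" using \<Xi> Tin by (simp add: fconv_def)
  then have "limitin (prod_topology euclidean weak_topology) (\<lambda>n. (xs n, \<Xi>s n T)) (x, \<Xi> T) sequentially"
    using x wconv_imp_limitin by (simp add: limitin_pairwise comp_def)
  moreover have "continuous_map (prod_topology euclidean weak_topology) euclideanreal V" using V by (simp add: Cb_def)
  ultimately have "limitin euclideanreal (V \<circ> (\<lambda>n. (xs n, \<Xi>s n T))) (V (x, \<Xi> T)) sequentially" by (intro continuous_map_limit)
  then show "(\<lambda>n. val T (\<Xi>s n) (xs n)) \<longlonglongrightarrow> val T \<Xi> x" by (simp add: v comp_def)
qed

lemma regular: "1 \<le> t \<Longrightarrow> t \<le> T \<Longrightarrow> regular t"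
proof (induction "T - t" arbitrary: t)
  case 0
  then show ?case using regular_T by simp
next
  case (Suc n)
  have r: "regular (Suc t)" by (rule Suc(1)) (use Suc(2,3) in arith)+
  have "t \<in> {1..T-1}" using Suc(2,3) by auto
  from regular_step[OF this r] show ?case .
qed

lemma regular_Suc: "t \<in> {1..T-1} \<Longrightarrow> regular (Suc t)"
  using T by (intro regular) auto

text \<open>The midpoint of two minimisers would have a penalty strictly below the average of theirs, and by convexity of the operator at most their average cost.
  Uniqueness makes the minimiser continuous in the state and in the laws.\<close>

lemma minimiser_unique:
  assumes t: "t \<in> {1..T-1}" and \<Xi>: "laws \<Xi>" and \<epsilon>: "\<epsilon> > 0"
    and m: "minimiser \<epsilon> t \<Xi> x \<mu>" "minimiser \<epsilon> t \<Xi> x \<nu>"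
  shows "\<mu> = \<nu>"
proof -
  have p: "\<mu> \<in> borel_probs" "\<nu> \<in> borel_probs" using m by (auto simp: minimiser_def)
  define d where "d = (\<lambda>j. crd \<mu> j - crd \<nu> j)"
  have c: "crd \<mu> \<in> cube" "crd \<nu> \<in> cube" by (rule crd_cube[OF p(1)], rule crd_cube[OF p(2)])
  have eq: "cost \<epsilon> t \<Xi> x \<mu> = cost \<epsilon> t \<Xi> x \<nu>" using m p by (intro antisym) (auto simp: minimiser_def)
  have "mixture (1/2) \<mu> \<nu> \<in> borel_probs" by (rule mixture_eq_bind(2)[OF p]) auto
  then have "cost \<epsilon> t \<Xi> x \<mu> \<le> cost \<epsilon> t \<Xi> x (mixture (1/2) \<mu> \<nu>)" using m by (simp add: minimiser_def)
  also have "\<dots> \<le> 1/2 * G t (\<Xi> t) \<mu> (val (Suc t) \<Xi>) x + (1 - 1/2) * G t (\<Xi> t) \<nu> (val (Suc t) \<Xi>) x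
      + \<epsilon> * (1/2 * ip (crd \<mu>) (crd \<mu>) + 1/2 * ip (crd \<nu>) (crd \<nu>) - 1/4 * ip d d)"
  proof -
    have "crd (mixture (1/2) \<mu> \<nu>) = (\<lambda>j. 1/2 * crd \<mu> j + (1 - 1/2) * crd \<nu> j)" by (rule crd_mixture[OF p]) auto
    then have "ip (crd (mixture (1/2) \<mu> \<nu>)) (crd (mixture (1/2) \<mu> \<nu>)) = 1/2 * ip (crd \<mu>) (crd \<mu>) + 1/2 * ip (crd \<nu>) (crd \<nu>) - 1/4 * ip d d"
      unfolding d_def by (simp only: ip_midpoint[OF c])
    moreover have "G t (\<Xi> t) (mixture (1/2) \<mu> \<nu>) (val (Suc t) \<Xi>) x \<le> 1/2 * G t (\<Xi> t) \<mu> (val (Suc t) \<Xi>) x + (1 - 1/2) * G t (\<Xi> t) \<nu> (val (Suc t) \<Xi>) x"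
      by (rule G_convex[OF t laws_probs[OF \<Xi> t] p val_Bb[OF regular_Suc[OF t] \<Xi>]]) auto
    ultimately show ?thesis unfolding cost_def by simp
  qed
  also have "\<dots> = 1/2 * cost \<epsilon> t \<Xi> x \<mu> + 1/2 * cost \<epsilon> t \<Xi> x \<nu> - \<epsilon> / 4 * ip d d"
    by (simp add: cost_def algebra_simps)
  finally have "\<epsilon> / 4 * ip d d \<le> 0" using eq by simp
  then have le: "ip d d \<le> 0" using \<epsilon> by (simp add: mult_le_0_iff)
  have "d j = 0" for j
    by (rule ip_self_le_0[OF _ le, of 1]) (simp add: d_def cube_diff_bound[OF c])
  then have "crd \<mu> = crd \<nu>" by (auto simp: d_def)
  then show ?thesis by (rule crd_inj[OF p])
qed

lemma best_tendsto:
  assumes t: "t \<in> {1..T-1}" and \<epsilon>: "\<epsilon> > 0" and \<Xi>: "fconv \<Xi>s \<Xi>" and x: "xs \<longlonglongrightarrow> x"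
  shows "wconv (\<lambda>n. best \<epsilon> t (\<Xi>s n) (xs n)) (best \<epsilon> t \<Xi> x)"
proof -
  note r = regular_Suc[OF t]
  interpret gamma_limit "\<lambda>n. cost \<epsilon> t (\<Xi>s n) (xs n)" "cost \<epsilon> t \<Xi> x" "\<lambda>n. best \<epsilon> t (\<Xi>s n) (xs n)"
    by (rule gamma_limit_cost[OF t r tendsto_const \<Xi> x])
  have b: "minimiser \<epsilon> t \<Xi> x (best \<epsilon> t \<Xi> x)" by (rule minimiser_exists[OF t r fconv_laws(2)[OF \<Xi>]])
  show ?thesis
  proof (rule wcompact_wconvI[OF K_A m(1)])
    show "best \<epsilon> t \<Xi> x \<in> borel_probs" using b by (simp add: minimiser_def)
    fix q L assume q: "strict_mono (q :: nat \<Rightarrow> nat)" and L: "wconv (\<lambda>k. best \<epsilon> t (\<Xi>s (q k)) (xs (q k))) L"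
    have "minimiser \<epsilon> t \<Xi> x L"
      unfolding minimiser_def using L limit_minimiser[OF filterlim_subseq[OF q] L] by (simp add: wconv_def)
    then show "L = best \<epsilon> t \<Xi> x" by (rule minimiser_unique[OF t fconv_laws(2)[OF \<Xi>] \<epsilon> _ b])
  qed
qed

lemma best_kernel:
  assumes t: "t \<in> {1..T-1}" and \<epsilon>: "\<epsilon> > 0" and \<Xi>: "laws \<Xi>"
  shows "best \<epsilon> t \<Xi> \<in> borel \<rightarrow>\<^sub>M prob_algebra borel"
proof (rule kernel_of_wconv)
  show "best \<epsilon> t \<Xi> x \<in> borel_probs" for x
    using minimiser_exists[OF t regular_Suc[OF t] \<Xi>] by (simp add: minimiser_def)
qed (rule best_tendsto[OF t \<epsilon> fconv_const[OF \<Xi>]])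

definition law :: "real \<Rightarrow> nat \<Rightarrow> (nat \<Rightarrow> 'x measure) \<Rightarrow> ('x \<times> 'a) measure" where
  "law \<epsilon> t \<Xi> = joint (\<Xi> t) (best \<epsilon> t \<Xi>)"

lemma law_probs:
  assumes "t \<in> {1..T-1}" "\<epsilon> > 0" "laws \<Xi>"
  shows "law \<epsilon> t \<Xi> \<in> borel_probs" "marg (law \<epsilon> t \<Xi>) = \<Xi> t"
  unfolding law_def
  by (rule joint_borel_probs[OF laws_probs[OF assms(3,1)] best_kernel[OF assms]],
      rule marg_joint[OF laws_probs[OF assms(3,1)] best_kernel[OF assms]])

lemma law_tendsto:
  assumes t: "t \<in> {1..T-1}" and \<epsilon>: "\<epsilon> > 0" and \<Xi>: "fconv \<Xi>s \<Xi>"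
  shows "wconv (\<lambda>n. law \<epsilon> t (\<Xi>s n)) (law \<epsilon> t \<Xi>)"
  unfolding law_def
proof (rule wconv_joint[OF fconvD[OF \<Xi> t]])
  show "best \<epsilon> t (\<Xi>s n) \<in> borel \<rightarrow>\<^sub>M prob_algebra borel" for n by (rule best_kernel[OF t \<epsilon> fconv_laws(1)[OF \<Xi>]])
  show "best \<epsilon> t \<Xi> \<in> borel \<rightarrow>\<^sub>M prob_algebra borel" by (rule best_kernel[OF t \<epsilon> fconv_laws(2)[OF \<Xi>]])
  show "wconv (\<lambda>j. best \<epsilon> t \<Xi> (ys j)) (best \<epsilon> t \<Xi> y)" if "ys \<longlonglongrightarrow> y" for ys y
    by (rule best_tendsto[OF t \<epsilon> fconv_const[OF fconv_laws(2)[OF \<Xi>]] that])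
  show "wconv (\<lambda>j. best \<epsilon> t (\<Xi>s (r j)) (ys j)) (best \<epsilon> t \<Xi> y)" if "filterlim r at_top sequentially" "ys \<longlonglongrightarrow> y" for r ys y
    by (rule best_tendsto[OF t \<epsilon> fconv_compose[OF \<Xi> that(1)] that(2)])
qed

text \<open>The moment bound grows by the factor \<open>ccheck\<close> in every time step. These sets are weakly compact and convex, contain the
  initial law, and one step of the dynamics maps each of them into the next one.\<close>

definition tight_laws :: "nat \<Rightarrow> 'x measure set" where
  "tight_laws t = {M \<in> borel_probs. (\<integral>\<^sup>+x. ennreal (\<tau> x) \<partial>M) \<le> ennreal (c\<tau> * ccheck ^ t)}"

lemma bound_nonneg: "0 \<le> c\<tau> * ccheck ^ t" using c\<tau> ccheck by simp

lemma \<xi>0_tight: "\<xi>0 \<in> tight_laws t"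
proof -
  have "c\<tau> * 1 \<le> c\<tau> * ccheck ^ t" using c\<tau> ccheck by (intro mult_left_mono one_le_power)
  then have "ennreal c\<tau> \<le> ennreal (c\<tau> * ccheck ^ t)" by (intro ennreal_leI) simp
  then show ?thesis using \<tau>_init \<xi>0 by (auto simp: tight_laws_def intro: order_trans)
qed

lemma wcompact_tight_laws: "wcompact (tight_laws t)"
  unfolding tight_laws_def by (rule wcompact_moment[OF \<tau>_cont \<tau>_nonneg K_compact K_incseq \<tau>_big bound_nonneg])

lemma mixture_tight_laws:
  assumes MN: "M \<in> tight_laws t" "N \<in> tight_laws t" and g: "0 < \<gamma>" "\<gamma> < 1"
  shows "mixture \<gamma> M N \<in> tight_laws t"
proof -
  have p: "M \<in> borel_probs" "N \<in> borel_probs" using MN by (auto simp: tight_laws_def)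
  have \<tau>m: "(\<lambda>x. ennreal (\<tau> x)) \<in> borel_measurable borel" using borel_measurable_continuous_onI[OF \<tau>_cont] by simp
  have "(\<integral>\<^sup>+x. ennreal (\<tau> x) \<partial>mixture \<gamma> M N) = ennreal \<gamma> * (\<integral>\<^sup>+x. ennreal (\<tau> x) \<partial>M) + ennreal (1 - \<gamma>) * (\<integral>\<^sup>+x. ennreal (\<tau> x) \<partial>N)"
    by (rule nn_integral_mixture[OF p _ _ \<tau>m]) (use g in auto)
  also have "\<dots> \<le> ennreal \<gamma> * ennreal (c\<tau> * ccheck ^ t) + ennreal (1 - \<gamma>) * ennreal (c\<tau> * ccheck ^ t)"
    using MN by (intro add_mono mult_left_mono) (auto simp: tight_laws_def)
  also have "\<dots> = ennreal (\<gamma> + (1 - \<gamma>)) * ennreal (c\<tau> * ccheck ^ t)"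
    unfolding distrib_right[symmetric] using g by (subst ennreal_plus) auto
  finally show ?thesis using mixture_eq_bind(2)[OF p, of \<gamma>] g by (simp add: tight_laws_def)
qed

text \<open>All agents respond optimally, in the game with penalised costs, to the given laws. The law at time \<open>t\<close> arises from the law at
  time \<open>t - 1\<close>; the value outside of the times \<open>2, \<dots>, T\<close> is the initial law, which is relevant at time \<open>1\<close>
  only.\<close>

definition step :: "real \<Rightarrow> (nat \<Rightarrow> 'x measure) \<Rightarrow> nat \<Rightarrow> 'x measure" where
  "step \<epsilon> \<Xi> t = (if 2 \<le> t \<and> t \<le> T then next_law P (t - 1) (law \<epsilon> (t - 1) \<Xi>) else \<xi>0)"

lemma tight_laws_imp_laws: assumes "\<And>t. \<Xi> t \<in> tight_laws t" shows "laws \<Xi>"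
  unfolding laws_def
proof
  fix t show "\<Xi> t \<in> borel_probs" using assms[of t] by (simp add: tight_laws_def)
qed

lemma next_law_probs:
  assumes "t \<in> {1..T-1}" "\<psi> \<in> borel_probs"
  shows "next_law P t \<psi> \<in> borel_probs"
  unfolding next_law_def by (rule bind_borel_probs[OF assms(2) P_kernel[OF assms(1) marg_borel_probs(3)[OF assms(2)]]])

text \<open>The fixed point theorem applied to \<open>step \<epsilon>\<close>, which is continuous because the penalised best response is.\<close>

lemma penalised_equilibrium:
  assumes \<epsilon>: "\<epsilon> > 0"
  obtains \<Xi> where "\<And>t. \<Xi> t \<in> tight_laws t" "step \<epsilon> \<Xi> = \<Xi>"
proof -
  interpret measure_box tight_laws by standard (rule wcompact_tight_laws)
  have "\<exists>\<Xi>. (\<forall>t. \<Xi> t \<in> tight_laws t) \<and> step \<epsilon> \<Xi> = \<Xi>"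
  proof (rule fixpoint[of "step \<epsilon>", OF mixture_tight_laws])
    show "\<exists>\<Xi>. (\<forall>t. \<Xi> t \<in> tight_laws t) \<and> step \<epsilon> \<Xi> = \<Xi>"
      if "\<And>t. \<Xi> t \<in> tight_laws t" "step \<epsilon> \<Xi> = \<Xi>" for \<Xi>
      using that by (intro exI[of _ \<Xi>]) simp
    show "tight_laws t \<noteq> {}" for t using \<xi>0_tight by blast
    show "step \<epsilon> \<Xi> t \<in> tight_laws t" if \<Xi>: "\<And>t. \<Xi> t \<in> tight_laws t" for \<Xi> t
    proof (cases "2 \<le> t \<and> t \<le> T")
      case True
      then have t: "t - 1 \<in> {1..T-1}" by auto
      note L = law_probs[OF t \<epsilon> tight_laws_imp_laws[OF \<Xi>]]
      have "(\<integral>\<^sup>+x. ennreal (\<tau> x) \<partial>next_law P (t - 1) (law \<epsilon> (t - 1) \<Xi>)) \<le> ennreal ccheck * (\<integral>\<^sup>+x. ennreal (\<tau> x) \<partial>\<Xi> (t - 1))"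
        using next_law_moment[OF t L(1)] unfolding L(2) .
      also have "\<dots> \<le> ennreal ccheck * ennreal (c\<tau> * ccheck ^ (t - 1))"
        using \<Xi>[of "t - 1"] by (intro mult_left_mono) (auto simp: tight_laws_def)
      also have "\<dots> = ennreal (c\<tau> * ccheck ^ t)"
      proof -
        have "ccheck * (c\<tau> * ccheck ^ (t - 1)) = c\<tau> * ccheck ^ t" using True by (cases t) auto
        moreover have "ennreal ccheck * ennreal (c\<tau> * ccheck ^ (t - 1)) = ennreal (ccheck * (c\<tau> * ccheck ^ (t - 1)))"
          using ccheck bound_nonneg[of "t - 1"] by (intro ennreal_mult[symmetric]) auto
        ultimately show ?thesis by (simp only:)
      qed
      finally show ?thesis using next_law_probs[OF t L(1)] True by (simp add: step_def tight_laws_def)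
    next
      case False then show ?thesis using \<xi>0_tight by (auto simp: step_def)
    qed
    fix \<Xi>s \<Xi> t assume a: "\<And>n t. \<Xi>s n t \<in> tight_laws t" "\<And>t. \<Xi> t \<in> tight_laws t" "\<And>t. wconv (\<lambda>n. \<Xi>s n t) (\<Xi> t)"
    then have f: "fconv \<Xi>s \<Xi>" by (simp add: fconv_def)
    show "wconv (\<lambda>n. step \<epsilon> (\<Xi>s n) t) (step \<epsilon> \<Xi> t)"
    proof (cases "2 \<le> t \<and> t \<le> T")
      case True
      then have t: "t - 1 \<in> {1..T-1}" by auto
      show ?thesis using next_law_tendsto[OF t law_tendsto[OF t \<epsilon> f]] True by (simp add: step_def)
    next
      case False then show ?thesis using wconv_const[OF \<xi>0] by (auto simp: step_def)
    qed
  qed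
  then show ?thesis using that by blast
qed

text \<open>Penalised equilibria for penalties tending to \<open>0\<close> have joint laws of state and action in a weakly compact set, and the laws
  along a convergent subsequence have a flow as their limit, because the dynamics is continuous. The limit policies need not be
  limits of the penalised policies at any given state, but by \<open>limit_kernel_in_convex\<close> they almost surely take values in
  the convex sets of optimal randomised actions, since limits of penalised minimisers are minimisers. So the integrand of
  every term of the exploitability vanishes almost surely.\<close>

theorem equilibrium_exists: "\<exists>\<Psi>. mean_field_flow T P \<xi>0 \<Psi> \<and> mf_exploitability T P G cbar \<Psi> V = 0"
proof -
  define e where "e n = inverse (real (Suc n))" for n
  have e: "e n > 0" for n by (simp add: e_def)
  have e0: "e \<longlonglongrightarrow> 0" unfolding e_def by (rule LIMSEQ_inverse_real_of_nat)
  have "\<exists>\<Xi>. (\<forall>t. \<Xi> t \<in> tight_laws t) \<and> step (e n) \<Xi> = \<Xi>" for n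
    by (rule penalised_equilibrium[OF e[of n]]) blast
  then obtain \<Xi>n where \<Xi>n: "\<And>n t. \<Xi>n n t \<in> tight_laws t" "\<And>n. step (e n) (\<Xi>n n) = \<Xi>n n" by metis
  have lawsn: "laws (\<Xi>n n)" for n by (rule tight_laws_imp_laws[OF \<Xi>n(1)])
  define J where "J = {1..T-1}"
  \<comment> \<open>at times outside of \<open>J\<close> any law in the compact set will do\<close>
  define xin where "xin n t = (if t \<in> J then \<Xi>n n t else \<xi>0)" for n t
  define ln where "ln n t = (if t \<in> J then best (e n) t (\<Xi>n n) else (\<lambda>_. return borel undefined))" for n t
  have xin: "xin n t \<in> tight_laws t" "xin n t \<in> borel_probs" for n t
    using \<Xi>n(1)[of n t] \<xi>0_tight[of t] by (auto simp: xin_def tight_laws_def)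
  have ln: "ln n t \<in> borel \<rightarrow>\<^sub>M prob_algebra borel" for n t
  proof (cases "t \<in> J")
    case True
    then show ?thesis using best_kernel[OF _ e lawsn, of t n n] by (simp add: ln_def J_def)
  next
    case False
    have "(\<lambda>_. return borel undefined) \<in> borel \<rightarrow>\<^sub>M prob_algebra borel"
      by (rule measurable_const) (use return_borel_probs in \<open>simp add: borel_probs_eq\<close>)
    then show ?thesis using False by (simp add: ln_def)
  qed
  define \<Psi>n where "\<Psi>n n t = joint (xin n t) (ln n t)" for n t
  define C where "C t = {M \<in> (borel_probs :: ('x \<times> 'a) measure set). (\<integral>\<^sup>+z. ennreal (\<tau> (fst z)) \<partial>M) \<le> ennreal (c\<tau> * ccheck ^ t)}" for t
  have \<tau>f: "continuous_on UNIV (\<lambda>z :: 'x \<times> 'a. \<tau> (fst z))"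
    by (intro continuous_on_compose2[OF \<tau>_cont] continuous_intros) auto
  have wC: "wcompact (C t)" for t
    unfolding C_def
  proof (rule wcompact_moment[OF \<tau>f, where K="\<lambda>i. K i \<times> UNIV"])
    show "compact (K i \<times> (UNIV :: 'a set))" for i by (intro compact_Times K_compact A_compact)
    show "incseq (\<lambda>i. K i \<times> (UNIV :: 'a set))" using K_incseq by (auto simp: incseq_def)
    show "real i \<le> \<tau> (fst z)" if "z \<notin> K i \<times> UNIV" for i and z :: "'x \<times> 'a"
      by (rule \<tau>_big) (use that in \<open>cases z, auto\<close>)
  qed (rule \<tau>_nonneg bound_nonneg)+
  have \<Psi>nC: "\<Psi>n n t \<in> C t" for n t
  proof -
    have "(\<integral>\<^sup>+z. ennreal (\<tau> (fst z)) \<partial>\<Psi>n n t) = (\<integral>\<^sup>+x. (\<integral>\<^sup>+a. ennreal (\<tau> x) \<partial>ln n t x) \<partial>xin n t)"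
      unfolding \<Psi>n_def using nn_integral_joint[OF xin(2) ln, of "\<lambda>z. ennreal (\<tau> (fst z))" n t n t] borel_measurable_continuous_onI[OF \<tau>f] by simp
    also have "\<dots> = (\<integral>\<^sup>+x. ennreal (\<tau> x) \<partial>xin n t)"
    proof (rule nn_integral_cong)
      fix x
      interpret prob_space "ln n t x" by (rule borel_probsD(1)[OF borel_probs_measurable_prob_algebra[OF ln]])
      show "(\<integral>\<^sup>+a. ennreal (\<tau> x) \<partial>ln n t x) = ennreal (\<tau> x)" by (simp add: emeasure_space_1)
    qed
    also have "\<dots> \<le> ennreal (c\<tau> * ccheck ^ t)" using xin(1)[of n t] by (simp add: tight_laws_def)
    finally show ?thesis using joint_borel_probs[OF xin(2) ln] by (simp add: C_def \<Psi>n_def)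
  qed
  interpret MB: measure_box C by standard (rule wC)
  obtain r \<Psi> where r: "strict_mono (r :: nat \<Rightarrow> nat)" and \<Psi>C: "\<And>t. \<Psi> t \<in> C t" and \<Psi>lim: "\<And>t. wconv (\<lambda>k. \<Psi>n (r k) t) (\<Psi> t)"
    by (rule MB.subseq[of \<Psi>n, OF \<Psi>nC]) (rule that; assumption)
  have rt: "filterlim r at_top sequentially" by (rule filterlim_subseq[OF r])
  have \<Psi>p: "\<Psi> t \<in> borel_probs" for t using \<Psi>C[of t] by (simp add: C_def)
  have \<Psi>n_marg: "marg (\<Psi>n n t) = xin n t" for n t unfolding \<Psi>n_def by (rule marg_joint[OF xin(2) ln])
  have mlim: "wconv (\<lambda>k. xin (r k) t) (marg (\<Psi> t))" for t using wconv_marg[OF \<Psi>lim[of t]] by (simp add: \<Psi>n_marg)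
  have stepn: "\<Xi>n n (Suc t) = next_law P t (\<Psi>n n t)" if t: "t \<in> J" for n t
  proof -
    have "\<Xi>n n (Suc t) = step (e n) (\<Xi>n n) (Suc t)" by (simp add: \<Xi>n(2))
    also have "\<dots> = next_law P t (law (e n) t (\<Xi>n n))" using t T by (auto simp: step_def J_def)
    finally show ?thesis using t by (simp add: \<Psi>n_def law_def xin_def ln_def)
  qed
  have nlim: "wconv (\<lambda>k. \<Xi>n (r k) (Suc t)) (next_law P t (\<Psi> t))" if t: "t \<in> J" for t
    using next_law_tendsto[OF _ \<Psi>lim[of t]] t by (simp add: stepn[OF t] J_def)
  have flow: "mean_field_flow T P \<xi>0 \<Psi>"
    unfolding mean_field_flow_def
  proof (intro conjI ballI)
    show "\<Psi> t \<in> borel_probs" for t by (rule \<Psi>p)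
    have "step (e n) (\<Xi>n n) 1 = \<xi>0" for n by (simp add: step_def)
    then have "\<Xi>n n 1 = \<xi>0" for n by (simp add: \<Xi>n(2))
    then have "xin n 1 = \<xi>0" for n by (simp add: xin_def)
    then show "marg (\<Psi> 1) = \<xi>0" using wconv_unique[OF mlim[of 1]] wconv_const[OF \<xi>0] by auto
    fix t assume "t \<in> {1..T-2}"
    then have t: "t \<in> J" "Suc t \<in> J" by (auto simp: J_def)
    have "wconv (\<lambda>k. \<Xi>n (r k) (Suc t)) (marg (\<Psi> (Suc t)))" using mlim[of "Suc t"] t by (simp add: xin_def)
    from wconv_unique[OF this nlim[OF t(1)]] show "marg (\<Psi> (t + 1)) = next_law P t (\<Psi> t)" by simp
  qed
  \<comment> \<open>the limit laws, including the terminal one\<close>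
  define \<Xi> where "\<Xi> t = (if t \<in> J then marg (\<Psi> t) else next_law P (T - 1) (\<Psi> (T - 1)))" for t
  have T1: "T - 1 \<in> J" using T by (simp add: J_def)
  have fc: "fconv (\<lambda>k. \<Xi>n (r k)) \<Xi>"
    unfolding fconv_def
  proof
    fix t assume t: "t \<in> {1..T}"
    show "wconv (\<lambda>k. \<Xi>n (r k) t) (\<Xi> t)"
    proof (cases "t \<in> J")
      case True then show ?thesis using mlim[of t] by (simp add: xin_def \<Xi>_def)
    next
      case False
      then have "t = Suc (T - 1)" using t T by (auto simp: J_def)
      then show ?thesis using nlim[OF T1] False by (simp add: \<Xi>_def)
    qed
  qed
  have laws: "laws \<Xi>" by (rule fconv_laws(2)[OF fc])
  have er: "(\<lambda>k. e (r k)) \<longlonglongrightarrow> 0" by (rule filterlim_compose[OF e0 rt])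
  have TJ: "T \<notin> J" using T by (auto simp: J_def)
  have Sval: "S_comp G t T (\<lambda>t. marg (\<Psi> t)) (V_flow T P V \<Psi>) = val t \<Xi>" if "1 \<le> t" for t
  proof -
    have "S_comp G t T (\<lambda>t. marg (\<Psi> t)) = S_comp G t T \<Xi>"
      by (rule S_comp_cong) (use that in \<open>auto simp: \<Xi>_def J_def\<close>)
    moreover have "V_flow T P V \<Psi> = (\<lambda>x. V (x, \<Xi> T))" using TJ by (simp add: V_flow_def[abs_def] \<Xi>_def)
    ultimately show ?thesis by (simp add: val_def)
  qed
  have zero: "(\<integral>x. (S_pol G t (marg (\<Psi> t)) (pol (\<Psi> t)) (val (Suc t) \<Xi>) x - val t \<Xi> x) \<partial>marg (\<Psi> t)) = 0" if t: "t \<in> J" for t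
  proof -
    have tT: "t \<in> {1..T-1}" using t by (simp add: J_def)
    note rg = regular_Suc[OF tT]
    have "disintegrates (\<Psi> t) (pol (\<Psi> t))"
      unfolding pol_def by (rule someI_ex[OF disintegration_exists[OF A_compact \<Psi>p]])
    note dis = disintegrates_imp_joint[OF \<Psi>p this]
    have "AE x in marg (\<Psi> t). pol (\<Psi> t) x \<in> {\<mu>. minimiser 0 t \<Xi> x \<mu>}"
    proof (rule limit_kernel_in_convex[OF A_compact _ xin(2) ln marg_borel_probs(3)[OF \<Psi>p] dis(1)])
      show "wconv (\<lambda>k. joint (xin (r k) t) (ln (r k) t)) (joint (marg (\<Psi> t)) (pol (\<Psi> t)))"
        using \<Psi>lim[of t] unfolding \<Psi>n_def dis(2)[symmetric] .
      show "wcompact {\<mu>. minimiser 0 t \<Xi> x \<mu>}" for x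
        unfolding wcompact_def
      proof (intro conjI allI impI)
        show "{\<mu>. minimiser 0 t \<Xi> x \<mu>} \<subseteq> borel_probs" by (auto simp: minimiser_def)
        fix M :: "nat \<Rightarrow> 'a measure" assume "\<forall>n. M n \<in> {\<mu>. minimiser 0 t \<Xi> x \<mu>}"
        then have M: "\<And>n. M n \<in> borel_probs" "\<And>n \<nu>. \<nu> \<in> borel_probs \<Longrightarrow> cost 0 t \<Xi> x (M n) \<le> cost 0 t \<Xi> x \<nu>"
          by (auto simp: minimiser_def)
        obtain q N where q: "strict_mono (q :: nat \<Rightarrow> nat)" "N \<in> borel_probs" "wconv (\<lambda>k. M (q k)) N"
          by (rule wcompact_subseq[OF K_A M(1)])
        have "(\<lambda>k. cost 0 t \<Xi> x (M (q k))) \<longlonglongrightarrow> cost 0 t \<Xi> x N"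
          by (rule cost_tendsto[OF tT rg tendsto_const fconv_const[OF laws] tendsto_const q(3)])
        then have "cost 0 t \<Xi> x N \<le> cost 0 t \<Xi> x \<nu>" if "\<nu> \<in> borel_probs" for \<nu>
          by (rule LIMSEQ_le_const2) (use M(2)[OF that] in blast)
        then have "minimiser 0 t \<Xi> x N" using q(2) by (simp add: minimiser_def)
        with q show "\<exists>r N. strict_mono r \<and> N \<in> {\<mu>. minimiser 0 t \<Xi> x \<mu>} \<and> wconv (\<lambda>k. M (r k)) N" by blast
      qed
      show "mixture \<gamma> M N \<in> {\<mu>. minimiser 0 t \<Xi> x \<mu>}"
        if "M \<in> {\<mu>. minimiser 0 t \<Xi> x \<mu>}" "N \<in> {\<mu>. minimiser 0 t \<Xi> x \<mu>}" "0 < \<gamma>" "\<gamma> < 1" for x M N \<gamma>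
      proof -
        have MN: "M \<in> borel_probs" "N \<in> borel_probs"
          "\<And>\<nu>. \<nu> \<in> borel_probs \<Longrightarrow> cost 0 t \<Xi> x M \<le> cost 0 t \<Xi> x \<nu>" "\<And>\<nu>. \<nu> \<in> borel_probs \<Longrightarrow> cost 0 t \<Xi> x N \<le> cost 0 t \<Xi> x \<nu>"
          using that(1,2) by (auto simp: minimiser_def)
        have mx: "mixture \<gamma> M N \<in> borel_probs" by (rule mixture_eq_bind(2)[OF MN(1,2)]) (use that in auto)
        have "cost 0 t \<Xi> x (mixture \<gamma> M N) \<le> \<gamma> * cost 0 t \<Xi> x M + (1 - \<gamma>) * cost 0 t \<Xi> x N"
          using G_convex[OF tT laws_probs[OF laws tT] MN(1,2) val_Bb[OF rg laws] that(3,4)] by (simp add: cost_def)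
        also have "\<dots> \<le> \<gamma> * cost 0 t \<Xi> x \<nu> + (1 - \<gamma>) * cost 0 t \<Xi> x \<nu>" if \<nu>: "\<nu> \<in> borel_probs" for \<nu>
          using MN(3,4)[OF \<nu>] \<open>0 < \<gamma>\<close> \<open>\<gamma> < 1\<close> by (intro add_mono mult_left_mono) auto
        finally have "cost 0 t \<Xi> x (mixture \<gamma> M N) \<le> cost 0 t \<Xi> x \<nu>" if "\<nu> \<in> borel_probs" for \<nu>
          using that by (simp add: algebra_simps)
        then show ?thesis using mx by (simp add: minimiser_def)
      qed
      fix q xs x M assume q: "filterlim q at_top sequentially" and x: "xs \<longlonglongrightarrow> x"
        and w: "wconv (\<lambda>k. ln (r (q k)) t (xs k)) M"
      interpret gamma_limit "\<lambda>k. cost (e (r (q k))) t (\<Xi>n (r (q k))) (xs k)" "cost 0 t \<Xi> x" "\<lambda>k. best (e (r (q k))) t (\<Xi>n (r (q k))) (xs k)"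
        by (rule gamma_limit_cost[OF tT rg filterlim_compose[OF er q] fconv_compose[OF fc q] x])
      have "wconv (\<lambda>k. best (e (r (q k))) t (\<Xi>n (r (q k))) (xs k)) M" using w t by (simp add: ln_def)
      from limit_minimiser[OF filterlim_ident this] show "M \<in> {\<mu>. minimiser 0 t \<Xi> x \<mu>}"
        using w by (simp add: minimiser_def wconv_def)
    qed
    then have "AE x in marg (\<Psi> t). S_pol G t (marg (\<Psi> t)) (pol (\<Psi> t)) (val (Suc t) \<Xi>) x - val t \<Xi> x = 0"
    proof (rule AE_mp, intro AE_I2 impI)
      fix x assume "pol (\<Psi> t) x \<in> {\<mu>. minimiser 0 t \<Xi> x \<mu>}"
      then show "S_pol G t (marg (\<Psi> t)) (pol (\<Psi> t)) (val (Suc t) \<Xi>) x - val t \<Xi> x = 0"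
        using val_eq_cost[OF tT] t by (simp add: S_pol_def \<Xi>_def)
    qed
    then show ?thesis by (rule integral_eq_zero_AE)
  qed
  have "mf_exploitability T P G cbar \<Psi> V = 0"
    unfolding mf_exploitability_def Let_def
  proof (rule sum.neutral, intro ballI)
    fix t assume t: "t \<in> {1..T-1}"
    then have "(\<integral>x. (S_pol G t (marg (\<Psi> t)) (pol (\<Psi> t)) (S_comp G (t + 1) T (\<lambda>t. marg (\<Psi> t)) (V_flow T P V \<Psi>)) x
              - S_comp G t T (\<lambda>t. marg (\<Psi> t)) (V_flow T P V \<Psi>) x) \<partial>marg (\<Psi> t)) = 0"
      using zero[of t] Sval[of t] Sval[of "t + 1"] by (simp add: J_def)
    then show "cbar ^ t * (\<integral>x. (S_pol G t (marg (\<Psi> t)) (pol (\<Psi> t)) (S_comp G (t + 1) T (\<lambda>t. marg (\<Psi> t)) (V_flow T P V \<Psi>)) x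
              - S_comp G t T (\<lambda>t. marg (\<Psi> t)) (V_flow T P V \<Psi>) x) \<partial>marg (\<Psi> t)) = 0" by simp
  qed
  with flow show ?thesis by blast
qed

end

theorem theorem6p1:
  fixes T :: nat
    and P :: "nat \<Rightarrow> 'x::polish_space \<Rightarrow> 'x measure \<Rightarrow> 'a::polish_space \<Rightarrow> 'x measure"
    and \<xi>0 :: "'x measure"
    and G :: "nat \<Rightarrow> 'x measure \<Rightarrow> 'a measure \<Rightarrow> ('x \<Rightarrow> real) \<Rightarrow> 'x \<Rightarrow> real"
    and G0 :: "('x \<Rightarrow> real) \<Rightarrow> real"
    and V :: "'x \<times> 'x measure \<Rightarrow> real"
    and c0 c1 cbar ccheck :: real
    and K :: "nat \<Rightarrow> 'x set"
    and \<sigma> :: "'x \<Rightarrow> real"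
  assumes T: "T \<ge> 2"
    and P_kernel: "\<And>t. t \<in> {1..T-1} \<Longrightarrow>
      (\<lambda>(x, \<xi>, a). P t x \<xi> a) \<in>
        measurable (borel_of (prod_topology euclidean (prod_topology weak_topology euclidean)))
          (borel_of weak_topology)"
    and \<xi>0: "\<xi>0 \<in> borel_probs"
    and G_Bb: "\<And>t \<xi> l v. t \<in> {1..T-1} \<Longrightarrow> \<xi> \<in> borel_probs \<Longrightarrow> l \<in> borel_probs \<Longrightarrow> v \<in> Bb \<Longrightarrow>
      G t \<xi> l v \<in> Bb"
    and G_borel: "\<And>t v. t \<in> {1..T-1} \<Longrightarrow> v \<in> Bb \<Longrightarrow>
      (\<lambda>(x, \<xi>, l). G t \<xi> l v x) \<in>
        borel_measurable
          (borel_of (prod_topology euclidean (prod_topology weak_topology weak_topology)))"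
    and V: "V \<in> Cb (prod_topology euclidean weak_topology)"
    and A_compact: "compact (UNIV :: 'a set)"
    and G0_mono: "mono_on Bb G0"
    and G_mono: "\<And>t \<xi> l. t \<in> {1..T-1} \<Longrightarrow> \<xi> \<in> borel_probs \<Longrightarrow> l \<in> borel_probs \<Longrightarrow>
      mono_on Bb (G t \<xi> l)"
    and c0: "c0 > 0" and c1: "c1 > 0"
    and G_growth: "\<And>t \<xi> l v. t \<in> {1..T-1} \<Longrightarrow> \<xi> \<in> borel_probs \<Longrightarrow> l \<in> borel_probs \<Longrightarrow> v \<in> Bb \<Longrightarrow>
      sup_norm (G t \<xi> l v) \<le> c0 + c1 * sup_norm v"
    and cbar: "cbar > 0"
    and G0_lipschitz: "\<And>v v'. v \<in> Bb \<Longrightarrow> v' \<in> Bb \<Longrightarrow>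
      \<bar>G0 v - G0 v'\<bar> \<le> cbar * (\<integral>y. \<bar>v y - v' y\<bar> \<partial>\<xi>0)"
    and G_lipschitz: "\<And>t \<xi> l x v v'. t \<in> {1..T-1} \<Longrightarrow> \<xi> \<in> borel_probs \<Longrightarrow> l \<in> borel_probs \<Longrightarrow>
      v \<in> Bb \<Longrightarrow> v' \<in> Bb \<Longrightarrow>
      \<bar>G t \<xi> l v x - G t \<xi> l v' x\<bar> \<le> cbar * (\<integral>y. \<bar>v y - v' y\<bar> \<partial>Q P t x \<xi> l)"
    and G_convex: "\<And>t \<xi> l l' v \<gamma> x. t \<in> {1..T-1} \<Longrightarrow> \<xi> \<in> borel_probs \<Longrightarrow>
      l \<in> borel_probs \<Longrightarrow> l' \<in> borel_probs \<Longrightarrow> v \<in> Bb \<Longrightarrow> 0 < \<gamma> \<Longrightarrow> \<gamma> < 1 \<Longrightarrow>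
      G t \<xi> (mixture \<gamma> l l') v x \<le> \<gamma> * G t \<xi> l v x + (1 - \<gamma>) * G t \<xi> l' v x"
    and K_incseq: "incseq K"
    and K_compact: "\<And>i. compact (K i)"
    and ccheck: "ccheck \<ge> 1"
    and \<sigma>_cont: "continuous_on UNIV \<sigma>"
    and \<sigma>_inf: "\<And>i. (INF x\<in>- K i. ereal (\<sigma> x)) \<ge> ereal (real i)"
    and \<sigma>_init: "integrable \<xi>0 \<sigma>" "(\<integral>y. \<sigma> y \<partial>\<xi>0) \<le> ccheck"
    and \<sigma>_step: "\<And>t x \<xi> a. t \<in> {1..T-1} \<Longrightarrow> \<xi> \<in> borel_probs \<Longrightarrow>
      integrable (P t x \<xi> a) \<sigma> \<and> (\<integral>y. \<sigma> y \<partial>P t x \<xi> a) \<le> ccheck * \<sigma> x"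
    and P_cont: "\<And>t. t \<in> {1..T-1} \<Longrightarrow>
      continuous_map (prod_topology euclidean (prod_topology weak_topology euclidean))
        weak_topology (\<lambda>(x, \<xi>, a). P t x \<xi> a)"
    and G_cont: "\<And>t v. t \<in> {1..T-1} \<Longrightarrow> v \<in> Cb euclidean \<Longrightarrow>
      continuous_map (prod_topology euclidean (prod_topology weak_topology weak_topology))
        euclideanreal (\<lambda>(x, \<xi>, l). G t \<xi> l v x)"
  shows "\<exists>\<Psi>. mean_field_flow T P \<xi>0 \<Psi> \<and> mf_exploitability T P G cbar \<Psi> V = 0"
proof -
  have big: "real i \<le> \<sigma> x" if "x \<notin> K i" for i x
  proof -
    have "ereal (real i) \<le> (INF x\<in>- K i. ereal (\<sigma> x))" by (rule \<sigma>_inf)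
    also have "\<dots> \<le> ereal (\<sigma> x)" by (rule INF_lower) (use that in simp)
    finally show ?thesis by simp
  qed
  \<comment> \<open>\<open>\<sigma>\<close> is bounded below by compactness of \<open>K 0\<close>\<close>
  obtain b where b: "0 \<le> b" "\<And>x. 0 \<le> \<sigma> x + b"
  proof -
    have "bounded (\<sigma> ` K 0)"
      by (rule compact_imp_bounded[OF compact_continuous_image[OF continuous_on_subset[OF \<sigma>_cont] K_compact]]) simp
    then obtain c where c: "\<And>x. x \<in> K 0 \<Longrightarrow> \<bar>\<sigma> x\<bar> \<le> c" by (auto simp: bounded_iff)
    have "0 \<le> \<sigma> x + \<bar>c\<bar>" for x
    proof (cases "x \<in> K 0")
      case True then show ?thesis using c[of x] by linarith
    next
      case False then show ?thesis using big[of x 0] by simp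
    qed
    then show ?thesis using that[of "\<bar>c\<bar>"] by simp
  qed
  define \<tau> where "\<tau> x = \<sigma> x + b" for x
  have moment: "(\<integral>\<^sup>+x. ennreal (\<tau> x) \<partial>M) = ennreal ((\<integral>x. \<sigma> x \<partial>M) + b)"
    if M: "M \<in> borel_probs" and i: "integrable M \<sigma>" for M
  proof -
    interpret prob_space M using borel_probsD(1)[OF M] .
    have "integrable M \<tau>" unfolding \<tau>_def using i by simp
    then have "(\<integral>\<^sup>+x. ennreal (\<tau> x) \<partial>M) = ennreal (\<integral>x. \<tau> x \<partial>M)"
      by (rule nn_integral_eq_integral) (simp add: \<tau>_def b)
    then show ?thesis unfolding \<tau>_def using i by (simp add: prob_space)
  qed
  interpret mean_field_game T P \<xi>0 G V c0 c1 cbar ccheck K \<tau> "ccheck + b"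
  proof
    show "continuous_on UNIV \<tau>" unfolding \<tau>_def by (intro continuous_intros \<sigma>_cont)
    show "0 \<le> \<tau> x" for x using b(2) by (simp add: \<tau>_def)
    show "real i \<le> \<tau> x" if "x \<notin> K i" for i x using big[OF that] b(1) by (simp add: \<tau>_def)
    show "0 \<le> ccheck + b" using ccheck b(1) by simp
    show "(\<integral>\<^sup>+x. ennreal (\<tau> x) \<partial>\<xi>0) \<le> ennreal (ccheck + b)"
      unfolding moment[OF \<xi>0 \<sigma>_init(1)] using \<sigma>_init(2) by (intro ennreal_leI) simp
    show "(\<integral>\<^sup>+y. ennreal (\<tau> y) \<partial>P t x \<xi> a) \<le> ennreal ccheck * ennreal (\<tau> x)"
      if t: "t \<in> {1..T-1}" and \<xi>: "\<xi> \<in> borel_probs" for t x \<xi> a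
    proof -
      have "P t x \<xi> a \<in> borel_probs"
        using continuous_map_image_subset_topspace[OF P_cont[OF t]] \<xi> by (auto simp: topspace_weak image_subset_iff)
      then have "(\<integral>\<^sup>+y. ennreal (\<tau> y) \<partial>P t x \<xi> a) = ennreal ((\<integral>y. \<sigma> y \<partial>P t x \<xi> a) + b)"
        by (rule moment) (use \<sigma>_step[OF t \<xi>] in blast)
      also have "\<dots> \<le> ennreal (ccheck * \<tau> x)"
      proof (rule ennreal_leI)
        have "(\<integral>y. \<sigma> y \<partial>P t x \<xi> a) \<le> ccheck * \<sigma> x" using \<sigma>_step[OF t \<xi>] by blast
        moreover have "1 * b \<le> ccheck * b" using ccheck b(1) by (rule mult_right_mono)
        ultimately show "(\<integral>y. \<sigma> y \<partial>P t x \<xi> a) + b \<le> ccheck * \<tau> x" by (simp add: \<tau>_def algebra_simps)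
      qed
      also have "\<dots> = ennreal ccheck * ennreal (\<tau> x)"
        using ccheck b(2)[of x] by (intro ennreal_mult) (auto simp: \<tau>_def)
      finally show ?thesis .
    qed
  qed (fact T \<xi>0 G_Bb V A_compact c1 G_growth G_lipschitz G_convex K_incseq K_compact ccheck P_cont G_cont)+
  show ?thesis by (rule equilibrium_exists)
qed

end
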